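(* Let $q\in(1,M+1]$ and write $(\alpha_i)=\alpha(q)$. (i) If $q=M+1$, then $\overline{\mathcal U_q}=\mathcal V_q=J_q=[0,1]$. (ii) If $q\in\overline{\mathcal U}\setminus\{M+1\}$, then $J_q\setminus\overline{\mathcal U_q}=J_q\setminus\mathcal V_q$ is the union of infinitely many disjoint open intervals $(x_L,x_R)$ (its connected components); $x_L$ runs over $A_q$ and $x_R$ runs over $B_q$. More precisely, if $b(x_L,q)=b_1\cdots b_n0^\infty$ with $b_n>0$, then $b(x_R,q)=b_1\cdots b_n\overline{\alpha_1\alpha_2\cdots}$. (iii) If $q\in\mathcal V\setminus\overline{\mathcal U}$, then $J_q\setminus\overline{\mathcal U_q}=J_q\setminus\mathcal U_q$ is an open set. Each connected component $(x_L,x_R)$ of $J_q\setminus\mathcal U_q$ contains infinitely many elements of $\mathcal V_q$, forming an increasing sequence $(x_k)_{k=-\infty}^{\infty}$ with $x_k\to x_L$ as $k\to-\infty$ and $x_k\to x_R$ as $k\to\infty$; moreover, for each $m$, if $b(x_m,q)=b_1\cdots b_n0^\infty$ with $b_n>0$, then $a(x_{m+1},q)=b_1\cdots b_n\overline{\alpha_1\alpha_2\cdots}$. (iv) If $q\in(1,\tilde q]$, then $J_q\setminus\mathcal U_q=(0,M/(q-1))$. (v) Let $(q_1,q_2)$ be a connected component of $(1,M+1]\setminus\mathcal V$ with $q_1\neq1$, and let $q\in(q_1,q_2]$. Then $\mathcal U_q'=\mathcal V_{q_1}'$, and the open sets $J_q\setminus\mathcal U_q$ and $J_{q_1}\setminus\mathcal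 V_{q_1}$ are homeomorphic.
   Context: Fix a positive integer $M$, $A=\{0,1,\dots,M\}$, sequences are elements of $A^{\mathbb N}$, ordered lexicographically; $\overline c=M-c$ for digits, digitwise for sequences. A sequence is finite if it has a last nonzero digit, infinite otherwise; doubly infinite if both it and its reflection are infinite. For $q\in(1,M+1]$ an expansion of $x$ in base $q$ is $(c_i)\in A^{\mathbb N}$ with $\sum c_iq^{-i}=x$; $J_q=[0,M/(q-1)]$. $b(x,q)$ (greedy) is the lexicographically largest expansion of $x$, $a(x,q)$ (quasi-greedy) the lexicographically largest infinite expansion; $\alpha(q)=a(1,q)$. $\mathcal U$ (resp. $\mathcal V$) is the set of $q>1$ such that $1$ has a unique expansion (resp. a unique doubly infinite expansion) in base $q$; $\overline{\mathcal U}$ is its closure; $\tilde q=\min\mathcal V$ (explicitly $m+1$ if $M=2m$, $(m+\sqrt{m^2+4m})/2$ if $M=2m-1$). $\mathcal U_q$ is the set of $x\in J_q$ with a unique expansion; for $q<M+1$, $\mathcal V_q$ is the set of $x\in J_q$ with a unique doubly infinite expansion, $\mathcal V_{M+1}=[0,1]$. $\mathcal U_q'$, $\mathcal V_q'$ are the sets of quasi-greedy expansions of elements of $\mathcal U_q$, $\mathcal V_q$. $A_q$ (resp. $B_q$) is the set of $x\in\mathcal V_q\setminus\mathcal U_q$ with finite (resp. infinite) greedy expansion $b(x,q)$. *)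

theory Defs
  imports
    "HOL-Analysis.Analysis"
    "HOL-Library.Fun_Lexorder"
    "HOL-Library.Omega_Words_Fun"
begin

text \<open>
  A sequence over the alphabet \<open>{0..M}\<close> is a function \<open>c :: nat \<Rightarrow> nat\<close> with values at most \<open>M\<close>.
  Indices start at 0: the digit written \<open>c\<^sub>i\<close> (\<open>i \<ge> 1\<close>) on paper is \<open>c (i - 1)\<close>.  The
  lexicographic order is \<^const>\<open>less_fun\<close>; the order symbols on functions denote the pointwise
  order and are not used.
\<close>

definition digit_seqs :: "nat \<Rightarrow> (nat \<Rightarrow> nat) set" where
  "digit_seqs M = {c. \<forall>i. c i \<le> M}"

definition reflect :: "nat \<Rightarrow> (nat \<Rightarrow> nat) \<Rightarrow> nat \<Rightarrow> nat" where
  "reflect M c = (\<lambda>i. M - c i)"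

text \<open>The zero sequence has no last nonzero digit, hence counts as infinite.\<close>

definition finite_seq :: "(nat \<Rightarrow> nat) \<Rightarrow> bool" where
  "finite_seq c \<longleftrightarrow> (\<exists>n. c n \<noteq> 0 \<and> (\<forall>i>n. c i = 0))"

definition doubly_infinite_seq :: "nat \<Rightarrow> (nat \<Rightarrow> nat) \<Rightarrow> bool" where
  "doubly_infinite_seq M c \<longleftrightarrow> \<not> finite_seq c \<and> \<not> finite_seq (reflect M c)"

definition expansions :: "nat \<Rightarrow> real \<Rightarrow> real \<Rightarrow> (nat \<Rightarrow> nat) set" where
  "expansions M q x = {c \<in> digit_seqs M. (\<lambda>i. real (c i) / q ^ Suc i) sums x}"

definition J :: "nat \<Rightarrow> real \<Rightarrow> real set" where
  "J M q = {0 .. real M / (q - 1)}"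

definition lex_greatest :: "(nat \<Rightarrow> nat) set \<Rightarrow> nat \<Rightarrow> nat" where
  "lex_greatest S = (THE c. c \<in> S \<and> (\<forall>d\<in>S. d = c \<or> less_fun d c))"

definition greedy :: "nat \<Rightarrow> real \<Rightarrow> real \<Rightarrow> nat \<Rightarrow> nat" where
  "greedy M q x = lex_greatest (expansions M q x)"

definition quasi_greedy :: "nat \<Rightarrow> real \<Rightarrow> real \<Rightarrow> nat \<Rightarrow> nat" where
  "quasi_greedy M q x = lex_greatest {c \<in> expansions M q x. \<not> finite_seq c}"

definition alpha :: "nat \<Rightarrow> real \<Rightarrow> nat \<Rightarrow> nat" where
  "alpha M q = quasi_greedy M q 1"

text \<open>
  No upper bound on \<open>q\<close> is needed in the next two definitions: for \<open>q > M + 1\<close> the number 1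
  exceeds \<open>M / (q - 1)\<close> and has no expansion at all.
\<close>

definition U :: "nat \<Rightarrow> real set" where
  "U M = {q. q > 1 \<and> (\<exists>!c. c \<in> expansions M q 1)}"

definition V :: "nat \<Rightarrow> real set" where
  "V M = {q. q > 1 \<and> (\<exists>!c. c \<in> expansions M q 1 \<and> doubly_infinite_seq M c)}"

definition q_tilde :: "nat \<Rightarrow> real" where
  "q_tilde M = (LEAST q. q \<in> V M)"

definition Uq :: "nat \<Rightarrow> real \<Rightarrow> real set" where
  "Uq M q = {x \<in> J M q. \<exists>!c. c \<in> expansions M q x}"

text \<open>
  The base \<open>M + 1\<close> is exceptional by convention: there the interior points with a finite expansion
  have no doubly infinite expansion.
\<close>

definition Vq :: "nat \<Rightarrow> real \<Rightarrow> real set" where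
  "Vq M q =
    (if q = real M + 1 then {0..1}
     else {x \<in> J M q. \<exists>!c. c \<in> expansions M q x \<and> doubly_infinite_seq M c})"

definition Uq' :: "nat \<Rightarrow> real \<Rightarrow> (nat \<Rightarrow> nat) set" where
  "Uq' M q = quasi_greedy M q ` Uq M q"

definition Vq' :: "nat \<Rightarrow> real \<Rightarrow> (nat \<Rightarrow> nat) set" where
  "Vq' M q = quasi_greedy M q ` Vq M q"

definition Aq :: "nat \<Rightarrow> real \<Rightarrow> real set" where
  "Aq M q = {x \<in> Vq M q - Uq M q. finite_seq (greedy M q x)}"

definition Bq :: "nat \<Rightarrow> real \<Rightarrow> real set" where
  "Bq M q = {x \<in> Vq M q - Uq M q. \<not> finite_seq (greedy M q x)}"

end

theory Submission
  imports Defs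
begin

text \<open>
  On quasi-greedy sequences evaluation in base \<open>q\<close> is strictly increasing, and membership in \<open>U\<^sub>q\<close> and
  \<open>V\<^sub>q\<close> amounts to comparing the tails of a sequence and of its reflection with \<open>\<alpha>(q)\<close>, strictly and
  weakly.  Hence, for \<open>q \<in> V\<close>, the complement of \<open>V\<^sub>q\<close> is read off from the first digit at which the
  quasi-greedy expansion violates the lower bound: cutting there yields \<open>x\<^sub>L = b\<^sub>1 \<dots> b\<^sub>n 0\<^sup>\<infinity>\<close>, and
  appending the reflection of \<open>\<alpha>(q)\<close> yields \<open>x\<^sub>R\<close>.  The closure of \<open>U\<close> consists of the \<open>q \<in> V\<close> for which
  no tail of \<open>\<alpha>(q)\<close> is the reflection of \<open>\<alpha>(q)\<close>; then elements of \<open>V\<^sub>q\<close> are limits of elements of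
  \<open>U\<^sub>q\<close>, obtained by replacing the final \<open>\<alpha>(q)\<close> by \<open>(\<alpha>\<^sub>1 \<dots> \<alpha>\<^sub>m\<^sup>-)\<^sup>\<infinity>\<close>.  Otherwise every point of
  \<open>V\<^sub>q\<close> outside \<open>U\<^sub>q\<close> is an endpoint of two such intervals.  For (v), a left endpoint \<open>q\<^sub>1\<close> has a
  periodic \<open>\<alpha>(q\<^sub>1)\<close> with period \<open>w\<^sup>-\<close>, and the sequences admissible for \<open>(w w')\<^sup>\<infinity>\<close>, where \<open>w'\<close> is the
  reflection of \<open>w\<close>, are the same as for \<open>\<alpha>(q\<^sub>1)\<close>; the order isomorphism between \<open>U\<^sub>q\<close> and \<open>V\<close> of
  the base \<open>q\<^sub>1\<close> extends affinely over the gaps.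
\<close>

section \<open>Lexicographic order\<close>

text \<open>Long common prefixes force close values, but close values force long common prefixes
  only on one side: \<open>quasi_agree_left\<close> compares a quasi-greedy sequence with a larger
  one. For points x the other side comes from reflection, which sends x to M/(q-1) - x. Bases have
  no such symmetry: as p increases to q, \<alpha>(p) tends to \<alpha>(q), while as p decreases to q
  it tends to the greedy expansion of 1, a different sequence when that expansion is finite. Hence
  limits of bases are treated separately from the left and from the right.

  Strict inequalities are passed to nearby sequences by recording the prefix that decides them.
  Constructions that change a digit therefore choose a cut long enough for the relevant comparisons
  to be decided within it.

  The split between (ii) and (iii) has a combinatorial cause. A point of V_q outside U_q has a tail
  \<alpha> or a tail whose reflection is \<alpha>. If some tail of \<alpha> is the reflection of
  \<alpha>, each of the two produces the other further on, so the point ends one gap and begins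
  another; otherwise they exclude each other and the point is an endpoint of one gap only.\<close>

notation less_fun (infix "\<sqsubset>" 50)

definition lex_le :: "(nat \<Rightarrow> nat) \<Rightarrow> (nat \<Rightarrow> nat) \<Rightarrow> bool" (infix "\<sqsubseteq>" 50) where
  "f \<sqsubseteq> g \<longleftrightarrow> f = g \<or> f \<sqsubset> g"

definition agree :: "nat \<Rightarrow> (nat \<Rightarrow> nat) \<Rightarrow> (nat \<Rightarrow> nat) \<Rightarrow> bool" where
  "agree n f g \<longleftrightarrow> (\<forall>i<n. f i = g i)"

text \<open>A strict comparison decided within the first \<open>n\<close> digits. Unlike
  \<open>\<sqsubset>\<close> it survives every change of later digits (\<open>below_cong\<close>),
  so it can be transferred to approximating sequences.\<close>

definition below :: "nat \<Rightarrow> (nat \<Rightarrow> nat) \<Rightarrow> (nat \<Rightarrow> nat) \<Rightarrow> bool" where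
  "below n f g \<longleftrightarrow> (\<exists>k<n. f k < g k \<and> agree k f g)"

lemma less_fun_agree: "f \<sqsubset> g \<longleftrightarrow> (\<exists>k. f k < g k \<and> agree k f g)"
  by (simp add: less_fun_def agree_def)

lemma agreeD: "agree n f g \<Longrightarrow> i < n \<Longrightarrow> f i = g i"
  by (simp add: agree_def)

lemma agree_mono: "agree n f g \<Longrightarrow> m \<le> n \<Longrightarrow> agree m f g"
  by (simp add: agree_def)

lemma agree_0 [simp]: "agree 0 f g"
  by (simp add: agree_def)

lemma agree_refl [simp]: "agree n f f"
  by (simp add: agree_def)

lemma agree_sym: "agree n f g \<Longrightarrow> agree n g f"
  by (simp add: agree_def)

lemma agree_trans [trans]: "agree n f g \<Longrightarrow> agree n g h \<Longrightarrow> agree n f h"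
  by (simp add: agree_def)

lemma agree_Suc: "agree (Suc n) f g \<longleftrightarrow> agree n f g \<and> f n = g n"
  by (auto simp: agree_def less_Suc_eq)

lemma agree_suffix: "agree n f g \<Longrightarrow> k + m \<le> n \<Longrightarrow> agree m (suffix k f) (suffix k g)"
  by (simp add: agree_def)

lemma agree_add: "agree (m + n) f g \<longleftrightarrow> agree m f g \<and> agree n (suffix m f) (suffix m g)"
proof
  assume *: "agree m f g \<and> agree n (suffix m f) (suffix m g)"
  show "agree (m + n) f g"
    unfolding agree_def
  proof (intro allI impI)
    fix i assume "i < m + n"
    then show "f i = g i"
      using * agreeD[of m f g i] agreeD[of n "suffix m f" "suffix m g" "i - m"]
      by (cases "i < m") auto
  qed
qed (auto simp: agree_def)

lemma agree_all: "(\<And>n. agree n f g) \<Longrightarrow> f = g"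
  by (auto simp: agree_def)

lemma agree_suffix_eq: "agree n f g \<Longrightarrow> suffix n f = suffix n g \<Longrightarrow> f = g"
proof
  fix i
  assume *: "agree n f g" "suffix n f = suffix n g"
  show "f i = g i"
  proof (cases "i < n")
    case False
    then show ?thesis using fun_cong[OF *(2), of "i - n"] by simp
  qed (use * in \<open>simp add: agree_def\<close>)
qed

lemma first_difference:
  assumes "f \<noteq> g" obtains k where "f k \<noteq> g k" "agree k f g"
proof -
  have "\<exists>k. f k \<noteq> g k" using assms by auto
  then show ?thesis
    using that[of "LEAST k. f k \<noteq> g k"] LeastI_ex[of "\<lambda>k. f k \<noteq> g k"] not_less_Least
    unfolding agree_def by blast
qed

interpretation lex: linorder lex_le less_fun
proof -
  have total: "f \<sqsubseteq> g \<or> g \<sqsubseteq> f" for f g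
  proof (cases "f = g")
    case False
    then obtain k where "f k \<noteq> g k" "agree k f g" by (rule first_difference)
    then show ?thesis
      unfolding lex_le_def less_fun_agree using agree_sym linorder_neq_iff by metis
  qed (simp add: lex_le_def)
  show "class.linorder lex_le less_fun"
    using total
    by unfold_locales
      (auto simp: lex_le_def less_fun_irrefl dest: less_fun_asym intro: less_fun_trans)
qed

lemma less_fun_first: "f \<sqsubset> g \<Longrightarrow> agree k f g \<Longrightarrow> f k \<noteq> g k \<Longrightarrow> f k < g k"
  unfolding less_fun_agree agree_def by (metis linorder_neqE_nat order_less_not_sym)

lemma below_imp_less: "below n f g \<Longrightarrow> f \<sqsubset> g"
  by (auto simp: below_def less_fun_agree)

lemma below_mono: "below n f g \<Longrightarrow> n \<le> m \<Longrightarrow> below m f g"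
  unfolding below_def by (meson order_less_le_trans)

lemma less_fun_split: "f \<sqsubset> g \<longleftrightarrow> below n f g \<or> agree n f g \<and> suffix n f \<sqsubset> suffix n g"
proof
  assume "f \<sqsubset> g"
  then obtain k where k: "f k < g k" "agree k f g" by (auto simp: less_fun_agree)
  show "below n f g \<or> agree n f g \<and> suffix n f \<sqsubset> suffix n g"
  proof (cases "k < n")
    case True then show ?thesis using k by (auto simp: below_def)
  next
    case False
    then have "agree n f g" "suffix n f (k - n) < suffix n g (k - n)"
      "agree (k - n) (suffix n f) (suffix n g)"
      using k by (auto intro: agree_mono agree_suffix)
    then show ?thesis by (auto simp: less_fun_agree)
  qed
next
  assume "below n f g \<or> agree n f g \<and> suffix n f \<sqsubset> suffix n g"
  then show "f \<sqsubset> g"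
  proof
    assume *: "agree n f g \<and> suffix n f \<sqsubset> suffix n g"
    then obtain k where "f (n + k) < g (n + k)" "agree k (suffix n f) (suffix n g)"
      by (auto simp: less_fun_agree)
    then show ?thesis using * agree_add less_fun_agree by metis
  qed (rule below_imp_less)
qed

lemma lex_le_split: "f \<sqsubseteq> g \<longleftrightarrow> below n f g \<or> agree n f g \<and> suffix n f \<sqsubseteq> suffix n g"
  unfolding lex_le_def less_fun_split[of f g n] using agree_suffix_eq agree_refl by metis

lemma less_fun_suffix: "agree n f g \<Longrightarrow> suffix n f \<sqsubset> suffix n g \<longleftrightarrow> f \<sqsubset> g"
  unfolding less_fun_split[of f g n] by (auto simp: below_def agree_def)

lemma lex_le_suffix: "agree n f g \<Longrightarrow> suffix n f \<sqsubseteq> suffix n g \<longleftrightarrow> f \<sqsubseteq> g"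
  unfolding lex_le_split[of f g n] by (auto simp: below_def agree_def)

lemma below_cong:
  assumes "agree n f f'" "agree n g g'" shows "below n f g \<longleftrightarrow> below n f' g'"
proof -
  have "f k = f' k \<and> g k = g' k \<and> (agree k f g \<longleftrightarrow> agree k f' g')" if "k < n" for k
    using assms that unfolding agree_def by auto
  then show ?thesis unfolding below_def by auto
qed

lemma lex_le_imp: "f \<sqsubseteq> g \<Longrightarrow> below n f g \<or> agree n f g"
  using lex_le_split by blast

lemma below_not_agree: "below n f g \<Longrightarrow> \<not> agree n f g"
  by (auto simp: below_def agree_def)

lemma below_trans: "below n f g \<Longrightarrow> below n g h \<Longrightarrow> below n f h"
proof -
  assume "below n f g" "below n g h"
  then obtain j k where jk: "j < n" "f j < g j" "agree j f g" "k < n" "g k < h k" "agree k g h"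
    by (auto simp: below_def)
  have "agree (min j k) f h" "min j k < n"
    using jk by (auto simp: agree_def)
  moreover have "f (min j k) < h (min j k)"
    using jk agreeD[of k g h j] agreeD[of j f g k] by (cases j k rule: linorder_cases) auto
  ultimately show ?thesis by (auto simp: below_def)
qed

text \<open>The digit \<open>k\<close> lies inside the compared prefix, so lowering it settles the
  comparison whatever digits follow.\<close>

lemma below_lower:
  assumes "below n f g \<or> agree n f g" "agree k f' f" "f' k < f k" "k < n"
  shows "below n f' g"
proof -
  have "below n f' f" using assms by (auto simp: below_def)
  then show ?thesis using assms(1) below_trans below_cong agree_refl by blast
qed

text \<open>Reflecting a lowered digit raises it. Raising the last compared digit by one can at
  worst turn strictness into equality of the prefixes; this equality has to be treated separately in
  the later uses.\<close>

lemma below_raise: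
  assumes "below (Suc n) f g" "agree n f' f" "f' n \<le> Suc (f n)"
  shows "below (Suc n) f' g \<or> agree (Suc n) f' g"
proof -
  obtain k where k: "k < Suc n" "f k < g k" "agree k f g" using assms(1) by (auto simp: below_def)
  show ?thesis
  proof (cases "k < n")
    case True
    then have "f' k < g k" "agree k f' g"
      using k assms(2) by (auto simp: agree_def)
    then show ?thesis using k(1) by (auto simp: below_def)
  next
    case False
    then have [simp]: "k = n" using k(1) by simp
    have "agree n f' g" using k(3) assms(2) by (auto simp: agree_def)
    moreover have "f' n \<le> g n" using assms(3) k(2) by simp
    ultimately show ?thesis
      unfolding below_def agree_Suc using le_neq_implies_less by blast
  qed
qed

section \<open>Digits, reflection and admissible sequences\<close>

lemma digit_seqs_le: "c \<in> digit_seqs M \<Longrightarrow> c i \<le> M"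
  by (simp add: digit_seqs_def)

lemma suffix_digit_seqs [simp]: "c \<in> digit_seqs M \<Longrightarrow> suffix n c \<in> digit_seqs M"
  by (simp add: digit_seqs_def)

lemma reflect_digit_seqs [simp]: "reflect M c \<in> digit_seqs M"
  by (simp add: digit_seqs_def reflect_def)

lemma reflect_nth: "reflect M c i = M - c i"
  by (simp add: reflect_def)

lemma reflect_reflect [simp]: "c \<in> digit_seqs M \<Longrightarrow> reflect M (reflect M c) = c"
  by (auto simp: digit_seqs_def reflect_def)

lemma suffix_reflect: "suffix n (reflect M c) = reflect M (suffix n c)"
  by (auto simp: reflect_def)

lemma agree_reflect: "agree n f g \<Longrightarrow> agree n (reflect M f) (reflect M g)"
  by (simp add: agree_def reflect_def)

lemma below_reflect:
  "f \<in> digit_seqs M \<Longrightarrow> g \<in> digit_seqs M \<Longrightarrow> below n f g \<Longrightarrow> below n (reflect M g) (reflect M f)"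
proof -
  assume *: "f \<in> digit_seqs M" "g \<in> digit_seqs M" "below n f g"
  then obtain k where k: "k < n" "f k < g k" "agree k f g" by (auto simp: below_def)
  have "M - g k < M - f k" using k digit_seqs_le[OF *(2), of k] by linarith
  then show ?thesis
    using k agree_reflect[OF agree_sym[OF k(3)], of M] by (auto simp: below_def reflect_nth)
qed

lemma reflect_less: "f \<in> digit_seqs M \<Longrightarrow> g \<in> digit_seqs M \<Longrightarrow> f \<sqsubset> g \<Longrightarrow> reflect M g \<sqsubset> reflect M f"
  by (metis below_imp_less below_reflect below_def less_fun_agree lessI)

lemma reflect_less_iff:
  "f \<in> digit_seqs M \<Longrightarrow> g \<in> digit_seqs M \<Longrightarrow> reflect M f \<sqsubset> reflect M g \<longleftrightarrow> g \<sqsubset> f"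
  by (metis reflect_less reflect_reflect reflect_digit_seqs)

lemma reflect_le_iff:
  "f \<in> digit_seqs M \<Longrightarrow> g \<in> digit_seqs M \<Longrightarrow> reflect M f \<sqsubseteq> reflect M g \<longleftrightarrow> g \<sqsubseteq> f"
  by (metis lex.not_le reflect_less_iff)

lemma reflect_less_swap:
  "f \<in> digit_seqs M \<Longrightarrow> g \<in> digit_seqs M \<Longrightarrow> reflect M f \<sqsubset> g \<longleftrightarrow> reflect M g \<sqsubset> f"
  by (metis reflect_less reflect_reflect reflect_digit_seqs)

lemma reflect_le_swap:
  "f \<in> digit_seqs M \<Longrightarrow> g \<in> digit_seqs M \<Longrightarrow> reflect M f \<sqsubseteq> g \<longleftrightarrow> reflect M g \<sqsubseteq> f"
  by (metis reflect_le_iff reflect_reflect reflect_digit_seqs)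

text \<open>
  For \<open>a = \<alpha>(q)\<close> these are the sets \<open>V\<^sub>q'\<close> (if \<open>q < M + 1\<close>) and \<open>U\<^sub>q'\<close>.
\<close>

definition weak_seqs :: "nat \<Rightarrow> (nat \<Rightarrow> nat) \<Rightarrow> (nat \<Rightarrow> nat) set" where
  "weak_seqs M a = {c \<in> digit_seqs M. \<forall>n.
     (c n < M \<longrightarrow> suffix (Suc n) c \<sqsubseteq> a) \<and> (0 < c n \<longrightarrow> reflect M (suffix (Suc n) c) \<sqsubseteq> a)}"

definition strict_seqs :: "nat \<Rightarrow> (nat \<Rightarrow> nat) \<Rightarrow> (nat \<Rightarrow> nat) set" where
  "strict_seqs M a = {c \<in> digit_seqs M. \<forall>n.
     (c n < M \<longrightarrow> suffix (Suc n) c \<sqsubset> a) \<and> (0 < c n \<longrightarrow> reflect M (suffix (Suc n) c) \<sqsubset> a)}"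

lemma weak_seqsD:
  assumes "c \<in> weak_seqs M a"
  shows "c \<in> digit_seqs M" "c n < M \<Longrightarrow> suffix (Suc n) c \<sqsubseteq> a"
    "0 < c n \<Longrightarrow> reflect M (suffix (Suc n) c) \<sqsubseteq> a"
  using assms by (auto simp: weak_seqs_def)

lemma strict_seqsD:
  assumes "c \<in> strict_seqs M a"
  shows "c \<in> digit_seqs M" "c n < M \<Longrightarrow> suffix (Suc n) c \<sqsubset> a"
    "0 < c n \<Longrightarrow> reflect M (suffix (Suc n) c) \<sqsubset> a"
  using assms by (auto simp: strict_seqs_def)

lemma weak_seqs_reflect: "c \<in> weak_seqs M a \<Longrightarrow> reflect M c \<in> weak_seqs M a"
  unfolding weak_seqs_def by (auto simp: suffix_reflect reflect_nth)

lemma strict_seqs_reflect: "c \<in> strict_seqs M a \<Longrightarrow> reflect M c \<in> strict_seqs M a"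
  unfolding strict_seqs_def by (auto simp: suffix_reflect reflect_nth)

lemma strict_seqs_subset: "strict_seqs M a \<subseteq> weak_seqs M a"
  unfolding weak_seqs_def strict_seqs_def by (auto simp: lex.less_imp_le)

lemma strict_seqs_mono: "a \<sqsubseteq> b \<Longrightarrow> strict_seqs M a \<subseteq> strict_seqs M b"
  unfolding strict_seqs_def by (auto intro: lex.less_le_trans)

lemma weak_seqs_strict_seqs: "a \<sqsubset> b \<Longrightarrow> weak_seqs M a \<subseteq> strict_seqs M b"
  unfolding strict_seqs_def weak_seqs_def by (auto intro: lex.le_less_trans)

section \<open>Values of sequences\<close>

definition val :: "real \<Rightarrow> (nat \<Rightarrow> nat) \<Rightarrow> real" where
  "val q c = (\<Sum>i. real (c i) / q ^ Suc i)"

definition psum :: "real \<Rightarrow> nat \<Rightarrow> (nat \<Rightarrow> nat) \<Rightarrow> real" where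
  "psum q n c = (\<Sum>i<n. real (c i) / q ^ Suc i)"

lemma geometric_digit_sums:
  assumes "1 < (q::real)" shows "(\<lambda>i. real M / q ^ Suc i) sums (real M / (q - 1))"
proof -
  have "(\<lambda>i. (real M / q) * (1 / q) ^ i) sums ((real M / q) * (1 / (1 - 1 / q)))"
    using assms by (intro sums_mult geometric_sums) auto
  moreover have "(real M / q) * (1 / (1 - 1 / q)) = real M / (q - 1)"
    using assms by (simp add: field_simps)
  moreover have "(\<lambda>i. (real M / q) * (1 / q) ^ i) = (\<lambda>i. real M / q ^ Suc i)"
    by (simp add: fun_eq_iff power_divide)
  ultimately show ?thesis by metis
qed

lemma summable_digits:
  assumes "1 < q" "c \<in> digit_seqs M" shows "summable (\<lambda>i. real (c i) / q ^ Suc i)"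
proof (rule summable_comparison_test_ev)
  show "\<forall>\<^sub>F i in sequentially. norm (real (c i) / q ^ Suc i) \<le> real M / q ^ Suc i"
    using assms by (intro always_eventually allI)
      (simp add: divide_right_mono digit_seqs_le)
  show "summable (\<lambda>i. real M / q ^ Suc i)"
    using geometric_digit_sums[OF assms(1)] by (rule sums_summable)
qed

lemma val_sums:
  "1 < q \<Longrightarrow> c \<in> digit_seqs M \<Longrightarrow> (\<lambda>i. real (c i) / q ^ Suc i) sums val q c"
  unfolding val_def by (rule summable_sums[OF summable_digits])

lemma expansions_iff:
  assumes "1 < q" shows "c \<in> expansions M q x \<longleftrightarrow> c \<in> digit_seqs M \<and> val q c = x"
  unfolding expansions_def using val_sums[OF assms, of c M] sums_unique2 by auto

lemma val_psum:
  assumes "1 < q" "c \<in> digit_seqs M" shows "val q c = psum q n c + val q (suffix n c) / q ^ n"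
proof -
  have "val q c = (\<Sum>i. real (c (i + n)) / q ^ Suc (i + n)) + psum q n c"
    unfolding val_def psum_def by (rule suminf_split_initial_segment[OF summable_digits[OF assms]])
  also have "(\<Sum>i. real (c (i + n)) / q ^ Suc (i + n)) = (\<Sum>i. real (suffix n c i) / q ^ Suc i / q ^ n)"
    by (simp add: add.commute power_add mult.commute mult.left_commute)
  also have "\<dots> = val q (suffix n c) / q ^ n"
    unfolding val_def by (rule suminf_divide[OF summable_digits[OF assms(1) suffix_digit_seqs[OF assms(2)]]])
  finally show ?thesis by simp
qed

lemma psum_Suc: "psum q (Suc n) c = psum q n c + real (c n) / q ^ Suc n"
  by (simp add: psum_def)

lemma psum_0 [simp]: "psum q 0 c = 0"
  by (simp add: psum_def)

lemma psum_agree: "agree n c d \<Longrightarrow> psum q n c = psum q n d"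
  unfolding psum_def agree_def by (intro sum.cong) auto

lemma val_step:
  assumes "1 < q" "c \<in> digit_seqs M"
  shows "val q c = (real (c 0) + val q (suffix 1 c)) / q"
  using val_psum[OF assms, of 1] assms(1) by (simp add: psum_Suc field_simps)

lemma val_nonneg:
  assumes "1 < q" "c \<in> digit_seqs M" shows "0 \<le> val q c"
  unfolding val_def using assms(1) by (intro suminf_nonneg summable_digits[OF assms]) auto

lemma val_pos:
  assumes "1 < q" "c \<in> digit_seqs M" "c i \<noteq> 0" shows "0 < val q c"
  unfolding val_def using assms(1,3)
  by (intro suminf_pos2[OF summable_digits[OF assms(1,2)], of i]) auto

lemma val_zero [simp]: "val q (\<lambda>_. 0) = 0"
  by (simp add: val_def)

lemma val_reflect:
  assumes "1 < q" "c \<in> digit_seqs M"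
  shows "val q (reflect M c) = real M / (q - 1) - val q c"
proof -
  have "(\<lambda>i. real M / q ^ Suc i - real (c i) / q ^ Suc i) sums (real M / (q - 1) - val q c)"
    by (intro sums_diff geometric_digit_sums val_sums[OF assms] assms(1))
  moreover have "(\<lambda>i. real M / q ^ Suc i - real (c i) / q ^ Suc i) = (\<lambda>i. real (reflect M c i) / q ^ Suc i)"
    using digit_seqs_le[OF assms(2)] by (simp add: fun_eq_iff reflect_nth of_nat_diff diff_divide_distrib)
  ultimately have "(\<lambda>i. real (reflect M c i) / q ^ Suc i) sums (real M / (q - 1) - val q c)" by simp
  then show ?thesis using val_sums[OF assms(1) reflect_digit_seqs] sums_unique2 by blast
qed

lemma val_le:
  assumes "1 < q" "c \<in> digit_seqs M" shows "val q c \<le> real M / (q - 1)"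
  using val_reflect[OF assms] val_nonneg[OF assms(1) reflect_digit_seqs, of M c] by simp

lemma val_in_J: "1 < q \<Longrightarrow> c \<in> digit_seqs M \<Longrightarrow> val q c \<in> J M q"
  by (simp add: J_def val_nonneg val_le)

lemma psum_le_val:
  assumes "1 < q" "c \<in> digit_seqs M" shows "psum q n c \<le> val q c"
  using val_psum[OF assms, of n] val_nonneg[OF assms(1) suffix_digit_seqs[OF assms(2)], of n] assms(1)
  by simp

lemma val_diff_agree:
  assumes "1 < q" "c \<in> digit_seqs M" "d \<in> digit_seqs M" "agree n c d"
  shows "val q d - val q c =
    (real (d n) - real (c n) + val q (suffix (Suc n) d) - val q (suffix (Suc n) c)) / q ^ Suc n"
  using val_psum[OF assms(1,2), of "Suc n"] val_psum[OF assms(1,3), of "Suc n"] psum_agree[OF assms(4), of q]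
  by (simp add: psum_Suc add_divide_distrib diff_divide_distrib)

lemma val_suffix_diff:
  assumes "1 < q" "c \<in> digit_seqs M" "d \<in> digit_seqs M" "agree n c d"
  shows "val q d - val q c = (val q (suffix n d) - val q (suffix n c)) / q ^ n"
  using val_psum[OF assms(1,2), of n] val_psum[OF assms(1,3), of n] psum_agree[OF assms(4), of q]
  by (simp add: diff_divide_distrib)

lemma tendsto_div_power:
  assumes "1 < (q::real)" shows "(\<lambda>n. K / q ^ n) \<longlonglongrightarrow> 0"
  by (rule LIMSEQ_divide_realpow_zero[OF assms])

section \<open>Finite sequences\<close>

lemma finite_seq_suffix:
  assumes "finite_seq c" "suffix n c i \<noteq> 0" shows "finite_seq (suffix n c)"
proof -
  obtain m where m: "c m \<noteq> 0" "\<And>i. i > m \<Longrightarrow> c i = 0" using assms(1) by (auto simp: finite_seq_def)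
  then have "n \<le> m" using assms(2) by (metis suffix_nth le_add1 not_less order_le_less_trans)
  then show ?thesis using m unfolding finite_seq_def
    by (intro exI[of _ "m - n"]) auto
qed

lemma finite_seq_if_suffix:
  assumes "finite_seq (suffix n c)" shows "finite_seq c"
proof -
  obtain m where m: "c (n + m) \<noteq> 0" "\<And>i. i > m \<Longrightarrow> c (n + i) = 0"
    using assms by (auto simp: finite_seq_def)
  have "c i = 0" if "i > n + m" for i
    using m(2)[of "i - n"] that by simp
  then show ?thesis using m(1) unfolding finite_seq_def by blast
qed

lemma not_finite_seq_zero [simp]: "\<not> finite_seq (\<lambda>_. 0)"
  by (simp add: finite_seq_def)

lemma finite_seq_iff: "finite_seq c \<longleftrightarrow> (\<exists>n. c n \<noteq> 0 \<and> suffix (Suc n) c = (\<lambda>_. 0))"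
proof -
  have "(\<forall>i>n. c i = 0) \<longleftrightarrow> suffix (Suc n) c = (\<lambda>_. 0)" for n
  proof
    show "\<forall>i>n. c i = 0" if "suffix (Suc n) c = (\<lambda>_. 0)"
    proof (intro allI impI)
      fix i assume "n < i"
      then show "c i = 0" using fun_cong[OF that, of "i - Suc n"] by simp
    qed
  qed (simp add: fun_eq_iff)
  then show ?thesis by (simp add: finite_seq_def)
qed

lemma not_finite_seqD: "\<not> finite_seq c \<Longrightarrow> c n \<noteq> 0 \<Longrightarrow> \<exists>i. suffix (Suc n) c i \<noteq> 0"
  unfolding finite_seq_iff by (metis ext)

text \<open>Numerical characterisation of the outputs of the quasi-greedy and the greedy algorithm.\<close>

definition quasi_seq :: "nat \<Rightarrow> real \<Rightarrow> (nat \<Rightarrow> nat) \<Rightarrow> bool" where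
  "quasi_seq M q c \<longleftrightarrow> c \<in> digit_seqs M \<and> \<not> finite_seq c
     \<and> (\<forall>n. c n < M \<longrightarrow> val q (suffix (Suc n) c) \<le> 1)"

definition greedy_seq :: "nat \<Rightarrow> real \<Rightarrow> (nat \<Rightarrow> nat) \<Rightarrow> bool" where
  "greedy_seq M q c \<longleftrightarrow> c \<in> digit_seqs M \<and> (\<forall>n. c n < M \<longrightarrow> val q (suffix (Suc n) c) < 1)"

lemma quasi_digits: "quasi_seq M q c \<Longrightarrow> c \<in> digit_seqs M"
  by (simp add: quasi_seq_def)

lemma greedy_seq_digits: "greedy_seq M q c \<Longrightarrow> c \<in> digit_seqs M"
  by (simp add: greedy_seq_def)

section \<open>Monotonicity of evaluation and uniqueness of the greedy sequences\<close>

lemma first_difference_val: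
  assumes q: "1 < q" and c: "c \<in> digit_seqs M" and d: "d \<in> digit_seqs M" and less: "c \<sqsubset> d"
  obtains k where "c k < M" "c k < d k"
    "(1 + val q (suffix (Suc k) d) - val q (suffix (Suc k) c)) / q ^ Suc k \<le> val q d - val q c"
proof -
  obtain k where k: "c k < d k" "agree k c d" using less by (auto simp: less_fun_agree)
  show ?thesis
  proof (rule that[of k])
    show "c k < M" using k(1) digit_seqs_le[OF d, of k] by simp
    show "(1 + val q (suffix (Suc k) d) - val q (suffix (Suc k) c)) / q ^ Suc k \<le> val q d - val q c"
      unfolding val_diff_agree[OF q c d k(2)] using k(1) q by (intro divide_right_mono) auto
  qed (rule k(1))
qed

text \<open>At the first difference \<open>d\<close> gains at least one unit, the tail of
  \<open>c\<close> there is worth at most one unit, and the tail of the infinite sequence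
  \<open>d\<close> is positive. As \<open>d\<close> ranges over all infinite sequences,
  \<open>c\<close> is the largest infinite expansion of its value. In the greedy variant the
  strictness comes from the tail of \<open>c\<close> instead.\<close>

lemma quasi_less_val:
  assumes q: "1 < q" and c: "quasi_seq M q c" and d: "d \<in> digit_seqs M" "\<not> finite_seq d" and less: "c \<sqsubset> d"
  shows "val q c < val q d"
proof -
  obtain k where k: "c k < M" "c k < d k"
    "(1 + val q (suffix (Suc k) d) - val q (suffix (Suc k) c)) / q ^ Suc k \<le> val q d - val q c"
    using first_difference_val[OF q quasi_digits[OF c] d(1) less] .
  obtain i where "suffix (Suc k) d i \<noteq> 0" using not_finite_seqD[OF d(2), of k] k(2) by auto
  then have "0 < val q (suffix (Suc k) d)" by (rule val_pos[OF q suffix_digit_seqs[OF d(1)]])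
  moreover have "val q (suffix (Suc k) c) \<le> 1" using c k(1) by (simp add: quasi_seq_def)
  ultimately have "0 < (1 + val q (suffix (Suc k) d) - val q (suffix (Suc k) c)) / q ^ Suc k"
    using q by (intro divide_pos_pos) auto
  then show ?thesis using k(3) by linarith
qed

lemma greedy_seq_less_val:
  assumes q: "1 < q" and c: "greedy_seq M q c" and d: "d \<in> digit_seqs M" and less: "c \<sqsubset> d"
  shows "val q c < val q d"
proof -
  obtain k where k: "c k < M"
    "(1 + val q (suffix (Suc k) d) - val q (suffix (Suc k) c)) / q ^ Suc k \<le> val q d - val q c"
    using first_difference_val[OF q greedy_seq_digits[OF c] d less] .
  have "0 \<le> val q (suffix (Suc k) d)" by (rule val_nonneg[OF q suffix_digit_seqs[OF d]])
  moreover have "val q (suffix (Suc k) c) < 1" using c k(1) by (simp add: greedy_seq_def)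
  ultimately have "0 < (1 + val q (suffix (Suc k) d) - val q (suffix (Suc k) c)) / q ^ Suc k"
    using q by (intro divide_pos_pos) auto
  then show ?thesis using k(2) by linarith
qed

lemma quasi_le_val:
  assumes q: "1 < q" and c: "quasi_seq M q c" and d: "d \<in> digit_seqs M" and less: "c \<sqsubset> d"
  shows "val q c \<le> val q d"
proof -
  obtain k where k: "c k < M"
    "(1 + val q (suffix (Suc k) d) - val q (suffix (Suc k) c)) / q ^ Suc k \<le> val q d - val q c"
    using first_difference_val[OF q quasi_digits[OF c] d less] .
  have "0 \<le> val q (suffix (Suc k) d)" by (rule val_nonneg[OF q suffix_digit_seqs[OF d]])
  moreover have "val q (suffix (Suc k) c) \<le> 1" using c k(1) by (simp add: quasi_seq_def)
  ultimately have "0 \<le> (1 + val q (suffix (Suc k) d) - val q (suffix (Suc k) c)) / q ^ Suc k"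
    using q by (intro divide_nonneg_pos) auto
  then show ?thesis using k(2) by linarith
qed

lemma quasi_val_less_iff:
  assumes "1 < q" "quasi_seq M q c" "quasi_seq M q d" shows "val q c < val q d \<longleftrightarrow> c \<sqsubset> d"
  using quasi_less_val[OF assms(1,2)] quasi_less_val[OF assms(1,3)] assms(2,3)
  unfolding quasi_seq_def by (metis lex.linorder_cases order_less_asym order_less_irrefl)

lemma quasi_inj: "1 < q \<Longrightarrow> quasi_seq M q c \<Longrightarrow> quasi_seq M q d \<Longrightarrow> val q c = val q d \<Longrightarrow> c = d"
  using quasi_val_less_iff by (metis lex.linorder_cases order_less_irrefl)

lemma lex_greatestI:
  assumes "c \<in> S" "\<And>d. d \<in> S \<Longrightarrow> d \<sqsubseteq> c" shows "lex_greatest S = c"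
  unfolding lex_greatest_def
proof (rule the_equality)
  show "c \<in> S \<and> (\<forall>d\<in>S. d = c \<or> d \<sqsubset> c)" using assms by (auto simp: lex_le_def)
  show "e = c" if "e \<in> S \<and> (\<forall>d\<in>S. d = e \<or> d \<sqsubset> e)" for e
    using that assms unfolding lex_le_def by (metis less_fun_asym)
qed

lemma quasi_greedy_eq:
  assumes "1 < q" "quasi_seq M q c" shows "quasi_greedy M q (val q c) = c"
  unfolding quasi_greedy_def
proof (rule lex_greatestI)
  show "c \<in> {d \<in> expansions M q (val q c). \<not> finite_seq d}"
    using assms by (simp add: expansions_iff quasi_seq_def)
  show "d \<sqsubseteq> c" if "d \<in> {d \<in> expansions M q (val q c). \<not> finite_seq d}" for d
    using that quasi_less_val[OF assms, of d] assms(1)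
    by (metis (no_types, lifting) expansions_iff lex.not_le_imp_less mem_Collect_eq order_less_irrefl)
qed

lemma greedy_eq:
  assumes "1 < q" "greedy_seq M q c" shows "greedy M q (val q c) = c"
  unfolding greedy_def
proof (rule lex_greatestI)
  show "c \<in> expansions M q (val q c)"
    using assms by (simp add: expansions_iff greedy_seq_def)
  show "d \<sqsubseteq> c" if "d \<in> expansions M q (val q c)" for d
    using that greedy_seq_less_val[OF assms, of d] assms(1)
    by (metis expansions_iff lex.not_le_imp_less order_less_irrefl)
qed

section \<open>The quasi-greedy and the greedy algorithm\<close>

fun remainder :: "(real \<Rightarrow> nat) \<Rightarrow> real \<Rightarrow> real \<Rightarrow> nat \<Rightarrow> real" where
  "remainder f q x 0 = x"
| "remainder f q x (Suc n) = q * remainder f q x n - real (f (remainder f q x n))"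

text \<open>Covers both algorithms: \<open>f\<close> chooses the next digit from the remainder and
  \<open>S\<close> is an invariant set of remainders. As \<open>S\<close> is bounded, the remainder
  divided by \<open>q ^ k\<close> tends to 0, so every tail of the digit sequence expands the
  remainder at its place.\<close>

lemma digit_algorithm:
  fixes f :: "real \<Rightarrow> nat" and q x :: real
  assumes q: "1 < q" and le: "\<And>r. f r \<le> M"
    and step: "\<And>r. r \<in> S \<Longrightarrow> q * r - real (f r) \<in> S" and S: "S \<subseteq> J M q" and x: "x \<in> S"
  shows "\<exists>c \<in> digit_seqs M. \<forall>n. val q (suffix n c) \<in> S \<and> c n = f (val q (suffix n c)) \<and> val q c = x"
proof -
  define r where "r = remainder f q x"
  define c where "c = (\<lambda>n. f (r n))"
  have rS: "r n \<in> S" for n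
    by (induction n) (simp_all add: r_def x step)
  have c: "c \<in> digit_seqs M" by (simp add: c_def digit_seqs_def le)
  have sum: "(\<Sum>i<k. real (c (n + i)) / q ^ Suc i) = r n - r (n + k) / q ^ k" for n k
  proof (induction k)
    case (Suc k)
    have "r (n + Suc k) = q * r (n + k) - real (c (n + k))" by (simp add: r_def c_def)
    then have "real (c (n + k)) / q ^ Suc k = r (n + k) / q ^ k - r (n + Suc k) / q ^ Suc k"
      using q by (simp add: diff_divide_distrib)
    then show ?case using Suc by simp
  qed simp
  have "val q (suffix n c) = r n" for n
  proof -
    have "(\<lambda>k. r (n + k) / q ^ k) \<longlonglongrightarrow> 0"
    proof (rule Lim_null_comparison)
      show "\<forall>\<^sub>F k in sequentially. norm (r (n + k) / q ^ k) \<le> (real M / (q - 1)) / q ^ k"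
      proof (intro always_eventually allI)
        fix k
        have "0 \<le> r (n + k)" "r (n + k) \<le> real M / (q - 1)"
          using rS[of "n + k"] S by (auto simp: J_def)
        then have "r (n + k) / q ^ k \<le> (real M / (q - 1)) / q ^ k" "0 \<le> r (n + k) / q ^ k"
          using q by (intro divide_right_mono divide_nonneg_nonneg; simp)+
        then show "norm (r (n + k) / q ^ k) \<le> (real M / (q - 1)) / q ^ k" by simp
      qed
      show "(\<lambda>k. (real M / (q - 1)) / q ^ k) \<longlonglongrightarrow> 0" by (rule tendsto_div_power[OF q])
    qed
    then have "(\<lambda>k. r n - r (n + k) / q ^ k) \<longlonglongrightarrow> r n - 0" by (intro tendsto_intros)
    then have "(\<lambda>i. real (suffix n c i) / q ^ Suc i) sums r n"
      unfolding sums_def suffix_nth sum by simp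
    then show ?thesis using val_sums[OF q suffix_digit_seqs[OF c]] sums_unique2 by blast
  qed
  note v = this
  show ?thesis
    using c rS v[of 0] by (intro bexI[of _ c]) (auto simp: v, auto simp: c_def r_def)
qed

text \<open>The upper bound on \<open>q\<close> is what puts 1 into \<open>J M q\<close>, so that
  \<open>\<alpha>\<close> is an expansion of 1.\<close>

locale base =
  fixes M :: nat and q :: real
  assumes M: "1 \<le> M" and q: "1 < q" and qM: "q \<le> real M + 1"
begin

lemma one_le: "1 \<le> real M / (q - 1)"
  using q qM by simp

lemma fixed_point: "q * (real M / (q - 1)) - real M = real M / (q - 1)"
  using q by (simp add: field_simps)

lemma quasi_seq_exists:
  assumes "x \<in> J M q" shows "\<exists>c. quasi_seq M q c \<and> val q c = x"
proof (cases "x = 0")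
  case True
  then show ?thesis
    by (intro exI[of _ "\<lambda>_. 0"]) (auto simp: quasi_seq_def digit_seqs_def suffix_def)
next
  case False
  \<comment> \<open>Remainders are kept positive, which prevents the digits from ending in zeros;
    \<open>\<lceil>q * r\<rceil> - 1\<close> is the largest integer strictly below
    \<open>q * r\<close>.\<close>
  define S where "S = {0<..real M / (q - 1)}"
  define f where "f = (\<lambda>r. min M (nat (\<lceil>q * r\<rceil> - 1)))"
  have f: "real (f r) < q * r \<and> (f r < M \<longrightarrow> q * r - real (f r) \<le> 1)" if "0 < r" for r
  proof -
    have "0 < q * r" using that q by simp
    then have "1 \<le> \<lceil>q * r\<rceil>" by simp
    then have "real (nat (\<lceil>q * r\<rceil> - 1)) = of_int \<lceil>q * r\<rceil> - 1" by simp
    then show ?thesis unfolding f_def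
      using ceiling_correct[of "q * r"] by (auto simp: min_def split: if_splits)
  qed
  have step: "q * r - real (f r) \<in> S" if "r \<in> S" for r
  proof (cases "f r < M")
    case True
    then show ?thesis using f[of r] that one_le by (auto simp: S_def)
  next
    case False
    then have "f r = M" by (simp add: f_def)
    moreover have "q * r \<le> q * (real M / (q - 1))" using that q unfolding S_def
      by (intro mult_left_mono) auto
    ultimately show ?thesis using f[of r] that fixed_point by (auto simp: S_def)
  qed
  have "x \<in> S" using assms False by (auto simp: S_def J_def)
  then obtain c where c: "c \<in> digit_seqs M" "\<And>n. val q (suffix n c) \<in> S"
      "\<And>n. c n = f (val q (suffix n c))" "val q c = x"
    using digit_algorithm[of q f M S x, OF q _ step] by (force simp: f_def S_def J_def)
  have "\<not> finite_seq c"
  proof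
    assume "finite_seq c"
    then obtain n where "suffix (Suc n) c = (\<lambda>_. 0)" by (auto simp: finite_seq_iff)
    then show False using c(2)[of "Suc n"] by (simp add: S_def)
  qed
  moreover have "val q (suffix (Suc n) c) \<le> 1" if "c n < M" for n
  proof -
    have "val q (suffix (Suc n) c) = q * val q (suffix n c) - real (c n)"
      using val_step[OF q suffix_digit_seqs[OF c(1)], of n] q by (simp add: field_simps)
    then show ?thesis using f[of "val q (suffix n c)"] c(2)[of n] c(3)[of n] that by (auto simp: S_def)
  qed
  ultimately show ?thesis using c by (auto simp: quasi_seq_def)
qed

lemma greedy_seq_exists:
  assumes "x \<in> J M q" shows "\<exists>c. greedy_seq M q c \<and> val q c = x"
proof -
  define f where "f = (\<lambda>r. min M (nat \<lfloor>q * r\<rfloor>))"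
  have f: "real (f r) \<le> q * r \<and> (f r < M \<longrightarrow> q * r - real (f r) < 1)" if "0 \<le> r" for r
  proof -
    have "0 \<le> q * r" using that q by simp
    then have "real (nat \<lfloor>q * r\<rfloor>) = of_int \<lfloor>q * r\<rfloor>" by simp
    then show ?thesis unfolding f_def
      using floor_correct[of "q * r"] by (simp add: min_def) linarith
  qed
  have step: "q * r - real (f r) \<in> J M q" if "r \<in> J M q" for r
  proof (cases "f r < M")
    case True
    then show ?thesis using f[of r] that one_le by (auto simp: J_def)
  next
    case False
    then have "f r = M" by (simp add: f_def)
    moreover have "q * r \<le> q * (real M / (q - 1))" using that q unfolding J_def
      by (intro mult_left_mono) auto
    ultimately show ?thesis using f[of r] that fixed_point by (auto simp: J_def)
  qed
  obtain c where c: "c \<in> digit_seqs M" "\<And>n. val q (suffix n c) \<in> J M q"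
      "\<And>n. c n = f (val q (suffix n c))" "val q c = x"
    using digit_algorithm[of q f M "J M q" x, OF q _ step] assms by (force simp: f_def)
  moreover have "val q (suffix (Suc n) c) < 1" if "c n < M" for n
  proof -
    have "val q (suffix (Suc n) c) = q * val q (suffix n c) - real (c n)"
      using val_step[OF q suffix_digit_seqs[OF c(1)], of n] q by (simp add: field_simps)
    then show ?thesis using f[of "val q (suffix n c)"] c(2)[of n] c(3)[of n] that by (auto simp: J_def)
  qed
  ultimately show ?thesis by (auto simp: greedy_seq_def)
qed

lemma quasi_greedy:
  assumes "x \<in> J M q" shows "quasi_seq M q (quasi_greedy M q x)" "val q (quasi_greedy M q x) = x"
  using quasi_seq_exists[OF assms] quasi_greedy_eq[OF q] by auto

lemma greedy:
  assumes "x \<in> J M q" shows "greedy_seq M q (greedy M q x)" "val q (greedy M q x) = x"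
  using greedy_seq_exists[OF assms] greedy_eq[OF q] by auto

abbreviation \<alpha> :: "nat \<Rightarrow> nat" where "\<alpha> \<equiv> alpha M q"

lemma one_in_J: "1 \<in> J M q"
  using one_le by (simp add: J_def)

lemma alpha_quasi: "quasi_seq M q \<alpha>" and val_alpha: "val q \<alpha> = 1"
  unfolding alpha_def using quasi_greedy[OF one_in_J] by auto

lemma alpha_digits [simp]: "\<alpha> \<in> digit_seqs M"
  using alpha_quasi by (simp add: quasi_seq_def)

lemma alpha_not_finite: "\<not> finite_seq \<alpha>"
  using alpha_quasi by (simp add: quasi_seq_def)

lemma alpha_0: "0 < \<alpha> 0"
proof (rule ccontr)
  assume *: "\<not> 0 < \<alpha> 0"
  then have "val q (suffix 1 \<alpha>) = q"
    using val_step[OF q alpha_digits] val_alpha q by (simp add: field_simps)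
  moreover have "val q (suffix (Suc 0) \<alpha>) \<le> 1"
    using alpha_quasi * M by (auto simp: quasi_seq_def)
  ultimately show False using q by simp
qed

lemma quasi_seq_suffix:
  assumes "quasi_seq M q c" shows "quasi_seq M q (suffix n c)"
  using assms finite_seq_if_suffix[of n c] by (auto simp: quasi_seq_def)

end

text \<open>Iterating the estimate contracts the excess of the value over 1 by the factor \<open>q\<close>.\<close>

lemma val_le_one_if_lex:
  assumes q: "1 < q" and a: "a \<in> digit_seqs M" "val q a \<le> 1"
    and d: "d \<in> digit_seqs M" "d \<sqsubseteq> a" "\<And>n. d n < M \<Longrightarrow> suffix (Suc n) d \<sqsubseteq> a"
  shows "val q d \<le> 1"
proof -
  define K where "K = real M / (q - 1)"
  have K: "0 \<le> K" using q by (simp add: K_def)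
  have bound: "val q d \<le> 1 + K / q ^ m"
    if "d \<in> digit_seqs M" "d \<sqsubseteq> a" "\<And>n. d n < M \<Longrightarrow> suffix (Suc n) d \<sqsubseteq> a" for d m
    using that
  proof (induction m arbitrary: d)
    case 0
    then show ?case using val_le[OF q 0(1)] by (simp add: K_def)
  next
    case (Suc m)
    show ?case
    proof (cases "d = a")
      case True
      then show ?thesis using a(2) K q by (smt (verit) divide_nonneg_nonneg zero_le_power)
    next
      case False
      then obtain j where j: "d j < a j" "agree j d a"
        using Suc.prems(2) by (auto simp: lex_le_def less_fun_agree)
      have "d j < M" using j(1) digit_seqs_le[OF a(1), of j] by simp
      let ?e = "suffix (Suc j) d"
      have 1: "val q ?e \<le> 1 + K / q ^ m"
      proof (rule Suc.IH)
        show "suffix (Suc n) ?e \<sqsubseteq> a" if "?e n < M" for n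
          using Suc.prems(3)[of "Suc j + n"] that unfolding suffix_suffix suffix_nth add_Suc_right .
        show "?e \<in> digit_seqs M" using Suc.prems(1) by (rule suffix_digit_seqs)
        show "?e \<sqsubseteq> a" using Suc.prems(3) \<open>d j < M\<close> by blast
      qed
      have "real (a j) - real (d j) + val q (suffix (Suc j) a) - val q ?e \<ge> - (K / q ^ m)"
        using 1 j(1) val_nonneg[OF q suffix_digit_seqs[OF a(1)], of "Suc j"] by linarith
      then have "(real (a j) - real (d j) + val q (suffix (Suc j) a) - val q ?e) / q ^ Suc j
          \<ge> - (K / q ^ m) / q ^ Suc j"
        using q by (intro divide_right_mono) auto
      then have "val q a - val q d \<ge> - (K / q ^ m) / q ^ Suc j"
        using val_diff_agree[OF q Suc.prems(1) a(1) j(2)] by simp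
      moreover have "(K / q ^ m) / q ^ Suc j \<le> (K / q ^ m) / q ^ 1"
        using q K by (intro divide_left_mono power_increasing) auto
      moreover have "(K / q ^ m) / q ^ 1 = K / q ^ Suc m" by simp
      ultimately show ?thesis using a(2) by linarith
    qed
  qed
  have "(\<lambda>m. 1 + K / q ^ m) \<longlonglongrightarrow> 1 + 0" by (intro tendsto_intros tendsto_div_power q)
  then show ?thesis
    using LIMSEQ_le_const[of "\<lambda>m. 1 + K / q ^ m" "1" "val q d"] bound[OF d] by auto
qed

text \<open>The previous bound applies to the tail of \<open>d\<close> after its first difference
  from \<open>a\<close>. The strictness comes from the tail of \<open>a\<close> at that place, which
  is positive because \<open>a\<close> is infinite.\<close>

lemma val_less_one_if_lex:
  assumes q: "1 < q" and a: "a \<in> digit_seqs M" "val q a \<le> 1" "\<not> finite_seq a"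
    and d: "d \<in> digit_seqs M" "d \<sqsubset> a" "\<And>n. d n < M \<Longrightarrow> suffix (Suc n) d \<sqsubseteq> a"
  shows "val q d < 1"
proof -
  obtain j where j: "d j < a j" "agree j d a" using d(2) by (auto simp: less_fun_agree)
  have "d j < M" using j(1) digit_seqs_le[OF a(1), of j] by simp
  have "val q (suffix (Suc j) d) \<le> 1"
  proof (rule val_le_one_if_lex[OF q a(1,2)])
    show "suffix (Suc n) (suffix (Suc j) d) \<sqsubseteq> a" if "suffix (Suc j) d n < M" for n
      using d(3)[of "Suc j + n"] that by simp
  qed (use d \<open>d j < M\<close> in simp_all)
  moreover obtain i where "suffix (Suc j) a i \<noteq> 0" using not_finite_seqD[OF a(3), of j] j by auto
  then have "0 < val q (suffix (Suc j) a)"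
    using val_pos[OF q suffix_digit_seqs[OF a(1)]] by blast
  ultimately have "0 < real (a j) - real (d j) + val q (suffix (Suc j) a) - val q (suffix (Suc j) d)"
    using j(1) by linarith
  then have "0 < (real (a j) - real (d j) + val q (suffix (Suc j) a) - val q (suffix (Suc j) d)) / q ^ Suc j"
    using q by simp
  then show ?thesis using val_diff_agree[OF q d(1) a(1) j(2)] a(2) by linarith
qed

context base
begin

text \<open>From here on the conditions on tails are purely lexicographic: monotonicity of
  evaluation turns the bound 1 into a comparison with \<open>\<alpha>\<close>, and
  \<open>val_le_one_if_lex\<close> gives the converse.\<close>

lemma quasi_seq_iff:
  "quasi_seq M q c \<longleftrightarrow> c \<in> digit_seqs M \<and> \<not> finite_seq c \<and> (\<forall>n. c n < M \<longrightarrow> suffix (Suc n) c \<sqsubseteq> \<alpha>)"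
proof (intro iffI conjI allI impI)
  fix n assume c: "quasi_seq M q c" "c n < M"
  then have "val q (suffix (Suc n) c) \<le> val q \<alpha>" by (auto simp: quasi_seq_def val_alpha)
  then show "suffix (Suc n) c \<sqsubseteq> \<alpha>"
    using quasi_val_less_iff[OF q alpha_quasi quasi_seq_suffix[OF c(1), of "Suc n"]]
    by (meson lex.not_le_imp_less not_less)
next
  assume c: "c \<in> digit_seqs M \<and> \<not> finite_seq c \<and> (\<forall>n. c n < M \<longrightarrow> suffix (Suc n) c \<sqsubseteq> \<alpha>)"
  have "val q (suffix (Suc n) c) \<le> 1" if "c n < M" for n
  proof (rule val_le_one_if_lex[OF q alpha_digits])
    show "suffix (Suc m) (suffix (Suc n) c) \<sqsubseteq> \<alpha>" if "suffix (Suc n) c m < M" for m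
      using c that by (auto dest: spec[of _ "Suc n + m"])
  qed (use c that val_alpha in simp_all)
  then show "quasi_seq M q c" using c by (simp add: quasi_seq_def)
qed (auto simp: quasi_seq_def)

lemma greedy_seq_iff:
  "greedy_seq M q c \<longleftrightarrow> c \<in> digit_seqs M \<and> (\<forall>n. c n < M \<longrightarrow> suffix (Suc n) c \<sqsubset> \<alpha>)"
proof (intro iffI conjI allI impI)
  fix n assume c: "greedy_seq M q c" "c n < M"
  then have less: "val q (suffix (Suc n) c) < val q \<alpha>" by (auto simp: greedy_seq_def val_alpha)
  show "suffix (Suc n) c \<sqsubset> \<alpha>"
  proof (rule ccontr)
    assume "\<not> suffix (Suc n) c \<sqsubset> \<alpha>"
    then have "\<alpha> = suffix (Suc n) c \<or> \<alpha> \<sqsubset> suffix (Suc n) c" by (metis lex.linorder_cases)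
    then have "val q \<alpha> \<le> val q (suffix (Suc n) c)"
      using quasi_le_val[OF q alpha_quasi suffix_digit_seqs[OF greedy_seq_digits[OF c(1)]]] by auto
    then show False using less by simp
  qed
next
  assume c: "c \<in> digit_seqs M \<and> (\<forall>n. c n < M \<longrightarrow> suffix (Suc n) c \<sqsubset> \<alpha>)"
  have "val q (suffix (Suc n) c) < 1" if "c n < M" for n
  proof (rule val_less_one_if_lex[OF q alpha_digits])
    show "suffix (Suc m) (suffix (Suc n) c) \<sqsubseteq> \<alpha>" if "suffix (Suc n) c m < M" for m
      using c that by (auto simp: lex.less_imp_le dest: spec[of _ "Suc n + m"])
  qed (use c that val_alpha alpha_not_finite in simp_all)
  then show "greedy_seq M q c" using c by (simp add: greedy_seq_def)
qed (auto simp: greedy_seq_def)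

text \<open>The characterisation \<open>quasi_seq_iff\<close> speaks only of tails after a digit
  below \<open>M\<close>. After a digit \<open>M\<close> the induction hypothesis forces
  \<open>\<alpha>\<close> to begin with \<open>M\<close>, and dropping both digits leaves a
  comparison with \<open>suffix 1 \<alpha>\<close>. If that tail exceeded \<open>\<alpha>\<close>,
  then \<open>\<alpha>\<close> would start with a run of digits \<open>M\<close> followed by a still
  larger digit.\<close>

lemma alpha_suffix_le: "suffix n \<alpha> \<sqsubseteq> \<alpha>"
proof (induction n)
  case (Suc n)
  show ?case
  proof (cases "\<alpha> n < M")
    case True
    then show ?thesis using alpha_quasi unfolding quasi_seq_iff by blast
  next
    case False
    then have "\<alpha> n = M" using digit_seqs_le[OF alpha_digits, of n] by simp
    then have eq: "agree 1 (suffix n \<alpha>) \<alpha>"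
      using lex_le_imp[OF Suc, of 1] digit_seqs_le[OF alpha_digits, of 0]
      by (auto simp: below_def agree_def)
    have "suffix 1 (suffix n \<alpha>) \<sqsubseteq> suffix 1 \<alpha>" by (rule iffD2[OF lex_le_suffix[OF eq] Suc])
    show ?thesis
    proof (cases "\<alpha> 0 < M")
      case True
      then have "suffix 1 \<alpha> \<sqsubseteq> \<alpha>" using alpha_quasi by (auto simp: quasi_seq_iff)
      with \<open>suffix 1 (suffix n \<alpha>) \<sqsubseteq> suffix 1 \<alpha>\<close> have "suffix 1 (suffix n \<alpha>) \<sqsubseteq> \<alpha>"
        by (rule lex.order_trans)
      then show ?thesis unfolding suffix_suffix Suc_eq_plus1 .
    next
      case False
      show ?thesis
      proof (rule ccontr)
        assume *: "\<not> suffix (Suc n) \<alpha> \<sqsubseteq> \<alpha>"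
        then have "\<alpha> \<sqsubset> suffix (Suc n) \<alpha>" "\<alpha> \<sqsubset> suffix 1 \<alpha>"
          using \<open>suffix 1 (suffix n \<alpha>) \<sqsubseteq> suffix 1 \<alpha>\<close> by auto
        then obtain k where k: "\<alpha> k < \<alpha> (Suc k)" "agree k \<alpha> (suffix 1 \<alpha>)"
          by (auto simp: less_fun_agree)
        have "\<alpha> i = M" if "i \<le> k" for i
          using that
        proof (induction i)
          case 0 then show ?case using False digit_seqs_le[OF alpha_digits, of 0] by simp
        next
          case (Suc i) then show ?case using agreeD[OF k(2), of i] by simp
        qed
        then show False using k(1) digit_seqs_le[OF alpha_digits, of "Suc k"] by auto
      qed
    qed
  qed
qed simp

end

section \<open>Characterisation of U, V, Uq and Vq\<close>

text \<open>To be used with \<open>r\<close> the weak and the strict order. The hypothesis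
  \<open>hyp\<close> covers the positions after a nonzero digit. At a zero digit the reflected tail
  begins with \<open>M\<close>, hence so does \<open>a\<close>; dropping both first digits keeps the
  relation, and the remaining tail of \<open>a\<close> is at most \<open>a\<close>. The case
  \<open>k = 0\<close> follows from \<open>k = 1\<close> by \<open>swap\<close>.\<close>

lemma reflect_suffix_all:
  fixes r :: "(nat \<Rightarrow> nat) \<Rightarrow> (nat \<Rightarrow> nat) \<Rightarrow> bool"
  assumes a: "a \<in> digit_seqs M" "\<And>k. suffix k a \<sqsubseteq> a" "0 < a 0"
    and shift: "\<And>f g. agree 1 f g \<Longrightarrow> r f g \<Longrightarrow> r (suffix 1 f) (suffix 1 g)"
    and trans: "\<And>f g h. r f g \<Longrightarrow> g \<sqsubseteq> h \<Longrightarrow> r f h"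
    and le: "\<And>f g. r f g \<Longrightarrow> f \<sqsubseteq> g"
    and swap: "\<And>f g. f \<in> digit_seqs M \<Longrightarrow> g \<in> digit_seqs M \<Longrightarrow> r (reflect M f) g \<Longrightarrow> r (reflect M g) f"
    and hyp: "\<And>n. 0 < a n \<Longrightarrow> r (reflect M (suffix (Suc n) a)) a"
  shows "r (reflect M (suffix k a)) a"
proof -
  have pos: "r (reflect M (suffix (Suc k) a)) a" for k
  proof (induction k)
    case 0
    show ?case by (rule hyp[OF a(3)])
  next
    case (Suc k)
    have IH: "r (reflect M (suffix (Suc k) a)) a" using Suc .
    show ?case
    proof (cases "0 < a (Suc k)")
      case False
      let ?f = "reflect M (suffix (Suc k) a)"
      have "?f 0 = M" using False by (simp add: reflect_nth)
      then have "a 0 = M" "agree 1 ?f a"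
        using lex_le_imp[OF le[OF IH], of 1] digit_seqs_le[OF a(1), of 0]
        by (auto simp: below_def agree_def)
      then have "r (suffix 1 ?f) (suffix 1 a)" using shift IH by blast
      then have "r (suffix 1 ?f) a" using trans a(2) by blast
      then show ?thesis unfolding suffix_reflect suffix_suffix Suc_eq_plus1 .
    qed (rule hyp)
  qed
  have "r (reflect M a) a"
    using trans[OF swap[OF suffix_digit_seqs[OF a(1)] a(1) pos[of 0]] a(2)] .
  then show ?thesis using pos by (cases k) simp_all
qed

lemma le_const_M: "c \<in> digit_seqs M \<Longrightarrow> c \<sqsubseteq> (\<lambda>_. M)"
  using digit_seqs_le by (metis less_funE lex.not_le_imp_less not_less)

lemma reflect_zero [simp]: "reflect M (\<lambda>_. 0) = (\<lambda>_. M)"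
  by (simp add: reflect_def)

lemma reflect_const_M [simp]: "reflect M (\<lambda>_. M) = (\<lambda>_. 0)"
  by (simp add: reflect_def)

lemma suffix_const [simp]: "suffix n (\<lambda>_. x) = (\<lambda>_. x)"
  by (simp add: suffix_def)

lemma zero_le: "(\<lambda>_. 0) \<sqsubseteq> (c :: nat \<Rightarrow> nat)"
  by (metis less_funE lex.not_le_imp_less not_less_zero)

lemma val_const_M: "1 < q \<Longrightarrow> val q (\<lambda>_. M) = real M / (q - 1)"
  using geometric_digit_sums[of q M] val_sums[of q "\<lambda>_. M" M] sums_unique2
  by (auto simp: digit_seqs_def)

lemma reflect_finite_seq:
  assumes "c \<in> digit_seqs M" "finite_seq (reflect M c)"
  obtains n where "c n < M" "suffix (Suc n) c = (\<lambda>_. M)"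
proof -
  obtain n where n: "reflect M c n \<noteq> 0" "suffix (Suc n) (reflect M c) = (\<lambda>_. 0)"
    using assms(2) by (auto simp: finite_seq_iff)
  have "reflect M (reflect M (suffix (Suc n) c)) = reflect M (\<lambda>_. 0)"
    using n(2) by (simp only: suffix_reflect)
  then show ?thesis using that[of n] n(1) assms(1) by (simp add: reflect_nth)
qed

context base
begin

lemma strict_seqs_iff:
  "c \<in> strict_seqs M \<alpha> \<longleftrightarrow> c \<in> digit_seqs M \<and> greedy_seq M q c \<and> greedy_seq M q (reflect M c)"
proof -
  have "reflect M c n < M \<longleftrightarrow> 0 < c n" if "c \<in> digit_seqs M" for n
    using digit_seqs_le[OF that, of n] M by (auto simp: reflect_nth)
  then show ?thesis
    unfolding greedy_seq_iff strict_seqs_def suffix_reflect by auto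
qed

lemma strict_seqs_not_finite:
  assumes "c \<in> strict_seqs M \<alpha>" shows "\<not> finite_seq c"
proof
  assume "finite_seq c"
  then obtain n where "c n \<noteq> 0" "suffix (Suc n) c = (\<lambda>_. 0)" by (auto simp: finite_seq_iff)
  then have "(\<lambda>_. M) \<sqsubset> \<alpha>" using strict_seqsD(3)[OF assms, of n] by simp
  then show False using le_const_M[OF alpha_digits] by (meson lex.not_less)
qed

lemma strict_seqs_quasi: "c \<in> strict_seqs M \<alpha> \<Longrightarrow> quasi_seq M q c"
  using strict_seqs_not_finite unfolding quasi_seq_def
  by (auto simp: strict_seqs_iff greedy_seq_def less_imp_le)

lemma reflect_quasi_not_finite:
  assumes "q \<noteq> real M + 1" "quasi_seq M q c" shows "\<not> finite_seq (reflect M c)"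
proof
  assume "finite_seq (reflect M c)"
  then obtain n where "c n < M" "suffix (Suc n) c = (\<lambda>_. M)"
    using reflect_finite_seq assms(2) quasi_digits by blast
  then have "real M / (q - 1) \<le> 1" using assms(2) val_const_M[OF q, of M] unfolding quasi_seq_def by metis
  then show False using q qM assms(1) by (simp add: field_simps)
qed

lemma weak_seqs_not_finite:
  assumes "q \<noteq> real M + 1" "c \<in> weak_seqs M \<alpha>" shows "\<not> finite_seq c"
proof
  assume "finite_seq c"
  then obtain n where "c n \<noteq> 0" "suffix (Suc n) c = (\<lambda>_. 0)" by (auto simp: finite_seq_iff)
  then have "(\<lambda>_. M) \<sqsubseteq> \<alpha>" using weak_seqsD(3)[OF assms(2), of n] by simp
  then have "\<alpha> = (\<lambda>_. M)" using le_const_M[OF alpha_digits] by (metis lex.order_antisym)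
  then have "real M / (q - 1) = 1" using val_alpha val_const_M[OF q, of M] by simp
  then show False using q assms(1) by (simp add: field_simps)
qed

lemma weak_seqs_iff:
  assumes "q \<noteq> real M + 1"
  shows "c \<in> weak_seqs M \<alpha> \<longleftrightarrow> c \<in> digit_seqs M \<and> quasi_seq M q c \<and> quasi_seq M q (reflect M c)"
proof -
  have "reflect M c n < M \<longleftrightarrow> 0 < c n" if "c \<in> digit_seqs M" for n
    using digit_seqs_le[OF that, of n] M by (auto simp: reflect_nth)
  moreover have "\<not> finite_seq c \<and> \<not> finite_seq (reflect M c)" if "c \<in> weak_seqs M \<alpha>"
    using that weak_seqs_not_finite[OF assms] weak_seqs_reflect by blast
  ultimately show ?thesis
    unfolding quasi_seq_iff suffix_reflect by (auto simp: weak_seqs_def)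
qed

lemma alpha_not_const_M: "q \<noteq> real M + 1 \<Longrightarrow> \<alpha> \<sqsubset> (\<lambda>_. M)"
  using le_const_M[OF alpha_digits] val_alpha val_const_M[OF q, of M] q
  by (auto simp: lex_le_def field_simps)

lemma expansions_J: "c \<in> expansions M q x \<Longrightarrow> x \<in> J M q"
  using val_in_J[OF q] by (auto simp: expansions_iff[OF q])

text \<open>The reflection of the greedy expansion of M/(q-1) - x is the smallest expansion of x.
  Uniqueness means that it coincides with the largest one, so that \<open>c\<close> and its
  reflection are both greedy.\<close>

lemma Uq_eq: "Uq M q = val q ` strict_seqs M \<alpha>"
proof (intro equalityI subsetI)
  fix x assume "x \<in> Uq M q"
  then have x: "x \<in> J M q" and uniq: "\<exists>!c. c \<in> expansions M q x" by (auto simp: Uq_def)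
  define g where "g = greedy M q x"
  define h where "h = greedy M q (real M / (q - 1) - x)"
  have g: "greedy_seq M q g" "val q g = x" using greedy[OF x] by (auto simp: g_def)
  have "real M / (q - 1) - x \<in> J M q" using x by (auto simp: J_def)
  then have h: "greedy_seq M q h" "val q h = real M / (q - 1) - x"
    using greedy by (auto simp: h_def)
  have "reflect M h \<in> expansions M q x" "g \<in> expansions M q x"
    using g h greedy_seq_digits val_reflect[OF q] by (auto simp: expansions_iff[OF q])
  then have "reflect M h = g" using uniq by blast
  then have "reflect M g = h" using h greedy_seq_digits by auto
  then show "x \<in> val q ` strict_seqs M \<alpha>" using g h greedy_seq_digits by (auto simp: strict_seqs_iff)
next
  fix x assume "x \<in> val q ` strict_seqs M \<alpha>"
  then obtain c where c: "c \<in> digit_seqs M" "greedy_seq M q c" "greedy_seq M q (reflect M c)" "x = val q c"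
    by (auto simp: strict_seqs_iff)
  have "d = c" if "d \<in> expansions M q x" for d
  proof -
    have d: "d \<in> digit_seqs M" "val q d = val q c" using that c by (auto simp: expansions_iff[OF q])
    then have "\<not> c \<sqsubset> d" using greedy_seq_less_val[OF q c(2) d(1)] by auto
    moreover have "\<not> reflect M c \<sqsubset> reflect M d"
      using greedy_seq_less_val[OF q c(3) reflect_digit_seqs, of d] d c(1) val_reflect[OF q] by auto
    ultimately show ?thesis using reflect_less_iff[OF c(1) d(1)] by (metis lex.linorder_cases)
  qed
  moreover have "c \<in> expansions M q x" using c by (auto simp: expansions_iff[OF q])
  ultimately show "x \<in> Uq M q" using expansions_J by (auto simp: Uq_def)
qed

text \<open>Same argument as for \<open>Uq_eq\<close> with quasi-greedy expansions. Below the base M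
  + 1 the reflection of a quasi-greedy sequence is infinite, since a tail of digits \<open>M\<close>
  after a smaller digit would have value above 1; hence both candidates are doubly infinite.\<close>

lemma Vq_eq:
  assumes "q \<noteq> real M + 1" shows "Vq M q = val q ` weak_seqs M \<alpha>"
proof (intro equalityI subsetI)
  fix x assume "x \<in> Vq M q"
  then have x: "x \<in> J M q" and uniq: "\<exists>!c. c \<in> expansions M q x \<and> doubly_infinite_seq M c"
    using assms by (auto simp: Vq_def)
  define g where "g = quasi_greedy M q x"
  define h where "h = quasi_greedy M q (real M / (q - 1) - x)"
  have g: "quasi_seq M q g" "val q g = x" using quasi_greedy[OF x] by (auto simp: g_def)
  have "real M / (q - 1) - x \<in> J M q" using x by (auto simp: J_def)
  then have h: "quasi_seq M q h" "val q h = real M / (q - 1) - x"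
    using quasi_greedy by (auto simp: h_def)
  have dig: "g \<in> digit_seqs M" "h \<in> digit_seqs M" using g h quasi_digits by auto
  have "reflect M h \<in> expansions M q x \<and> doubly_infinite_seq M (reflect M h)"
    "g \<in> expansions M q x \<and> doubly_infinite_seq M g"
    using g h dig val_reflect[OF q] reflect_quasi_not_finite[OF assms]
    by (auto simp: expansions_iff[OF q] doubly_infinite_seq_def quasi_seq_def)
  then have "reflect M h = g" using uniq by blast
  then have "reflect M g = h" using dig by auto
  then show "x \<in> val q ` weak_seqs M \<alpha>" using g h dig by (auto simp: weak_seqs_iff[OF assms])
next
  fix x assume "x \<in> val q ` weak_seqs M \<alpha>"
  then obtain c where c: "c \<in> digit_seqs M" "quasi_seq M q c" "quasi_seq M q (reflect M c)" "x = val q c"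
    by (auto simp: weak_seqs_iff[OF assms])
  have "d = c" if "d \<in> expansions M q x \<and> doubly_infinite_seq M d" for d
  proof -
    have d: "d \<in> digit_seqs M" "val q d = val q c" "\<not> finite_seq d" "\<not> finite_seq (reflect M d)"
      using that c by (auto simp: expansions_iff[OF q] doubly_infinite_seq_def)
    then have "\<not> c \<sqsubset> d" using quasi_less_val[OF q c(2) d(1)] by auto
    moreover have "\<not> reflect M c \<sqsubset> reflect M d"
      using quasi_less_val[OF q c(3) reflect_digit_seqs, of d] d c(1) val_reflect[OF q] by auto
    ultimately show ?thesis using reflect_less_iff[OF c(1) d(1)] by (metis lex.linorder_cases)
  qed
  moreover have "c \<in> expansions M q x \<and> doubly_infinite_seq M c"
    using c by (auto simp: expansions_iff[OF q] doubly_infinite_seq_def quasi_seq_def)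
  ultimately show "x \<in> Vq M q" using expansions_J assms by (auto simp: Vq_def)
qed

lemma Uq'_eq: "Uq' M q = strict_seqs M \<alpha>"
proof -
  have "quasi_greedy M q (val q c) = c" if "c \<in> strict_seqs M \<alpha>" for c
    using quasi_greedy_eq[OF q strict_seqs_quasi[OF that]] .
  then show ?thesis unfolding Uq'_def Uq_eq image_image by simp
qed

lemma Vq'_eq: assumes "q \<noteq> real M + 1" shows "Vq' M q = weak_seqs M \<alpha>"
proof -
  have "quasi_greedy M q (val q c) = c" if "c \<in> weak_seqs M \<alpha>" for c
    using quasi_greedy_eq[OF q] that by (simp add: weak_seqs_iff[OF assms])
  then show ?thesis unfolding Vq'_def Vq_eq[OF assms] image_image by simp
qed

lemma one_in_val_image:
  assumes "\<And>c. c \<in> S \<Longrightarrow> quasi_seq M q c" shows "1 \<in> val q ` S \<longleftrightarrow> \<alpha> \<in> S"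
proof
  assume "1 \<in> val q ` S"
  then obtain c where c: "c \<in> S" "val q \<alpha> = val q c" by (auto simp: val_alpha)
  then show "\<alpha> \<in> S" using quasi_inj[OF q alpha_quasi assms] by simp
next
  show "1 \<in> val q ` S" if "\<alpha> \<in> S" using that val_alpha by (intro image_eqI[of _ _ \<alpha>]) simp_all
qed

lemma U_iff: "q \<in> U M \<longleftrightarrow> \<alpha> \<in> strict_seqs M \<alpha>"
proof -
  have "q \<in> U M \<longleftrightarrow> 1 \<in> Uq M q" using q one_in_J by (auto simp: U_def Uq_def)
  also have "\<dots> \<longleftrightarrow> \<alpha> \<in> strict_seqs M \<alpha>"
    unfolding Uq_eq using one_in_val_image[of "strict_seqs M \<alpha>"] strict_seqs_quasi by simp
  finally show ?thesis .
qed

lemma alpha_top: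
  assumes "q = real M + 1" shows "\<alpha> = (\<lambda>_. M)"
proof -
  have "quasi_seq M q (\<lambda>_. M)" using M by (auto simp: quasi_seq_def digit_seqs_def finite_seq_def)
  moreover have "val q (\<lambda>_. M) = 1" using val_const_M[OF q, of M] assms M by simp
  ultimately show ?thesis using quasi_inj[OF q alpha_quasi] val_alpha by metis
qed

lemma top_in_U:
  assumes "q = real M + 1" shows "q \<in> U M"
  unfolding U_iff alpha_top[OF assms] using M zero_le
  by (auto simp: strict_seqs_def digit_seqs_def less_fun_def)

lemma top_in_V:
  assumes "q = real M + 1" shows "q \<in> V M"
proof -
  have "\<exists>!c. c \<in> expansions M q 1" using top_in_U[OF assms] by (simp add: U_def)
  moreover have "\<alpha> \<in> expansions M q 1" by (simp add: expansions_iff[OF q] val_alpha)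
  moreover have "doubly_infinite_seq M \<alpha>"
    using alpha_not_finite by (simp add: doubly_infinite_seq_def alpha_top[OF assms])
  ultimately show ?thesis unfolding V_def using q by blast
qed

lemma V_iff: "q \<in> V M \<longleftrightarrow> (\<forall>k. reflect M (suffix k \<alpha>) \<sqsubseteq> \<alpha>)"
proof (cases "q = real M + 1")
  case True
  then show ?thesis using top_in_V[OF True] zero_le unfolding alpha_top[OF True] by simp
next
  case False
  have "q \<in> V M \<longleftrightarrow> 1 \<in> Vq M q" using q one_in_J False by (auto simp: V_def Vq_def)
  also have "\<dots> \<longleftrightarrow> \<alpha> \<in> weak_seqs M \<alpha>"
    unfolding Vq_eq[OF False] using one_in_val_image[of "weak_seqs M \<alpha>"] weak_seqs_iff[OF False] by simp
  also have "\<dots> \<longleftrightarrow> (\<forall>n. 0 < \<alpha> n \<longrightarrow> reflect M (suffix (Suc n) \<alpha>) \<sqsubseteq> \<alpha>)"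
    using alpha_suffix_le by (auto simp: weak_seqs_def)
  also have "\<dots> \<longleftrightarrow> (\<forall>k. reflect M (suffix k \<alpha>) \<sqsubseteq> \<alpha>)"
  proof
    assume *: "\<forall>n. 0 < \<alpha> n \<longrightarrow> reflect M (suffix (Suc n) \<alpha>) \<sqsubseteq> \<alpha>"
    show "\<forall>k. reflect M (suffix k \<alpha>) \<sqsubseteq> \<alpha>"
    proof
      fix k
      show "reflect M (suffix k \<alpha>) \<sqsubseteq> \<alpha>"
        by (rule reflect_suffix_all[where r = lex_le, OF alpha_digits alpha_suffix_le alpha_0])
          (use * reflect_le_swap lex_le_suffix in \<open>auto intro: lex.order_trans\<close>)
    qed
  qed simp
  finally show ?thesis .
qed

lemma strict_reflect_all:
  assumes "\<And>n. 0 < \<alpha> n \<Longrightarrow> reflect M (suffix (Suc n) \<alpha>) \<sqsubset> \<alpha>"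
  shows "reflect M (suffix k \<alpha>) \<sqsubset> \<alpha>"
  by (rule reflect_suffix_all[where r = less_fun, OF alpha_digits alpha_suffix_le alpha_0])
    (use assms reflect_less_swap less_fun_suffix in \<open>auto intro: lex.less_le_trans\<close>)

end

lemma expansion_of_one_le:
  assumes "1 < q" "c \<in> expansions M q 1" shows "q \<le> real M + 1"
proof -
  have "1 \<le> real M / (q - 1)" using assms val_le[of q c M] by (auto simp: expansions_iff)
  then show ?thesis using assms(1) by (simp add: field_simps)
qed

lemma U_base: "1 \<le> M \<Longrightarrow> p \<in> U M \<Longrightarrow> base M p"
  unfolding base_def U_def using expansion_of_one_le by blast

lemma V_base: "1 \<le> M \<Longrightarrow> p \<in> V M \<Longrightarrow> base M p"
  unfolding base_def V_def using expansion_of_one_le by blast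

section \<open>Dependence on the base\<close>

lemma val_le_antimono:
  assumes "1 < p" "p \<le> q" "c \<in> digit_seqs M" shows "val q c \<le> val p c"
  unfolding val_def
  by (rule suminf_le[OF _ summable_digits[OF _ assms(3)] summable_digits[OF _ assms(3)]])
    (use assms in \<open>auto intro!: divide_left_mono power_mono mult_mono\<close>)

lemma val_less_antimono:
  assumes "1 < p" "p < q" "c \<in> digit_seqs M" "0 < c 0" shows "val q c < val p c"
proof -
  have "0 < real (c 0) + val p (suffix 1 c)"
    using assms val_nonneg[OF assms(1) suffix_digit_seqs[OF assms(3)], of 1] by simp
  then have "(real (c 0) + val p (suffix 1 c)) / q < (real (c 0) + val p (suffix 1 c)) / p"
    using assms by (intro divide_strict_left_mono) auto
  moreover have "(real (c 0) + val q (suffix 1 c)) / q \<le> (real (c 0) + val p (suffix 1 c)) / q"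
    using assms val_le_antimono[OF assms(1) _ suffix_digit_seqs[OF assms(3)], of q 1]
    by (intro divide_right_mono) auto
  ultimately show ?thesis using val_step[of q c M] val_step[of p c M] assms by simp
qed

text \<open>Otherwise \<open>alpha M q\<close> meets the lexicographic criterion in base
  \<open>p\<close> and has value at most 1 there, although its value 1 in base \<open>q\<close>
  strictly increases when the base decreases.\<close>

lemma alpha_less:
  assumes "base M p" "base M q" "p < q" shows "alpha M p \<sqsubset> alpha M q"
proof (rule ccontr)
  interpret P: base M p by fact
  interpret Q: base M q by fact
  assume "\<not> alpha M p \<sqsubset> alpha M q"
  then have le: "alpha M q \<sqsubseteq> alpha M p" by simp
  have "val p (alpha M q) \<le> 1"
    by (rule val_le_one_if_lex[OF P.q P.alpha_digits _ Q.alpha_digits le])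
      (use P.val_alpha Q.alpha_suffix_le le in \<open>auto intro: lex.order_trans\<close>)
  then show False
    using val_less_antimono[OF P.q assms(3) Q.alpha_digits Q.alpha_0] Q.val_alpha by simp
qed

lemma alpha_less_iff:
  assumes "base M p" "base M q" shows "alpha M p \<sqsubset> alpha M q \<longleftrightarrow> p < q"
  using alpha_less[OF assms] alpha_less[OF assms(2,1)] less_fun_asym
  by (metis lex.less_irrefl linorder_less_linear)

lemma alpha_le_iff:
  assumes "base M p" "base M q" shows "alpha M p \<sqsubseteq> alpha M q \<longleftrightarrow> p \<le> q"
  using alpha_less_iff[OF assms(2,1)] by (metis lex.not_le not_le)

lemma psum_mono: "1 < q \<Longrightarrow> m \<le> n \<Longrightarrow> psum q m c \<le> psum q n c"
  unfolding psum_def by (rule sum_mono2) auto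

lemma quasi_psum_upper:
  assumes "1 < q" "quasi_seq M q d" "d k < M" shows "val q d \<le> psum q k d + real (d k + 1) / q ^ Suc k"
proof -
  have "val q (suffix (Suc k) d) / q ^ Suc k \<le> 1 / q ^ Suc k"
    using assms by (intro divide_right_mono) (auto simp: quasi_seq_def)
  then show ?thesis
    using val_psum[OF assms(1) quasi_digits[OF assms(2)], of "Suc k"]
    by (simp add: psum_Suc add_divide_distrib)
qed

text \<open>At the first difference \<open>k\<close> the tail of \<open>d\<close> is worth at most
  one unit, so \<open>val q d\<close> does not exceed the partial sum of \<open>c\<close> through
  position \<open>k\<close>. If \<open>k < N\<close>, this contradicts the last hypothesis.\<close>

lemma quasi_agree_left:
  assumes "1 < q" "quasi_seq M q d" "c \<in> digit_seqs M" "d \<sqsubset> c" "psum q N c < val q d"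
  shows "agree N d c"
proof -
  obtain k where k: "d k < c k" "agree k d c" using assms(4) by (auto simp: less_fun_agree)
  show ?thesis
  proof (cases "k < N")
    case True
    have "d k < M" using k(1) digit_seqs_le[OF assms(3), of k] by simp
    then have "val q d \<le> psum q k d + real (d k + 1) / q ^ Suc k"
      by (rule quasi_psum_upper[OF assms(1,2)])
    also have "\<dots> \<le> psum q k c + real (c k) / q ^ Suc k"
      using psum_agree[OF k(2)] k(1) assms(1) by (auto intro!: divide_right_mono)
    also have "\<dots> \<le> psum q N c" using psum_mono[OF assms(1), of "Suc k" N c] True by (simp add: psum_Suc)
    finally show ?thesis using assms(5) by simp
  next
    case False
    then show ?thesis using k(2) agree_mono by (meson not_less)
  qed
qed

lemma isCont_psum: "q \<noteq> 0 \<Longrightarrow> isCont (\<lambda>p. psum p n c) q"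
  unfolding psum_def by (intro continuous_intros) auto

lemma eventually_zero_imp_zero:
  assumes "\<not> finite_seq c" "\<And>i. n \<le> i \<Longrightarrow> c i = 0" shows "c = (\<lambda>_. 0)"
  using assms(2)
proof (induction n)
  case (Suc n)
  have "\<forall>i>n. c i = 0" using Suc.prems by simp
  then have "c n = 0" using assms(1) unfolding finite_seq_def by blast
  then show ?case using Suc.IH \<open>\<forall>i>n. c i = 0\<close> by (metis le_eq_less_or_eq)
qed auto

lemma psum_less_val:
  assumes "1 < q" "c \<in> digit_seqs M" "\<not> finite_seq c" "c \<noteq> (\<lambda>_. 0)" shows "psum q n c < val q c"
proof -
  have "\<exists>i. suffix n c i \<noteq> 0"
  proof (rule ccontr)
    assume none: "\<not> (\<exists>i. suffix n c i \<noteq> 0)"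
    have "c i = 0" if "n \<le> i" for i
    proof -
      have "suffix n c (i - n) = 0" using none by blast
      then show ?thesis using that by simp
    qed
    then show False using eventually_zero_imp_zero[OF assms(3)] assms(4) by blast
  qed
  then have "0 < val q (suffix n c)" using val_pos[OF assms(1) suffix_digit_seqs[OF assms(2)]] by blast
  then show ?thesis using val_psum[OF assms(1,2), of n] assms(1) by simp
qed

context base
begin

lemma alpha_nonzero: "\<alpha> \<noteq> (\<lambda>_. 0)"
  using alpha_0 by auto

text \<open>Since \<open>\<alpha>\<close> is infinite, its partial sums in base \<open>q\<close> are
  strictly below 1. By continuity this persists in nearby bases, where
  \<open>quasi_agree_left\<close> applies.\<close>

lemma alpha_left_continuous: "\<exists>e>0. \<forall>p. q - e < p \<and> p < q \<longrightarrow> base M p \<and> agree N (alpha M p) \<alpha>"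
proof -
  have "psum q N \<alpha> < 1"
    using psum_less_val[OF q alpha_digits alpha_not_finite alpha_nonzero] val_alpha by simp
  then have "\<forall>\<^sub>F p in at q. psum p N \<alpha> < 1"
    using isCont_psum[of q N \<alpha>] q by (intro order_tendstoD) (auto simp: isCont_def)
  then obtain e where e: "0 < e" "\<And>p. p \<noteq> q \<Longrightarrow> dist p q < e \<Longrightarrow> psum p N \<alpha> < 1"
    by (auto simp: eventually_at)
  have "base M p \<and> agree N (alpha M p) \<alpha>" if p: "q - min e (q - 1) < p" "p < q" for p
  proof -
    have "base M p" using p qM M by (auto simp: base_def min_def split: if_splits)
    then interpret P: base M p .
    have "psum p N \<alpha> < val p (alpha M p)"
      using e(2)[of p] p P.val_alpha by (auto simp: dist_real_def)
    then show ?thesis using \<open>base M p\<close> quasi_agree_left[OF P.q P.alpha_quasi alpha_digits alpha_less]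
      by (simp add: base_axioms p(2))
  qed
  then show ?thesis using e(1) q by (intro exI[of _ "min e (q - 1)"]) auto
qed

text \<open>A larger base cannot produce a smaller digit at the first difference from
  \<open>b\<close>, because the partial sums of \<open>b\<close> are at most 1 in base
  \<open>q\<close> and drop below 1 in base \<open>p\<close>. It cannot produce a larger digit
  either: the greedy inequalities for \<open>b\<close> are strict, so finitely many of them persist
  near \<open>q\<close>.\<close>

lemma alpha_right_limit:
  assumes b: "greedy_seq M q b" "val q b = 1"
  shows "\<exists>e>0. \<forall>p. q < p \<and> p < q + e \<and> p \<le> real M + 1 \<longrightarrow> agree N (alpha M p) b"
proof -
  have bd: "b \<in> digit_seqs M" using b(1) by (rule greedy_seq_digits)
  have "\<forall>\<^sub>F p in at q. b k < M \<longrightarrow> 1 < psum p k b + real (b k + 1) / p ^ Suc k" for k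
  proof (cases "b k < M")
    case True
    have "val q (suffix (Suc k) b) / q ^ Suc k < 1 / q ^ Suc k"
      using True b(1) q by (intro divide_strict_right_mono) (auto simp: greedy_seq_def)
    then have "1 < psum q k b + real (b k + 1) / q ^ Suc k"
      using val_psum[OF q bd, of "Suc k"] b(2) by (simp add: psum_Suc add_divide_distrib)
    moreover have "isCont (\<lambda>p. psum p k b + real (b k + 1) / p ^ Suc k) q"
      using isCont_psum[of q k b] q by (intro continuous_intros) auto
    ultimately have "\<forall>\<^sub>F p in at q. 1 < psum p k b + real (b k + 1) / p ^ Suc k"
      by (intro order_tendstoD) (auto simp: isCont_def)
    then show ?thesis by simp
  qed simp
  then have "\<forall>\<^sub>F p in at q. \<forall>k\<in>{..<N}. b k < M \<longrightarrow> 1 < psum p k b + real (b k + 1) / p ^ Suc k"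
    by (intro eventually_ball_finite) simp_all
  then obtain e where e0: "0 < e" and "\<forall>p\<in>UNIV. p \<noteq> q \<and> dist p q < e \<longrightarrow>
      (\<forall>k\<in>{..<N}. b k < M \<longrightarrow> 1 < psum p k b + real (b k + 1) / p ^ Suc k)"
    unfolding eventually_at by blast
  then have e: "1 < psum p k b + real (b k + 1) / p ^ Suc k"
    if "p \<noteq> q" "dist p q < e" "k < N" "b k < M" for p k
    using that by blast
  have "agree N (alpha M p) b" if p: "q < p" "p < q + e" "p \<le> real M + 1" for p
  proof (rule ccontr)
    assume na: "\<not> agree N (alpha M p) b"
    interpret P: base M p using p q M by (auto simp: base_def)
    have "alpha M p \<noteq> b" using na by auto
    then obtain k where k: "alpha M p k \<noteq> b k" "agree k (alpha M p) b" by (rule first_difference)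
    have kN: "k < N" using na k(2) agree_mono by (meson not_less)
    have eq: "psum p k (alpha M p) = psum p k b" using psum_agree[OF k(2)] .
    show False
    proof (cases "alpha M p k < b k")
      case True
      have "alpha M p k < M" using True digit_seqs_le[OF bd, of k] by simp
      then have "1 \<le> psum p k b + real (alpha M p k + 1) / p ^ Suc k"
        using quasi_psum_upper[OF P.q P.alpha_quasi, of k] unfolding P.val_alpha eq by blast
      also have "\<dots> \<le> psum p k b + real (b k) / p ^ Suc k"
        using True P.q by (auto intro!: divide_right_mono)
      also have "\<dots> < psum q k b + real (b k) / q ^ Suc k"
      proof (rule add_le_less_mono)
        show "psum p k b \<le> psum q k b" unfolding psum_def
        proof (rule sum_mono)
          fix i
          have "q ^ Suc i \<le> p ^ Suc i" using p q by (intro power_mono) simp_all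
          then show "real (b i) / p ^ Suc i \<le> real (b i) / q ^ Suc i"
            using q p by (intro divide_left_mono) simp_all
        qed
        have "q ^ Suc k < p ^ Suc k" using p q by (intro power_strict_mono) simp_all
        then show "real (b k) / p ^ Suc k < real (b k) / q ^ Suc k"
          using q p True by (intro divide_strict_left_mono) simp_all
      qed
      also have "\<dots> \<le> 1" using psum_le_val[OF q bd, of "Suc k"] b(2) by (simp add: psum_Suc)
      finally show False by simp
    next
      case False
      then have less: "b k < alpha M p k" using k(1) by simp
      then have "b k < M" using digit_seqs_le[OF P.alpha_digits, of k] by simp
      then have "1 < psum p k b + real (b k + 1) / p ^ Suc k"
        using e[of p k] p kN by (simp add: dist_real_def)
      also have "\<dots> \<le> psum p k b + real (alpha M p k) / p ^ Suc k"
        using less P.q by (intro add_left_mono divide_right_mono) auto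
      also have "\<dots> = psum p (Suc k) (alpha M p)" by (simp add: psum_Suc eq)
      also have "\<dots> \<le> 1" using psum_le_val[OF P.q P.alpha_digits] P.val_alpha by metis
      finally show False by simp
    qed
  qed
  then show ?thesis using e0 by blast
qed

end

section \<open>Continuity in the base and the sequences that occur as alpha\<close>

lemma isCont_val:
  assumes "1 < q" "c \<in> digit_seqs M" shows "isCont (\<lambda>p. val p c) q"
proof -
  \<comment> \<open>Evaluation is a power series in 1/p, and \<open>1 / K\<close> is a point of
    summability beyond \<open>1 / q\<close>.\<close>
  define K where "K = (1 + q) / 2"
  have K: "1 < K" "K < q" using assms(1) by (auto simp: K_def)
  have "(\<lambda>n. K * (real (c n) / K ^ Suc n)) = (\<lambda>n. real (c n) * (1 / K) ^ n)"
    using K(1) by (simp add: fun_eq_iff power_divide)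
  then have "summable (\<lambda>n. real (c n) * (1 / K) ^ n)"
    using summable_mult[OF summable_digits[OF K(1) assms(2)], of K] by simp
  moreover have "1 / q < 1 / K" using K by (simp add: frac_less2)
  then have "norm (1 / q) < norm (1 / K)" using K by simp
  ultimately have 1: "isCont (\<lambda>x. \<Sum>n. real (c n) * x ^ n) (1 / q)" by (rule isCont_powser)
  have 2: "isCont (\<lambda>p. 1 / p) q" using assms(1) by (intro continuous_intros) simp
  have "isCont (\<lambda>p. (1 / p) * (\<Sum>n. real (c n) * (1 / p) ^ n)) q"
    by (rule continuous_mult[OF 2 isCont_o2[OF 2 1]])
  moreover have "\<forall>\<^sub>F p in nhds q. (1 / p) * (\<Sum>n. real (c n) * (1 / p) ^ n) = val p c"
  proof -
    have "(1 / p) * (\<Sum>n. real (c n) * (1 / p) ^ n) = val p c" if "1 < p" for p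
    proof -
      have "(\<lambda>n. p * (real (c n) / p ^ Suc n)) = (\<lambda>n. real (c n) * (1 / p) ^ n)"
        using that by (simp add: fun_eq_iff power_divide)
      then have "summable (\<lambda>n. real (c n) * (1 / p) ^ n)"
        using summable_mult[OF summable_digits[OF that assms(2)], of p] by simp
      from suminf_mult[OF this, of "1 / p"] show ?thesis
        by (simp add: val_def power_divide)
    qed
    then show ?thesis
      using eventually_nhds_in_open[of "{1<..}" q] assms(1)
      by (auto elim!: eventually_mono)
  qed
  ultimately show ?thesis by (simp add: isCont_cong)
qed

text \<open>The base is found by the intermediate value theorem: near base 1 two nonzero digits
  already contribute more than 1, and in base M + 1 no sequence has value above 1. The last
  hypothesis then makes \<open>a\<close> quasi-greedy in the base found.\<close>

lemma alpha_exists: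
  assumes M: "1 \<le> M" and a: "a \<in> digit_seqs M" "\<not> finite_seq a" "0 < a 0" "\<And>n. suffix n a \<sqsubseteq> a"
  shows "\<exists>q. base M q \<and> alpha M q = a"
proof -
  obtain i where i: "a (Suc i) \<noteq> 0" using not_finite_seqD[OF a(2), of 0] a(3) by auto
  let ?n = "Suc (Suc i)"
  have "real (a 0) + real (a (Suc i)) \<le> psum 1 ?n a"
  proof -
    have "(\<Sum>j\<in>{0, Suc i}. real (a j)) \<le> (\<Sum>j<?n. real (a j))" by (rule sum_mono2) auto
    then show ?thesis by (simp add: psum_def)
  qed
  then have "1 < psum 1 ?n a" using i a(3) by linarith
  then have "\<forall>\<^sub>F p in at 1. 1 < psum p ?n a"
    using isCont_psum[of 1 ?n a] by (intro order_tendstoD) (auto simp: isCont_def)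
  then obtain e where e: "0 < e" "\<And>p. p \<noteq> 1 \<Longrightarrow> dist p 1 < e \<Longrightarrow> 1 < psum p ?n a"
    by (auto simp: eventually_at)
  define p where "p = 1 + min (e / 2) 1"
  have p: "1 < p" "p \<le> real M + 1" "dist p 1 < e" using e(1) M by (auto simp: p_def dist_real_def)
  have "1 \<le> val p a"
    using e(2)[of p] p psum_le_val[OF p(1) a(1), of ?n] by simp
  moreover have "val (real M + 1) a \<le> 1" using val_le[of "real M + 1" a M] M a(1) by simp
  moreover have "\<forall>x. p \<le> x \<and> x \<le> real M + 1 \<longrightarrow> isCont (\<lambda>x. val x a) x"
    using isCont_val[OF _ a(1)] p(1) by auto
  ultimately obtain q where root: "p \<le> q" "q \<le> real M + 1" "val q a = 1"
    using IVT2[of "\<lambda>x. val x a" "real M + 1" 1 p] p(2) by auto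
  interpret base M q using M root p by (simp add: base_def)
  have "val q (suffix (Suc n) a) \<le> 1" for n
    by (rule val_le_one_if_lex[OF q a(1) _ suffix_digit_seqs[OF a(1)] a(4)])
      (use root(3) a(4) in simp_all)
  then have "quasi_seq M q a" using a by (simp add: quasi_seq_def)
  then have "\<alpha> = a" using quasi_inj[OF q alpha_quasi] val_alpha root(3) by simp
  then show ?thesis using base_axioms by blast
qed

section \<open>The closure of U\<close>

context base
begin

text \<open>Left of \<open>q\<close> the tail at \<open>k\<close> decreases, so its reflection
  increases, while \<open>alpha M p\<close> itself decreases. Both changes make a violation at
  \<open>k\<close> worse, so agreement on the first \<open>k\<close> digits suffices to transfer
  it.\<close>

lemma V_left_closed:
  assumes "\<And>e. 0 < e \<Longrightarrow> \<exists>p\<in>V M. q - e < p \<and> p < q" shows "q \<in> V M"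
proof (rule ccontr)
  assume "q \<notin> V M"
  then obtain k where k: "\<alpha> \<sqsubset> reflect M (suffix k \<alpha>)"
    unfolding V_iff using lex.not_le by blast
  obtain e where e: "0 < e" "\<And>p. q - e < p \<Longrightarrow> p < q \<Longrightarrow> agree k (alpha M p) \<alpha>"
    using alpha_left_continuous[of k] by blast
  obtain p where p: "p \<in> V M" "q - e < p" "p < q" using assms[OF e(1)] by blast
  interpret P: base M p using V_base[OF M p(1)] .
  have less: "alpha M p \<sqsubset> \<alpha>" using alpha_less[OF P.base_axioms base_axioms p(3)] .
  have "suffix k (alpha M p) \<sqsubset> suffix k \<alpha>" using less e(2)[OF p(2,3)] less_fun_suffix by blast
  then have "reflect M (suffix k \<alpha>) \<sqsubset> reflect M (suffix k (alpha M p))" by (simp add: reflect_less)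
  also have "reflect M (suffix k (alpha M p)) \<sqsubseteq> alpha M p" using p(1) by (simp add: P.V_iff)
  finally show False using k less by (meson lex.less_asym lex.less_trans)
qed

text \<open>A failure at \<open>n\<close> excludes \<open>q\<close> from \<open>U\<close>, so bases
  of \<open>U\<close> accumulate at \<open>q\<close>. From the left the chain of inequalities of
  \<open>V_left_closed\<close> forbids this. From the right \<open>alpha M p\<close> tends to the
  greedy expansion \<open>b\<close> of 1, and the proof distinguishes whether \<open>b\<close> is
  finite.\<close>

lemma closure_U_strict:
  assumes cl: "q \<in> closure (U M)" and top: "q \<noteq> real M + 1"
  shows "reflect M (suffix k \<alpha>) \<sqsubset> \<alpha>"
proof (rule strict_reflect_all, rule ccontr)
  fix n assume n: "0 < \<alpha> n" and "\<not> reflect M (suffix (Suc n) \<alpha>) \<sqsubset> \<alpha>"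
  then have ge: "\<alpha> \<sqsubseteq> reflect M (suffix (Suc n) \<alpha>)" by simp
  then have "q \<notin> U M" using n strict_seqsD(3)[of \<alpha> M \<alpha> n] by (auto simp: U_iff)
  then have close: "\<exists>p\<in>U M. p \<noteq> q \<and> \<bar>p - q\<bar> < e" if "0 < e" for e
    using cl that unfolding closure_approachable dist_real_def by metis
  obtain e1 where e1: "0 < e1" "\<And>p. q - e1 < p \<Longrightarrow> p < q \<Longrightarrow> agree (Suc n) (alpha M p) \<alpha>"
    using alpha_left_continuous[of "Suc n"] by blast
  have left: False if p: "p \<in> U M" "q - e1 < p" "p < q" for p
  proof -
    interpret P: base M p using U_base[OF M p(1)] .
    have less: "alpha M p \<sqsubset> \<alpha>" using alpha_less[OF P.base_axioms base_axioms p(3)] .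
    have eq: "agree (Suc n) (alpha M p) \<alpha>" using e1 p by blast
    then have "suffix (Suc n) (alpha M p) \<sqsubset> suffix (Suc n) \<alpha>" using less less_fun_suffix by blast
    then have "reflect M (suffix (Suc n) \<alpha>) \<sqsubset> reflect M (suffix (Suc n) (alpha M p))"
      by (simp add: reflect_less)
    moreover have "0 < alpha M p n" using n agreeD[OF eq, of n] by simp
    then have "reflect M (suffix (Suc n) (alpha M p)) \<sqsubset> alpha M p"
      using p(1) strict_seqsD(3) by (auto simp: P.U_iff)
    ultimately show False using ge less by (meson lex.leD lex.less_imp_le lex.less_trans)
  qed
  obtain b where b: "greedy_seq M q b" "val q b = 1" using greedy_seq_exists[OF one_in_J] by blast
  have "\<exists>e>0. \<forall>p\<in>U M. \<not> (q < p \<and> p < q + e)"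
  proof (cases "finite_seq b")
    case True
    then obtain m where m: "b m \<noteq> 0" "suffix (Suc m) b = (\<lambda>_. 0)" by (auto simp: finite_seq_iff)
    \<comment> \<open>With this length \<open>alpha M p\<close> has m + 2 zeros after position
      \<open>m\<close>. The reflected tail then begins with m + 2 digits \<open>M\<close>, whereas
      \<open>alpha M p\<close> has a zero at index m + 1, so the reflected tail cannot be
      smaller.\<close>
    let ?N = "Suc (Suc m) + Suc m"
    obtain e where e: "0 < e" "\<And>p. q < p \<Longrightarrow> p < q + e \<Longrightarrow> p \<le> real M + 1 \<Longrightarrow> agree ?N (alpha M p) b"
      using alpha_right_limit[OF b, of ?N] by blast
    have False if p: "p \<in> U M" "q < p" "p < q + e" for p
    proof -
      interpret P: base M p using U_base[OF M p(1)] .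
      have eq: "agree ?N (alpha M p) b" using e p P.qM by blast
      have "0 < alpha M p m" using m(1) agreeD[OF eq, of m] by simp
      then have lt: "reflect M (suffix (Suc m) (alpha M p)) \<sqsubset> alpha M p"
        using p(1) strict_seqsD(3) by (auto simp: P.U_iff)
      have z: "alpha M p (Suc m + i) = 0" if "i < Suc (Suc m)" for i
        using agreeD[OF eq, of "Suc m + i"] that fun_cong[OF m(2), of i] by simp
      have "agree (Suc (Suc m)) (reflect M (suffix (Suc m) (alpha M p))) (\<lambda>_. M)"
        using z by (simp add: agree_def reflect_nth)
      moreover have "alpha M p (Suc m) \<noteq> M" using z[of 0] M by simp
      moreover have "\<And>i. alpha M p i \<le> M" using digit_seqs_le[OF P.alpha_digits] .
      ultimately show False
        using lex_le_imp[OF lex.less_imp_le[OF lt], of "Suc (Suc m)"]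
        unfolding below_def agree_def by (metis lessI less_trans not_le)
    qed
    then show ?thesis using e(1) by blast
  next
    case False
    then have "quasi_seq M q b" using b(1) by (auto simp: quasi_seq_def greedy_seq_def less_imp_le)
    then have [simp]: "b = \<alpha>" using quasi_inj[OF q alpha_quasi] val_alpha b(2) by simp
    \<comment> \<open>Applying the equation twice would give the period 2(n + 1), whose last digit
      is M - \<open>\<alpha> n\<close> and hence below \<open>M\<close>. The tail after it would be
      \<open>\<alpha>\<close> itself, but \<open>\<alpha>\<close> is greedy here.\<close>
    have "\<alpha> \<noteq> reflect M (suffix (Suc n) \<alpha>)"
    proof
      assume eq: "\<alpha> = reflect M (suffix (Suc n) \<alpha>)"
      have "\<alpha> (n + Suc n) = M - \<alpha> n"
        using fun_cong[OF eq, of n] digit_seqs_le[OF alpha_digits, of "n + Suc n"]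
        by (simp add: reflect_nth add.commute)
      then have "\<alpha> (n + Suc n) < M" using n M by simp
      then have "suffix (Suc (n + Suc n)) \<alpha> \<sqsubset> \<alpha>" using b(1) by (simp add: greedy_seq_iff)
      moreover have "suffix (Suc n) \<alpha> = reflect M \<alpha>"
        using arg_cong[OF eq, of "reflect M"] by simp
      then have "suffix (Suc n) (suffix (Suc n) \<alpha>) = \<alpha>"
        using eq by (simp add: suffix_reflect)
      ultimately show False by (simp add: add.commute)
    qed
    then have "\<alpha> \<sqsubset> reflect M (suffix (Suc n) \<alpha>)" using ge by (auto simp: lex_le_def)
    then obtain j where j: "below (Suc j) \<alpha> (reflect M (suffix (Suc n) \<alpha>))"
      unfolding below_def less_fun_agree by blast
    obtain e where e: "0 < e"
      "\<And>p. q < p \<Longrightarrow> p < q + e \<Longrightarrow> p \<le> real M + 1 \<Longrightarrow> agree (Suc n + Suc j) (alpha M p) \<alpha>"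
      using alpha_right_limit[OF b, of "Suc n + Suc j"] by auto
    have False if p: "p \<in> U M" "q < p" "p < q + e" for p
    proof -
      interpret P: base M p using U_base[OF M p(1)] .
      have eq: "agree (Suc n + Suc j) (alpha M p) \<alpha>" using e p P.qM by blast
      have "0 < alpha M p n" using n agreeD[OF eq, of n] by simp
      then have lt: "reflect M (suffix (Suc n) (alpha M p)) \<sqsubset> alpha M p"
        using p(1) strict_seqsD(3) by (auto simp: P.U_iff)
      have "agree (Suc j) (alpha M p) \<alpha>"
        "agree (Suc j) (reflect M (suffix (Suc n) (alpha M p))) (reflect M (suffix (Suc n) \<alpha>))"
        using agree_mono[OF eq, of "Suc j"] agree_reflect[OF agree_suffix[OF eq, of "Suc n" "Suc j"]]
        by simp_all
      then have "below (Suc j) (alpha M p) (reflect M (suffix (Suc n) (alpha M p)))"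
        using j below_cong by blast
      then show False using lt below_imp_less lex.less_asym by blast
    qed
    then show ?thesis using e(1) by blast
  qed
  then obtain e2 where e2: "0 < e2" "\<And>p. p \<in> U M \<Longrightarrow> q < p \<Longrightarrow> p < q + e2 \<Longrightarrow> False" by blast
  obtain p where "p \<in> U M" "p \<noteq> q" "\<bar>p - q\<bar> < min e1 e2" using close[of "min e1 e2"] e1(1) e2(1) by auto
  then show False using left[of p] e2(2)[of p] by (cases "p < q") auto
qed

end

text \<open>
  The least \<open>k\<close> at which \<open>f k\<close> agrees with \<open>a\<close> up to position \<open>N\<close> has the required property itself,
  so if only finitely many \<open>N\<close> had it, some \<open>f k\<close> would agree with \<open>a\<close> up to arbitrarily large \<open>N\<close>.
\<close>

lemma strict_positions:
  assumes a: "\<And>i. suffix i a \<sqsubseteq> a" and f: "\<And>i j. suffix i (f j) = f (j + i)"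
    and less: "\<And>j. s \<le> j \<Longrightarrow> f j \<sqsubset> a"
  shows "\<exists>N\<ge>n. \<forall>k. s \<le> k \<and> k < N \<longrightarrow> below (N - k) (f k) a"
proof (rule ccontr)
  assume none: "\<not> ?thesis"
  have "\<exists>k<n. s \<le> k \<and> agree (N - k) (f k) a" if N: "n \<le> N" for N
  proof -
    define P where "P = (\<lambda>k. s \<le> k \<and> k < N \<and> agree (N - k) (f k) a)"
    have "\<exists>k. P k"
      using none N lex_le_imp[OF lex.less_imp_le[OF less]] unfolding P_def by blast
    then have least: "P (LEAST k. P k)" by (rule LeastI_ex)
    define k where "k = (LEAST k. P k)"
    have k: "s \<le> k" "k < N" "agree (N - k) (f k) a" using least by (auto simp: P_def k_def)
    have "below (k - j) (f j) a" if j: "s \<le> j" "j < k" for j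
    proof (rule ccontr)
      assume "\<not> below (k - j) (f j) a"
      then have ag: "agree (k - j) (f j) a" using lex_le_imp[OF lex.less_imp_le[OF less]] j by blast
      have fk: "suffix (k - j) (f j) = f k" using f[of "k - j" j] j by simp
      have "f k \<sqsubseteq> suffix (k - j) a"
        using lex_le_suffix[OF ag] less[OF j(1)] by (simp add: fk lex.less_imp_le)
      then have "agree (N - k) (f k) (suffix (k - j) a)"
        using lex_le_imp[of "f k" "suffix (k - j) a" "N - k"] lex_le_imp[OF a, of "N - k" "k - j"]
          below_trans below_cong[of "N - k" "f k" "f k" "suffix (k - j) a" a] below_not_agree k(3)
        by (metis agree_refl)
      then have "agree ((k - j) + (N - k)) (f j) a" using ag unfolding agree_add fk by blast
      then have "P j" using j k by (simp add: P_def)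
      then show False using j(2) not_less_Least[of j P] by (simp add: k_def)
    qed
    then have "k < n" using none by (meson not_less)
    then show ?thesis using k by blast
  qed
  then have "\<forall>N. \<exists>k<n. s \<le> k \<and> agree (n + N - k) (f k) a" by (meson le_add1)
  then obtain g where g: "\<And>N. g N < n" "\<And>N. s \<le> g N" "\<And>N. agree (n + N - g N) (f (g N)) a" by metis
  have "finite (range g)" using g(1) by (intro finite_subset[of "range g" "{..<n}"]) auto
  then obtain k where "infinite {N. g N = k}"
    using pigeonhole_infinite[of UNIV g] by auto
  have "agree i (f k) a" for i
  proof -
    obtain N where "g N = k" "i \<le> N"
      using \<open>infinite {N. g N = k}\<close> unfolding infinite_nat_iff_unbounded_le by auto
    then show ?thesis using g(1,3)[of N] agree_mono[of "n + N - k" "f k" a i] by simp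
  qed
  then have "f k = a" by (rule agree_all)
  moreover have "s \<le> k" using g(2) \<open>infinite {N. g N = k}\<close> by (metis (mono_tags, lifting) empty_Collect_eq finite.emptyI)
  ultimately show False using less by fastforce
qed

section \<open>Spliced sequences and lowered periods\<close>

lemma splice_nth: "(prefix n c \<frown> a) i = (if i < n then c i else a (i - n))"
  by simp

lemma suffix_splice_ge: "n \<le> k \<Longrightarrow> suffix k (prefix n c \<frown> a) = suffix (k - n) a"
  by simp

lemma agree_splice: "agree n (prefix n c \<frown> a) c"
  by (simp add: agree_def)

lemma splice_digit_seqs: "c \<in> digit_seqs M \<Longrightarrow> a \<in> digit_seqs M \<Longrightarrow> prefix n c \<frown> a \<in> digit_seqs M"
  unfolding digit_seqs_def by (simp add: splice_nth)

text \<open>The sequence \<open>(a\<^sub>1 \<dots> a\<^sub>m\<^sup>-)\<^sup>\<infinity>\<close>.\<close>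

definition lowered_period :: "nat \<Rightarrow> (nat \<Rightarrow> nat) \<Rightarrow> nat \<Rightarrow> nat" where
  "lowered_period m a = (\<lambda>i. if Suc (i mod m) = m then a (i mod m) - 1 else a (i mod m))"

lemma lowered_period_suffix: "suffix k (lowered_period m a) = suffix (k mod m) (lowered_period m a)"
  by (simp add: lowered_period_def fun_eq_iff mod_simps)

lemma lowered_period_agree: "agree (m - 1) (lowered_period m a) a"
  unfolding agree_def lowered_period_def by auto

lemma lowered_period_digits: "a \<in> digit_seqs M \<Longrightarrow> lowered_period m a \<in> digit_seqs M"
  unfolding digit_seqs_def lowered_period_def by (auto intro: le_trans diff_le_self)

lemma lowered_period_below:
  assumes a: "\<And>i. suffix i a \<sqsubseteq> a" and am: "0 < a (m - 1)" and m: "1 \<le> m"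
  shows "below m (suffix k (lowered_period m a)) a"
proof -
  define r where "r = k mod m"
  have r: "r < m" using m by (simp add: r_def)
  have ag: "agree (m - 1 - r) (suffix r (lowered_period m a)) (suffix r a)"
    by (rule agree_suffix[OF lowered_period_agree]) (use r in simp)
  have low: "lowered_period m a (r + (m - 1 - r)) < a (r + (m - 1 - r))"
    using am r m by (simp add: lowered_period_def)
  have "below (m - r) (suffix r (lowered_period m a)) a"
    by (rule below_lower[where f = "suffix r a", OF lex_le_imp[OF a] ag]) (use low r in auto)
  then show ?thesis
    unfolding lowered_period_suffix[of k] r_def[symmetric] by (rule below_mono) simp
qed

text \<open>The lowered last digit becomes a raised one under reflection, so at offset
  \<open>r\<close> the first \<open>m - r\<close> digits may coincide with those of
  \<open>a\<close>. The tail then continues with the reflected period, to be compared with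
  \<open>a\<close> from position \<open>m - r\<close>; reflecting \<open>good\<close> at
  \<open>m - r\<close> decides this. For \<open>r = 0\<close> the hypothesis \<open>start\<close>
  excludes the equality.\<close>

lemma lowered_period_reflect_below:
  assumes a: "a \<in> digit_seqs M"
    and am: "0 < a (m - 1)" and m: "1 \<le> m"
    and good: "\<And>k. k < m \<Longrightarrow> below (m - k) (reflect M (suffix k a)) a"
    and start: "below (m - 1) (reflect M a) a"
  shows "below m (reflect M (suffix k (lowered_period m a))) a"
proof -
  let ?g = "lowered_period m a"
  define r where "r = k mod m"
  have r: "r < m" using m by (simp add: r_def)
  have ag: "agree (m - 1 - r) (suffix r ?g) (suffix r a)"
    by (rule agree_suffix[OF lowered_period_agree]) (use r in simp)
  have low: "?g (m - 1) = a (m - 1) - 1"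
    using m by (simp add: lowered_period_def)
  have Suc: "Suc (m - 1 - r) = m - r" using r by simp
  have "below (m - r) (reflect M (suffix r ?g)) a \<or> agree (m - r) (reflect M (suffix r ?g)) a"
    unfolding Suc[symmetric]
  proof (rule below_raise)
    show "below (Suc (m - 1 - r)) (reflect M (suffix r a)) a" using good[OF r] Suc by simp
    show "agree (m - 1 - r) (reflect M (suffix r ?g)) (reflect M (suffix r a))"
      by (rule agree_reflect[OF ag])
    show "reflect M (suffix r ?g) (m - 1 - r) \<le> Suc (reflect M (suffix r a) (m - 1 - r))"
      using low r am by (simp add: reflect_nth)
  qed
  then have "below m (reflect M (suffix r ?g)) a"
  proof
    assume "below (m - r) (reflect M (suffix r ?g)) a"
    then show ?thesis by (rule below_mono) simp
  next
    assume eq: "agree (m - r) (reflect M (suffix r ?g)) a"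
    have "agree (m - 1) (reflect M a) (reflect M ?g)"
      by (rule agree_reflect[OF agree_sym[OF lowered_period_agree]])
    show ?thesis
    proof (cases "r = 0")
      case True
      then have "agree (m - 1) (reflect M a) a"
        using eq agree_mono[of m "reflect M ?g" a "m - 1"] \<open>agree (m - 1) (reflect M a) (reflect M ?g)\<close>
          agree_trans by (metis diff_le_self minus_nat.diff_0 suffix_0)
      then show ?thesis using start below_not_agree by blast
    next
      case False
      have "below r (reflect M (suffix (m - r) a)) a" using good[of "m - r"] r False by simp
      then have "below r (reflect M a) (suffix (m - r) a)"
        using below_reflect[of "reflect M (suffix (m - r) a)" M a r] a by simp
      moreover have "agree r (reflect M a) (reflect M ?g)"
        using agree_mono \<open>agree (m - 1) (reflect M a) (reflect M ?g)\<close> r by (metis One_nat_def Suc_leI Suc_pred' le_diff_conv2 m Suc_eq_plus1 Suc_le_mono)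
      ultimately have "below r (reflect M ?g) (suffix (m - r) a)" using below_cong agree_refl by blast
      moreover have "suffix m ?g = ?g" using lowered_period_suffix[of m m a] by simp
      then have "suffix (m - r) (reflect M (suffix r ?g)) = reflect M ?g"
        using r by (simp add: suffix_reflect)
      ultimately obtain i where i: "i < r" "agree i (suffix (m - r) (reflect M (suffix r ?g))) (suffix (m - r) a)"
        "suffix (m - r) (reflect M (suffix r ?g)) i < suffix (m - r) a i"
        unfolding below_def by metis
      then have "agree (m - r + i) (reflect M (suffix r ?g)) a" unfolding agree_add using eq by blast
      then show ?thesis using i r unfolding below_def by (intro exI[of _ "m - r + i"]) auto
    qed
  qed
  then show ?thesis unfolding lowered_period_suffix[of k] r_def[symmetric] .
qed

context base
begin

lemma good_positions:
  assumes strict: "\<And>k. reflect M (suffix k \<alpha>) \<sqsubset> \<alpha>"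
  obtains m where "n \<le> m" "1 \<le> m" "\<And>k. k < m \<Longrightarrow> below (m - k) (reflect M (suffix k \<alpha>)) \<alpha>"
    "0 < \<alpha> (m - 1)" "\<And>k. below m (suffix k (lowered_period m \<alpha>)) \<alpha>"
    "\<And>k. below m (reflect M (suffix k (lowered_period m \<alpha>))) \<alpha>"
proof -
  obtain l where l: "below l (reflect M \<alpha>) \<alpha>"
    using strict[of 0] by (auto simp: below_def less_fun_agree)
  \<comment> \<open>The bound \<open>Suc l\<close> ensures that the comparison of the reflection of
    \<open>\<alpha>\<close> with \<open>\<alpha>\<close> is decided before the digit at
    \<open>m - 1\<close>, which is the one to be lowered.\<close>
  obtain m where m: "max n (Suc l) \<le> m" "\<And>k. k < m \<Longrightarrow> below (m - k) (reflect M (suffix k \<alpha>)) \<alpha>"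
    using strict_positions[of \<alpha> "\<lambda>k. reflect M (suffix k \<alpha>)" 0 "max n (Suc l)",
        OF alpha_suffix_le _ strict] by (auto simp: suffix_reflect)
  have pos: "0 < \<alpha> (m - 1)"
  proof -
    have "below 1 (reflect M (suffix (m - 1) \<alpha>)) \<alpha>" using m(2)[of "m - 1"] m(1) by simp
    then show ?thesis using digit_seqs_le[OF alpha_digits, of 0] by (auto simp: below_def reflect_nth)
  qed
  have m1: "n \<le> m" "1 \<le> m" "l \<le> m - 1" using m(1) by auto
  have start: "below (m - 1) (reflect M \<alpha>) \<alpha>" by (rule below_mono[OF l m1(3)])
  show ?thesis
    by (rule that[OF m1(1,2) m(2) pos lowered_period_below[OF alpha_suffix_le pos m1(2)]
          lowered_period_reflect_below[OF alpha_digits pos m1(2) m(2) start]])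
qed

text \<open>
  A weak sequence fails to be strict at a first position \<open>n\<close>, where (up to reflection) its tail
  is \<open>\<alpha>\<close>; replacing that tail by \<open>(\<alpha>\<^sub>1 \<dots> \<alpha>\<^sub>m\<^sup>-)\<^sup>\<infinity>\<close> makes all inequalities strict.
\<close>

lemma weak_seqs_approx:
  assumes strict: "\<And>k. reflect M (suffix k \<alpha>) \<sqsubset> \<alpha>" and c: "c \<in> weak_seqs M \<alpha>"
  shows "\<exists>d\<in>strict_seqs M \<alpha>. agree N d c"
proof -
  have up: "\<exists>d\<in>strict_seqs M \<alpha>. agree N d c"
    if c: "c \<in> weak_seqs M \<alpha>" and n: "c n < M" "suffix (Suc n) c = \<alpha>" for c n
  proof -
    have cd: "c \<in> digit_seqs M" using c by (rule weak_seqsD)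
    have "\<exists>K. below K (reflect M (suffix (Suc i) c)) \<alpha>" if "0 < c i" "i \<le> n" for i
    proof -
      have "reflect M (suffix (Suc i) c) \<noteq> \<alpha>"
      proof
        assume eq: "reflect M (suffix (Suc i) c) = \<alpha>"
        have "suffix (n - i) (reflect M (suffix (Suc i) c)) = reflect M \<alpha>"
          using n(2) that(2) by (simp add: suffix_reflect)
        then have "reflect M (suffix (n - i) \<alpha>) = \<alpha>" by (simp add: eq)
        then show False using strict[of "n - i"] by simp
      qed
      then have "reflect M (suffix (Suc i) c) \<sqsubset> \<alpha>"
        using weak_seqsD(3)[OF c that(1)] by (auto simp: lex_le_def)
      then show ?thesis unfolding below_def less_fun_agree by blast
    qed
    then obtain K where K: "\<And>i. 0 < c i \<Longrightarrow> i \<le> n \<Longrightarrow> below (K i) (reflect M (suffix (Suc i) c)) \<alpha>"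
      by metis
    \<comment> \<open>One depth for the required precision and for all of the finitely many strict
      comparisons starting at or before \<open>n\<close>.\<close>
    define L where "L = Max (insert N (K ` {..n}))"
    have L: "N \<le> L" "\<And>i. i \<le> n \<Longrightarrow> K i \<le> L" unfolding L_def by (intro Max_ge; simp)+
    obtain m where m: "Suc L \<le> m" "\<And>k. below m (suffix k (lowered_period m \<alpha>)) \<alpha>"
        "\<And>k. below m (reflect M (suffix k (lowered_period m \<alpha>))) \<alpha>"
      by (rule good_positions[OF strict, of "Suc L"], rule that)
    let ?g = "lowered_period m \<alpha>"
    define d where "d = prefix (Suc n) c \<frown> ?g"
    have d_ge: "suffix k d = suffix (k - Suc n) ?g" if "Suc n \<le> k" for k
      using that unfolding d_def by (rule suffix_splice_ge)
    have d_agree: "agree (Suc n + L) d c"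
      unfolding agree_add d_ge[OF order_refl] n(2)
      using agree_splice[of "Suc n" c ?g] agree_mono[OF lowered_period_agree, of L m \<alpha>] m(1)
      by (simp add: d_def)
    have dd: "d \<in> digit_seqs M" unfolding d_def
      by (rule splice_digit_seqs[OF cd lowered_period_digits[OF alpha_digits]])
    have "d \<in> strict_seqs M \<alpha>" unfolding strict_seqs_def
    proof (intro CollectI conjI allI impI dd)
      fix i
      show "suffix (Suc i) d \<sqsubset> \<alpha>" if "d i < M"
      proof (cases "i \<le> n")
        case True
        then have "c i < M" using agreeD[OF d_agree, of i] that by simp
        have ag: "agree (n - i) (suffix (Suc i) d) (suffix (Suc i) c)"
          by (rule agree_suffix[OF d_agree]) (use True in simp)
        have "suffix (n - i) (suffix (Suc i) d) = ?g"
          "suffix (n - i) (suffix (Suc i) c) = \<alpha>"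
          using d_ge[of "Suc n"] n(2) True by simp_all
        then have "suffix (Suc i) d \<sqsubset> suffix (Suc i) c"
          using less_fun_suffix[OF ag] m(2)[of 0] below_imp_less by auto
        also have "suffix (Suc i) c \<sqsubseteq> \<alpha>" using weak_seqsD(2)[OF c \<open>c i < M\<close>] .
        finally show ?thesis .
      next
        case False
        then show ?thesis using d_ge[of "Suc i"] m(2) below_imp_less by auto
      qed
      show "reflect M (suffix (Suc i) d) \<sqsubset> \<alpha>" if "0 < d i"
      proof (cases "i \<le> n")
        case True
        then have "0 < c i" using agreeD[OF d_agree, of i] that by simp
        then have "below L (reflect M (suffix (Suc i) c)) \<alpha>"
          using K L(2) True below_mono by blast
        moreover have "agree L (suffix (Suc i) c) (suffix (Suc i) d)"
          by (rule agree_suffix[OF agree_sym[OF d_agree]]) (use True in simp)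
        ultimately have "below L (reflect M (suffix (Suc i) d)) \<alpha>"
          using below_cong[OF agree_reflect agree_refl] by blast
        then show ?thesis by (rule below_imp_less)
      next
        case False
        then show ?thesis using d_ge[of "Suc i"] m(3) below_imp_less by auto
      qed
    qed
    moreover have "agree N d c" using d_agree L(1) agree_mono by (metis le_add2 order_trans)
    ultimately show ?thesis by blast
  qed
  show ?thesis
  proof (cases "c \<in> strict_seqs M \<alpha>")
    case False
    then obtain n where n: "c n < M \<and> suffix (Suc n) c = \<alpha> \<or> 0 < c n \<and> reflect M (suffix (Suc n) c) = \<alpha>"
      using c unfolding strict_seqs_def weak_seqs_def lex_le_def by auto
    then show ?thesis
    proof
      assume *: "0 < c n \<and> reflect M (suffix (Suc n) c) = \<alpha>"
      have "reflect M c n < M" using * digit_seqs_le[OF weak_seqsD(1)[OF c], of n] by (simp add: reflect_nth)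
      moreover have "suffix (Suc n) (reflect M c) = \<alpha>" using * by (simp add: suffix_reflect)
      ultimately obtain d where d: "d \<in> strict_seqs M \<alpha>" "agree N d (reflect M c)"
        using up[OF weak_seqs_reflect[OF c]] by blast
      then have "agree N (reflect M d) c"
        using agree_reflect[OF d(2), of M] weak_seqsD(1)[OF c] by simp
      then show ?thesis using strict_seqs_reflect[OF d(1)] by blast
    qed (use up[OF c] in blast)
  next
    case True
    then show ?thesis using agree_refl by blast
  qed
qed

text \<open>If \<open>\<alpha>\<close> is not periodic, \<open>q\<close> itself lies in
  \<open>U\<close>. Otherwise bases of \<open>U\<close> increasing to \<open>q\<close> are obtained
  from \<open>\<alpha>\<^sub>1 \<dots> \<alpha>\<^sub>N\<^sup>- (\<alpha>\<^sub>1 \<dots>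
  \<alpha>\<^sub>m\<^sup>-)\<^sup>\<infinity>\<close> with \<open>N\<close> well above
  \<open>m\<close>. The tails in the periodic part are then compared with \<open>\<alpha>\<close>
  within a prefix that the new sequence shares with \<open>\<alpha>\<close>. Periodicity also bounds
  by one \<open>L\<close> the depth at which any reflected tail of \<open>\<alpha>\<close> falls
  below \<open>\<alpha>\<close>.\<close>

lemma strict_in_closure_U:
  assumes strict: "\<And>k. reflect M (suffix k \<alpha>) \<sqsubset> \<alpha>" shows "q \<in> closure (U M)"
proof (cases "\<exists>k\<ge>1. suffix k \<alpha> = \<alpha>")
  case False
  then have "suffix (Suc n) \<alpha> \<sqsubset> \<alpha>" for n using alpha_suffix_le[of "Suc n"] by (auto simp: lex_le_def)
  then have "q \<in> U M" unfolding U_iff strict_seqs_def using strict by auto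
  then show ?thesis using closure_subset by blast
next
  case True
  then obtain p where p: "1 \<le> p" "suffix p \<alpha> = \<alpha>" by auto
  have mult: "suffix (j * p) \<alpha> = \<alpha>" for j
  proof (induction j)
    case (Suc j)
    have "suffix (p + j * p) \<alpha> = suffix (j * p) (suffix p \<alpha>)" by simp
    also have "\<dots> = \<alpha>" unfolding p(2) using Suc .
    finally show ?case by simp
  qed simp
  have per: "suffix k \<alpha> = suffix (k mod p) \<alpha>" for k
  proof -
    have "suffix k \<alpha> = suffix (k mod p) (suffix (k div p * p) \<alpha>)" by simp
    then show ?thesis unfolding mult .
  qed
  have "\<forall>k. \<exists>l. below l (reflect M (suffix k \<alpha>)) \<alpha>"
    using strict unfolding below_def less_fun_agree by blast
  then obtain l where l: "\<And>k. below (l k) (reflect M (suffix k \<alpha>)) \<alpha>" by metis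
  define L where "L = Max (insert 1 (l ` {..<p}))"
  have "l k \<le> L" if "k < p" for k unfolding L_def using that by auto
  then have L: "below L (reflect M (suffix k \<alpha>)) \<alpha>" for k
    unfolding per[of k] using below_mono[OF l] p(1) by simp
  have L1: "1 \<le> L" unfolding L_def by auto
  show ?thesis unfolding closure_approachable
  proof (intro allI impI)
    fix e :: real assume e: "0 < e"
    \<comment> \<open>It suffices to find a base of \<open>U\<close> between \<open>p0\<close> and
      \<open>q\<close>. The index \<open>j\<close> separates the two expansions of 1, so a sequence
      below \<open>\<alpha>\<close> that shares more than \<open>j\<close> digits with it belongs to
      such a base.\<close>
    define p0 where "p0 = max (q - e / 2) ((1 + q) / 2)"
    have p0: "base M p0" "p0 < q" "q - e < p0"
      using q qM M e by (auto simp: p0_def base_def max_def)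
    obtain j where j: "alpha M p0 j < \<alpha> j" "agree j (alpha M p0) \<alpha>"
      using alpha_less[OF p0(1) base_axioms p0(2)] by (auto simp: less_fun_agree)
    obtain m where m: "Suc L \<le> m" "\<And>k. below m (suffix k (lowered_period m \<alpha>)) \<alpha>"
        "\<And>k. below m (reflect M (suffix k (lowered_period m \<alpha>))) \<alpha>"
      by (rule good_positions[OF strict, of "Suc L"], rule that)
    obtain N where N: "Suc (m + L + Suc j) \<le> N" "\<And>k. k < N \<Longrightarrow> below (N - k) (reflect M (suffix k \<alpha>)) \<alpha>"
        "0 < \<alpha> (N - 1)"
      by (rule good_positions[OF strict, of "Suc (m + L + Suc j)"], rule that)
    let ?g = "lowered_period m \<alpha>"
    define d where "d = prefix N (\<alpha>(N - 1 := \<alpha> (N - 1) - 1)) \<frown> ?g"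
    have dn: "d i = (if i < N - 1 then \<alpha> i else if i = N - 1 then \<alpha> (N - 1) - 1 else ?g (i - N))" for i
      using N(1) unfolding d_def splice_nth by auto
    have dd: "d \<in> digit_seqs M"
      using digit_seqs_le[OF alpha_digits] digit_seqs_le[OF lowered_period_digits[OF alpha_digits]]
      unfolding digit_seqs_def dn by (auto intro: le_trans diff_le_self)
    have d_agree: "agree (N - 1) d \<alpha>" by (simp add: agree_def dn)
    have d_ge: "suffix k d = suffix (k - N) ?g" if "N \<le> k" for k
      using that unfolding d_def by (rule suffix_splice_ge)
    have to_d: "f \<sqsubset> d" if "below k f \<alpha>" "k \<le> N - 1" for f k
      using that below_cong[OF agree_refl agree_mono[OF d_agree that(2)]] below_imp_less by blast
    have ag: "agree (N - 1 - k) (suffix k d) (suffix k \<alpha>)" if "k < N" for k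
      by (rule agree_suffix[OF d_agree]) (use that in simp)
    have up: "suffix k d \<sqsubset> d" if "1 \<le> k" for k
    proof (cases "k < N")
      case True
      have "below (N - k) (suffix k d) \<alpha>"
        by (rule below_lower[where f = "suffix k \<alpha>", OF lex_le_imp[OF alpha_suffix_le] ag[OF True]])
          (use True N(3) in \<open>auto simp: dn\<close>)
      then show ?thesis by (rule to_d) (use that in simp)
    next
      case False
      then show ?thesis using d_ge[of k] to_d[OF m(2)] N(1) by simp
    qed
    have down: "reflect M (suffix k d) \<sqsubset> d" if k: "1 \<le> k" for k
    proof (cases "k < N")
      case True
      show ?thesis
      \<comment> \<open>For \<open>k \<le> L\<close> the comparison is decided before the lowered
        digit. For larger \<open>k\<close> the raised reflected digit may give equality on
        \<open>N - k\<close> digits; what follows is decided by \<open>L\<close> further digits, and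
        \<open>L < k\<close> keeps these in the part common to \<open>d\<close> and
        \<open>\<alpha>\<close>.\<close>
      proof (cases "k \<le> L")
        case kL: True
        have "agree L (suffix k \<alpha>) (suffix k d)"
          by (rule agree_suffix[OF agree_sym[OF d_agree]]) (use kL N(1) m(1) in simp)
        then have "below L (reflect M (suffix k d)) \<alpha>"
          using L[of k] below_cong[OF agree_reflect agree_refl] by blast
        then show ?thesis by (rule to_d) (use N(1) in simp)
      next
        case kL: False
        have Suc: "Suc (N - 1 - k) = N - k" using True by simp
        have "below (N - k) (reflect M (suffix k d)) \<alpha> \<or> agree (N - k) (reflect M (suffix k d)) \<alpha>"
          unfolding Suc[symmetric]
        proof (rule below_raise)
          show "below (Suc (N - 1 - k)) (reflect M (suffix k \<alpha>)) \<alpha>" using N(2)[OF True] Suc by simp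
          show "agree (N - 1 - k) (reflect M (suffix k d)) (reflect M (suffix k \<alpha>))"
            by (rule agree_reflect[OF ag[OF True]])
          show "reflect M (suffix k d) (N - 1 - k) \<le> Suc (reflect M (suffix k \<alpha>) (N - 1 - k))"
            using True by (simp add: reflect_nth dn)
        qed
        then show ?thesis
        proof
          assume "below (N - k) (reflect M (suffix k d)) \<alpha>"
          then show ?thesis by (rule to_d) (use k in simp)
        next
          assume eq: "agree (N - k) (reflect M (suffix k d)) \<alpha>"
          have "below L (reflect M \<alpha>) (suffix (N - k) \<alpha>)"
            using below_reflect[OF _ alpha_digits L[of "N - k"]] by simp
          moreover have "agree L (reflect M \<alpha>) (reflect M ?g)"
            by (rule agree_reflect[OF agree_sym[OF agree_mono[OF lowered_period_agree]]]) (use m(1) in simp)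
          moreover have "agree L (suffix (N - k) \<alpha>) (suffix (N - k) d)"
            by (rule agree_suffix[OF agree_sym[OF d_agree]]) (use kL True in simp)
          ultimately have "below L (reflect M ?g) (suffix (N - k) d)" using below_cong by blast
          moreover have "suffix (N - k) (reflect M (suffix k d)) = reflect M ?g"
            using True d_ge[of N] by (simp add: suffix_reflect)
          moreover have "agree (N - k) (reflect M (suffix k d)) d"
            using agree_trans[OF eq agree_sym[OF agree_mono[OF d_agree]]] k by simp
          ultimately show ?thesis
            using less_fun_suffix[of "N - k" "reflect M (suffix k d)" d] below_imp_less by metis
        qed
      qed
    next
      case False
      then show ?thesis using d_ge[of k] to_d[OF m(3)] N(1) by simp
    qed
    have "\<not> finite_seq d"
    proof
      assume "finite_seq d"
      then obtain n where "suffix (Suc n) d = (\<lambda>_. 0)" by (auto simp: finite_seq_iff)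
      then show False using down[of "Suc n"] le_const_M[OF dd] lex.leD by auto
    qed
    moreover have "suffix k d \<sqsubseteq> d" for k using up[of k] by (cases k) (simp_all add: lex.less_imp_le)
    moreover have "0 < d 0" using alpha_0 N(1) by (simp add: dn)
    ultimately obtain p1 where p1: "base M p1" "alpha M p1 = d"
      using alpha_exists[OF M dd] by blast
    have "d \<in> strict_seqs M d" unfolding strict_seqs_def using dd up down by auto
    then have "p1 \<in> U M" using base.U_iff[OF p1(1)] p1(2) by simp
    moreover have "d \<sqsubset> \<alpha>"
    proof -
      have "below N d \<alpha>" unfolding below_def
        using d_agree N(1,3) by (intro exI[of _ "N - 1"]) (auto simp: dn)
      then show ?thesis by (rule below_imp_less)
    qed
    then have "p1 < q" using alpha_less_iff[OF p1(1) base_axioms] p1(2) by simp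
    moreover have "alpha M p0 \<sqsubset> d"
    proof (rule to_d)
      show "below (Suc j) (alpha M p0) \<alpha>" using j by (auto simp: below_def)
    qed (use N(1) in simp)
    then have "p0 < p1" using alpha_less_iff[OF p0(1) p1(1)] p1(2) by simp
    ultimately show "\<exists>y\<in>U M. dist y q < e"
      using p0(3) by (intro bexI[of _ p1]) (auto simp: dist_real_def)
  qed
qed

end

lemma periodic_not_finite:
  assumes "1 \<le> p" "suffix p c = c" "c 0 \<noteq> 0" shows "\<not> finite_seq c"
proof
  assume "finite_seq c"
  then obtain n where n: "\<And>i. n < i \<Longrightarrow> c i = 0" by (auto simp: finite_seq_def)
  have "c (j * p) = c 0" for j
  proof (induction j)
    case (Suc j)
    have "c (p + j * p) = c (j * p)" using fun_cong[OF assms(2), of "j * p"] by simp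
    then show ?case using Suc by simp
  qed simp
  moreover have "n < Suc n * p" using assms(1) by (metis lessI less_le_trans mult.right_neutral mult_le_mono2)
  ultimately show False using n[of "Suc n * p"] assms(3) by metis
qed

section \<open>Stability to the right of a base\<close>

text \<open>
  The sequence \<open>g\<close> starts with the raised period \<open>w\<close> of \<open>a\<close>.  A tail of \<open>c\<close> strictly between \<open>a\<close>
  and \<open>g\<close> reaches the block \<open>w\<close> sooner or later; what follows that block would have to be both
  strictly smaller and strictly larger than the reflection of \<open>g\<close>.
\<close>

lemma strict_seqs_forced:
  assumes per: "1 \<le> n" "suffix n a = a" "a (n - 1) < M"
    and g: "g \<in> digit_seqs M" "agree (n - 1) g a" "g (n - 1) = Suc (a (n - 1))"
      "suffix n g = reflect M g"
    and c: "c \<in> strict_seqs M g"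
  shows "c \<in> weak_seqs M a"
proof -
  have up: False
    if c: "c \<in> strict_seqs M g" and "c i < M" "a k < c (Suc i + k)" "agree k a (suffix (Suc i) c)" for c i k
    using that(2-)
  proof (induction k arbitrary: i rule: less_induct)
    case (less k)
    define d where "d = suffix (Suc i) c"
    have d: "d \<sqsubset> g" "a k < d k" "agree k a d" "d \<in> digit_seqs M"
    proof -
      show "agree k a d" unfolding d_def using less.prems(3) .
    qed (use strict_seqsD(2)[OF c less.prems(1)] less.prems(2) strict_seqsD(1)[OF c] in \<open>simp_all add: d_def\<close>)
    have dn: "d (n - 1) = c (i + n)" "suffix n d = suffix (Suc (i + n)) c"
      using per(1) by (simp_all add: d_def)
    show False
    \<comment> \<open>A difference beyond the first period is moved back by \<open>n\<close>: the
      digit closing that period is \<open>a (n - 1)\<close>, which is below \<open>M\<close>, so the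
      same situation recurs at the next tail.\<close>
    proof (cases "n \<le> k")
      case True
      have "d (n - 1) = a (n - 1)" using agreeD[OF d(3), of "n - 1"] True per(1) by simp
      then have 1: "c (i + n) < M" using per(3) dn(1) by simp
      have "agree (k - n) (suffix n a) (suffix n d)"
        by (rule agree_suffix[OF d(3)]) (use True in simp)
      then have 2: "agree (k - n) a (suffix (Suc (i + n)) c)" unfolding dn(2) per(2) .
      have "a k = a (k - n)" using fun_cong[OF per(2), of "k - n"] True by simp
      then have 3: "a (k - n) < c (Suc (i + n) + (k - n))" using True d(2) by (simp add: d_def)
      have "k - n < k" using True per(1) by simp
      then show False by (rule less.IH[OF _ 1 3 2])
    next
      case False
      have gk: "agree k g d" using agree_trans[OF agree_mono[OF g(2)] d(3)] False by simp
      then have le: "d k \<le> g k"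
        using d(1) less_fun_agree lex.less_asym by (metis linorder_not_less)
      have "k = n - 1"
      proof (rule ccontr)
        assume "k \<noteq> n - 1"
        then have "g k = a k" using agreeD[OF g(2), of k] False by simp
        then show False using le d(2) by simp
      qed
      then have "d (n - 1) = g (n - 1)" using le d(2) g(3) by simp
      then have "agree (Suc (n - 1)) d g" using gk \<open>k = n - 1\<close> by (simp add: agree_Suc agree_sym)
      then have "agree n d g" using per(1) by simp
      then have "suffix n d \<sqsubset> reflect M g" using d(1) less_fun_suffix g(4) by metis
      moreover have "0 < c (i + n)" using \<open>d (n - 1) = g (n - 1)\<close> g(3) dn(1) by simp
      then have "reflect M (suffix n d) \<sqsubset> g" using strict_seqsD(3)[OF c] dn(2) by metis
      then have "reflect M g \<sqsubset> suffix n d"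
        using reflect_less_swap[of "suffix n d" M g] d(4) g(1) by simp
      ultimately show False using lex.less_asym by blast
    qed
  qed
  have up': "suffix (Suc i) c \<sqsubseteq> a" if "c \<in> strict_seqs M g" "c i < M" for c i
  proof (rule ccontr)
    assume "\<not> suffix (Suc i) c \<sqsubseteq> a"
    then have "a \<sqsubset> suffix (Suc i) c" by simp
    then obtain k where "a k < suffix (Suc i) c k" "agree k a (suffix (Suc i) c)"
      unfolding less_fun_agree by blast
    then show False using up[OF that] by simp
  qed
  show ?thesis unfolding weak_seqs_def
  proof (intro CollectI conjI allI impI)
    show "c \<in> digit_seqs M" using strict_seqsD(1)[OF c] .
    show "suffix (Suc i) c \<sqsubseteq> a" if "c i < M" for i using up'[OF c that] .
    show "reflect M (suffix (Suc i) c) \<sqsubseteq> a" if "0 < c i" for i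
      using up'[OF strict_seqs_reflect[OF c], of i] that per(3) by (simp add: suffix_reflect reflect_nth)
  qed
qed

text \<open>The sequence \<open>(w w')\<^sup>\<infinity>\<close>, where \<open>w = a\<^sub>1 \<dots> a\<^sub>n\<^sup>+\<close> and \<open>w'\<close> is the reflection of \<open>w\<close>.\<close>

definition raised_double :: "nat \<Rightarrow> nat \<Rightarrow> (nat \<Rightarrow> nat) \<Rightarrow> nat \<Rightarrow> nat" where
  "raised_double M n a = (\<lambda>i. let w = a(n - 1 := Suc (a (n - 1))); j = i mod (2 * n)
     in if j < n then w j else M - w (j - n))"

lemma raised_double:
  assumes "1 \<le> n" "a \<in> digit_seqs M" "a (n - 1) < M"
  shows "raised_double M n a \<in> digit_seqs M" "agree (n - 1) (raised_double M n a) a"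
    "raised_double M n a (n - 1) = Suc (a (n - 1))"
    "suffix n (raised_double M n a) = reflect M (raised_double M n a)"
proof -
  let ?w = "a(n - 1 := Suc (a (n - 1)))"
  have w: "?w j \<le> M" for j using assms digit_seqs_le[OF assms(2), of j] by auto
  then show "raised_double M n a \<in> digit_seqs M"
    unfolding digit_seqs_def raised_double_def Let_def by simp
  show "agree (n - 1) (raised_double M n a) a" "raised_double M n a (n - 1) = Suc (a (n - 1))"
    using assms(1) by (auto simp: agree_def raised_double_def Let_def)
  show "suffix n (raised_double M n a) = reflect M (raised_double M n a)"
  proof
    fix i
    define j where "j = i mod (2 * n)"
    have j: "j < 2 * n" using assms(1) by (simp add: j_def)
    have "(n + i) mod (2 * n) = (n + j) mod (2 * n)" unfolding j_def by (simp add: mod_simps)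
    also have "\<dots> = (if j < n then n + j else j - n)"
      using j by (auto simp: mod_if)
    finally have nj: "(n + i) mod (2 * n) = (if j < n then n + j else j - n)" .
    show "suffix n (raised_double M n a) i = reflect M (raised_double M n a) i"
      unfolding suffix_nth reflect_nth raised_double_def Let_def nj j_def[symmetric]
      using w j by (cases "j < n") simp_all
  qed
qed

context base
begin

text \<open>The expansion of 1 in base \<open>r\<close> is \<open>raised_double\<close> of the
  minimal period. Minimality makes each proper tail of the period strictly smaller than
  \<open>\<alpha>\<close> within the period, which leaves room for raising the last digit;
  \<open>strict_seqs_forced\<close> then gives the inclusion.\<close>

lemma periodic_successor:
  assumes V: "q \<in> V M" and top: "q \<noteq> real M + 1" and per: "1 \<le> p" "suffix p \<alpha> = \<alpha>"
  shows "\<exists>r. base M r \<and> r \<in> V M \<and> q < r \<and> strict_seqs M (alpha M r) \<subseteq> weak_seqs M \<alpha>"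
proof -
  define n where "n = (LEAST n. 1 \<le> n \<and> suffix n \<alpha> = \<alpha>)"
  have n: "1 \<le> n" "suffix n \<alpha> = \<alpha>"
    using LeastI[of "\<lambda>n. 1 \<le> n \<and> suffix n \<alpha> = \<alpha>" p] per by (auto simp: n_def)
  have minimal: "suffix k \<alpha> \<noteq> \<alpha>" if "1 \<le> k" "k < n" for k
    using not_less_Least[of k "\<lambda>n. 1 \<le> n \<and> suffix n \<alpha> = \<alpha>"] that by (auto simp: n_def)
  have refl: "reflect M (suffix k \<alpha>) \<sqsubseteq> \<alpha>" for k using V V_iff by simp
  have below: "below (n - k) (suffix k \<alpha>) \<alpha>" if k: "1 \<le> k" "k < n" for k
  proof (rule ccontr)
    assume "\<not> ?thesis"
    then have ag: "agree (n - k) (suffix k \<alpha>) \<alpha>" using lex_le_imp[OF alpha_suffix_le] by blast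
    have "suffix (n - k) (suffix k \<alpha>) = \<alpha>" using k n by simp
    then have "\<alpha> \<sqsubseteq> suffix (n - k) \<alpha>" using lex_le_suffix[OF ag] alpha_suffix_le by metis
    then have "suffix (n - k) \<alpha> = \<alpha>" using alpha_suffix_le[of "n - k"] by (metis lex.order_antisym)
    then show False using minimal[of "n - k"] k by simp
  qed
  have last: "\<alpha> (n - 1) < M"
  proof (cases "n = 1")
    case True
    have "\<alpha> i = \<alpha> 0" for i
    proof (induction i)
      case (Suc i)
      have "suffix 1 \<alpha> i = \<alpha> i" using n True by simp
      then show ?case using Suc by simp
    qed simp
    then have "\<alpha> 0 \<noteq> M" using alpha_not_const_M[OF top] by (metis ext lex.less_irrefl)
    then show ?thesis using digit_seqs_le[OF alpha_digits, of 0] True by simp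
  next
    case False
    then have "\<alpha> (n - 1) < \<alpha> 0" using below[of "n - 1"] n(1) by (auto simp: below_def)
    then show ?thesis using digit_seqs_le[OF alpha_digits, of 0] by simp
  qed
  define g where "g = raised_double M n \<alpha>"
  have g: "g \<in> digit_seqs M" "agree (n - 1) g \<alpha>" "g (n - 1) = Suc (\<alpha> (n - 1))" "suffix n g = reflect M g"
    using raised_double[OF n(1) alpha_digits last] by (simp_all add: g_def)
  have less: "below n \<alpha> g" unfolding below_def
    using g(2,3) n(1) by (intro exI[of _ "n - 1"]) (auto simp: agree_sym)
  have to_g: "f \<sqsubset> g" if "below k f \<alpha>" "k \<le> n" for f k
    using below_trans[OF below_mono[OF that] less] below_imp_less by blast
  have Suc: "Suc (n - 1 - k) = n - k" if "k < n" for k using that by simp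
  have ag: "agree (n - 1 - k) (suffix k g) (suffix k \<alpha>)" if "k < n" for k
    by (rule agree_suffix[OF g(2)]) (use that in simp)
  have down: "below (n - k) (reflect M (suffix k g)) \<alpha>" if "k < n" for k
    by (rule below_lower[OF lex_le_imp[OF refl[of k]] agree_reflect[OF ag[OF that]]])
      (use that g(3) last in \<open>auto simp: reflect_nth\<close>)
  have shift1: "suffix k g \<sqsubset> g" if k: "1 \<le> k" "k < n" for k
  proof -
    have "below (n - k) (suffix k g) \<alpha> \<or> agree (n - k) (suffix k g) \<alpha>"
      unfolding Suc[OF k(2), symmetric]
    proof (rule below_raise)
      show "below (Suc (n - 1 - k)) (suffix k \<alpha>) \<alpha>" using below[OF k] Suc[OF k(2)] by simp
      show "agree (n - 1 - k) (suffix k g) (suffix k \<alpha>)" by (rule ag[OF k(2)])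
      show "suffix k g (n - 1 - k) \<le> Suc (suffix k \<alpha> (n - 1 - k))" using k g(3) by simp
    qed
    then show ?thesis
    proof
      assume "below (n - k) (suffix k g) \<alpha>"
      then show ?thesis by (rule to_g) simp
    next
      \<comment> \<open>In the case of equality the tail continues with the reflection of
        \<open>g\<close>, and this is smaller than the tail of \<open>g\<close> at
        \<open>n - k\<close> by the reflected form of \<open>down\<close>.\<close>
      assume "agree (n - k) (suffix k g) \<alpha>"
      then have ag': "agree (n - k) (suffix k g) g"
        by (rule agree_trans[OF _ agree_sym[OF agree_mono[OF g(2)]]]) (use k in simp)
      have "below k (reflect M (suffix (n - k) g)) \<alpha>" using down[of "n - k"] k by simp
      then have "below k (reflect M (suffix (n - k) g)) g"
        using below_cong[OF agree_refl agree_sym[OF agree_mono[OF g(2), of k]]] k by simp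
      then have "below k (reflect M g) (suffix (n - k) g)"
        using below_reflect[of "reflect M (suffix (n - k) g)" M g k] g(1) by simp
      then have "suffix (n - k) (suffix k g) \<sqsubset> suffix (n - k) g"
        using below_imp_less g(4) k by simp
      then show ?thesis using less_fun_suffix[OF ag'] by blast
    qed
  qed
  have double: "suffix (n + k) g = reflect M (suffix k g)" for k
  proof -
    have "suffix (n + k) g = suffix k (suffix n g)" by simp
    then show ?thesis unfolding g(4) suffix_reflect .
  qed
  have shift: "suffix k g \<sqsubseteq> g" for k
  proof (induction k rule: less_induct)
    case (less k)
    consider "k = 0" | "1 \<le> k" "k < n" | j where "k = n + j" "j < n" | j where "k = n + (n + j)"
      by (metis Suc_eq_plus1 Suc_leI add.commute le_add_diff_inverse not_gr0 not_less One_nat_def)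
    then have "suffix k g \<sqsubseteq> g"
    proof cases
      case 1 then show ?thesis by simp
    next
      case 2 then show ?thesis using shift1 lex.less_imp_le by blast
    next
      case (3 j)
      have "reflect M (suffix j g) \<sqsubset> g" using to_g[OF down[OF 3(2)]] by simp
      then show ?thesis unfolding 3(1) double by (rule lex.less_imp_le)
    next
      case (4 j)
      have "suffix k g = suffix j g" unfolding 4 double using g(1) by simp
      moreover have "suffix j g \<sqsubseteq> g" by (rule less) (use 4 n(1) in simp)
      ultimately show ?thesis by metis
    qed
    then show ?case .
  qed
  have "suffix (n + n) g = g" unfolding double g(4) using g(1) by simp
  moreover have "0 < g 0"
  proof (cases "n = 1")
    case False
    then show ?thesis using agreeD[OF g(2), of 0] alpha_0 n(1) by simp
  qed (use g(3) in simp)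
  ultimately have "\<not> finite_seq g" using periodic_not_finite[of "n + n" g] n(1) by simp
  then obtain r where r: "base M r" "alpha M r = g"
    using alpha_exists[OF M g(1) _ \<open>0 < g 0\<close> shift] by blast
  have "r \<in> V M" using base.V_iff[OF r(1)] shift double[symmetric] r(2) by simp
  moreover have "q < r"
    using alpha_less_iff[OF base_axioms r(1)] below_imp_less[OF less] r(2) by simp
  moreover have "strict_seqs M (alpha M r) \<subseteq> weak_seqs M \<alpha>"
    using strict_seqs_forced[OF n last g] r(2) by auto
  ultimately show ?thesis using r(1) by blast
qed

text \<open>
  Without periodicity the prefixes \<open>\<alpha>\<^sub>1 \<dots> \<alpha>\<^sub>N\<close> all of whose proper tails are strictly below \<open>\<alpha>\<close> have
  arbitrarily large length, and \<open>(\<alpha>\<^sub>1 \<dots> \<alpha>\<^sub>N)\<^sup>\<infinity>\<close> belongs to bases in \<open>V\<close> that decrease to \<open>q\<close>.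
\<close>

lemma nonperiodic_right_limit:
  assumes V: "q \<in> V M" and top: "q \<noteq> real M + 1" and nper: "\<And>k. 1 \<le> k \<Longrightarrow> suffix k \<alpha> \<noteq> \<alpha>"
    and e: "0 < (e :: real)"
  shows "\<exists>p\<in>V M. q < p \<and> p < q + e"
proof -
  have refl: "reflect M (suffix k \<alpha>) \<sqsubseteq> \<alpha>" for k using V V_iff by simp
  define p0 where "p0 = min (q + e / 2) (real M + 1)"
  have p0: "base M p0" "q < p0" "p0 < q + e"
    using q qM M e top by (auto simp: p0_def base_def min_def)
  obtain j where j: "\<alpha> j < alpha M p0 j" "agree j \<alpha> (alpha M p0)"
    using alpha_less[OF base_axioms p0(1,2)] by (auto simp: less_fun_agree)
  have strict: "suffix k \<alpha> \<sqsubset> \<alpha>" if "1 \<le> k" for k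
    using nper[OF that] alpha_suffix_le[of k] by (auto simp: lex_le_def)
  obtain N where N: "Suc j \<le> N" "\<And>k. 1 \<le> k \<Longrightarrow> k < N \<Longrightarrow> below (N - k) (suffix k \<alpha>) \<alpha>"
    using strict_positions[of \<alpha> "\<lambda>k. suffix k \<alpha>" 1 "Suc j", OF alpha_suffix_le _ strict] by auto
  define d where "d = (\<lambda>i. \<alpha> (i mod N))"
  have dd: "d \<in> digit_seqs M" using alpha_digits by (simp add: d_def digit_seqs_def)
  have d_agree: "agree N d \<alpha>" by (simp add: agree_def d_def)
  have dN: "suffix N d = d" by (simp add: d_def fun_eq_iff)
  have dmod: "suffix k d = suffix (k mod N) d" for k by (simp add: d_def fun_eq_iff mod_simps)
  have ag: "agree (N - k) (suffix k d) (suffix k \<alpha>)" if "k < N" for k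
    by (rule agree_suffix[OF d_agree]) (use that in simp)
  have up: "suffix k d \<sqsubseteq> d" for k
  proof (cases "k mod N = 0")
    case True
    then show ?thesis using dmod[of k] by simp
  next
    case False
    have r: "k mod N < N" using N(1) by simp
    have "below (N - k mod N) (suffix (k mod N) d) d"
      using N(2)[of "k mod N"] False r
        below_cong[OF ag[OF r] agree_mono[OF d_agree, of "N - k mod N"]] by simp
    then show ?thesis unfolding dmod[of k] by (intro lex.less_imp_le below_imp_less)
  qed
  have part: "below (N - r) (reflect M (suffix r d)) d \<or> agree (N - r) (reflect M (suffix r d)) d"
    if r: "r < N" for r
  proof -
    have "agree (N - r) (reflect M (suffix r \<alpha>)) (reflect M (suffix r d))" "agree (N - r) \<alpha> d"
      using agree_reflect[OF agree_sym[OF ag[OF r]]] agree_sym[OF agree_mono[OF d_agree]] by simp_all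
    then show ?thesis
      using lex_le_imp[OF refl[of r], of "N - r"] below_cong agree_trans agree_sym by meson
  qed
  have down: "reflect M (suffix k d) \<sqsubseteq> d" for k
  proof -
    define r where "r = k mod N"
    have r: "r < N" using N(1) by (simp add: r_def)
    let ?f = "reflect M (suffix r d)"
    \<comment> \<open>After \<open>N - r\<close> digits the reflected tail continues as the
      reflection of \<open>d\<close>, to be compared with the tail of \<open>d\<close> at
      \<open>N - r\<close>. Reflecting \<open>part\<close> at \<open>N - r\<close> settles these
      \<open>r\<close> digits.\<close>
    have "below N ?f d \<or> agree N ?f d"
    proof (cases "r = 0")
      case False
      have fN: "suffix (N - r) ?f = reflect M d" using r dN by (simp add: suffix_reflect)
      have "below r (reflect M (suffix (N - r) d)) d \<or> agree r (reflect M (suffix (N - r) d)) d"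
        using part[of "N - r"] False r by simp
      then have "below r (suffix (N - r) ?f) (suffix (N - r) d) \<or> agree r (suffix (N - r) ?f) (suffix (N - r) d)"
        unfolding fN
        using below_reflect[of "reflect M (suffix (N - r) d)" M d r]
          agree_reflect[of r "reflect M (suffix (N - r) d)" d M] dd agree_sym by auto
      then show ?thesis
      proof
        assume "agree r (suffix (N - r) ?f) (suffix (N - r) d)"
        then have "agree (N - r) ?f d \<Longrightarrow> agree N ?f d"
          using agree_add[of "N - r" r ?f d] r by simp
        then show ?thesis using part[OF r] below_mono by (meson diff_le_self)
      next
        assume "below r (suffix (N - r) ?f) (suffix (N - r) d)"
        then obtain i where i: "i < r" "suffix (N - r) ?f i < suffix (N - r) d i"
          "agree i (suffix (N - r) ?f) (suffix (N - r) d)" by (auto simp only: below_def)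
        have "agree (N - r) ?f d \<Longrightarrow> below N ?f d"
          using i r agree_add[of "N - r" i ?f d] unfolding below_def
          by (intro exI[of _ "N - r + i"]) simp
        then show ?thesis using part[OF r] below_mono by (meson diff_le_self)
      qed
    qed (use part[OF r] in simp)
    moreover have "?f = d" if "agree N ?f d"
    proof
      fix i
      have "?f i = ?f (i mod N)" by (simp add: reflect_nth d_def mod_simps)
      also have "\<dots> = d (i mod N)" using agreeD[OF that] N(1) by simp
      finally show "?f i = d i" by (simp add: d_def)
    qed
    ultimately have "?f \<sqsubseteq> d" using below_imp_less lex.less_imp_le by auto
    then show ?thesis unfolding dmod[of k] r_def .
  qed
  have "0 < d 0" using alpha_0 by (simp add: d_def)
  then have "\<not> finite_seq d" using periodic_not_finite[OF _ dN] N(1) by simp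
  then obtain p where p: "base M p" "alpha M p = d"
    using alpha_exists[OF M dd _ \<open>0 < d 0\<close> up] by blast
  have "p \<in> V M" using base.V_iff[OF p(1)] down p(2) by simp
  moreover have "\<alpha> \<sqsubset> d"
  proof -
    have "d \<noteq> \<alpha>" using nper[of N] dN N(1) by auto
    moreover have "\<not> d \<sqsubset> \<alpha>"
    proof
      assume "d \<sqsubset> \<alpha>"
      then obtain t where t: "d t < \<alpha> t" "agree t d \<alpha>" by (auto simp: less_fun_agree)
      have "N \<le> t" using t(1) agreeD[OF d_agree, of t] by (cases "t < N") simp_all
      have 1: "agree (t - N) (suffix N d) (suffix N \<alpha>)"
        by (rule agree_suffix[OF t(2)]) (use \<open>N \<le> t\<close> in simp)
      have "agree (t - N) \<alpha> (suffix N \<alpha>)"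
        using agree_trans[OF agree_sym[OF agree_mono[OF t(2)]] 1[unfolded dN]] by simp
      moreover have "\<alpha> (t - N) < suffix N \<alpha> (t - N)"
      proof -
        have "\<alpha> (t - N) = d (t - N)" using agreeD[OF t(2), of "t - N"] \<open>N \<le> t\<close> N(1) by simp
        also have "\<dots> = d t" using fun_cong[OF dN, of "t - N"] \<open>N \<le> t\<close> by simp
        finally show ?thesis using t(1) \<open>N \<le> t\<close> by simp
      qed
      ultimately have "\<alpha> \<sqsubset> suffix N \<alpha>" by (auto simp only: less_fun_agree)
      then show False using alpha_suffix_le lex.leD by blast
    qed
    ultimately show ?thesis by (metis lex.linorder_cases)
  qed
  then have "q < p" using alpha_less_iff[OF base_axioms p(1)] p(2) by simp
  moreover have "d \<sqsubset> alpha M p0"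
  proof -
    have "below N \<alpha> (alpha M p0)" unfolding below_def using j N(1) by (intro exI[of _ j]) simp
    then show ?thesis using below_cong[OF d_agree agree_refl] below_imp_less by blast
  qed
  then have "p < p0" using alpha_less_iff[OF p(1) p0(1)] p(2) by simp
  ultimately show ?thesis using p0(3) by force
qed

end

text \<open>This is the expansion of 1 in the smallest base of V: constantly m if M = 2m, and m, m-1
  repeated if M = 2m-1.\<close>

definition tilde_seq :: "nat \<Rightarrow> nat \<Rightarrow> nat" where
  "tilde_seq M = (\<lambda>i. if even i then Suc M div 2 else M div 2)"

text \<open>A digit below \<open>M\<close> turns out to be 0 and to be followed by a digit below
  \<open>M\<close>. For even \<open>M\<close> the bound equals its own reflection, so a digit
  strictly between 0 and \<open>M\<close> would require a tail both below and above it. For odd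
  \<open>M\<close>, \<open>strict_seqs_forced\<close> with period 1 reduces to the constant bound
  \<open>M div 2\<close>; the next digit and its reflection would both be at most
  \<open>M div 2\<close>, although their sum is \<open>M\<close>.\<close>

lemma strict_seqs_tilde_zero:
  assumes M: "1 \<le> M" and c: "c \<in> strict_seqs M (tilde_seq M)" and c0: "c 0 < M"
  shows "c = (\<lambda>_. 0)"
proof -
  have cd: "c i \<le> M" for i using digit_seqs_le[OF strict_seqsD(1)[OF c]] .
  have key: "c (Suc i) < M" "c i = 0" if ci: "c i < M" for i
  proof -
    have "c (Suc i) < M \<and> c i = 0"
    proof (cases "even M")
      case True
      then have t: "tilde_seq M = (\<lambda>_. M div 2)" and r: "reflect M (\<lambda>_. M div 2) = (\<lambda>_. M div 2)"
        by (auto simp: tilde_seq_def reflect_def)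
      have up: "suffix (Suc i) c \<sqsubset> (\<lambda>_. M div 2)" using strict_seqsD(2)[OF c ci] t by simp
      have "c (Suc i) \<le> M div 2"
        using lex_le_imp[OF lex.less_imp_le[OF up], of 1] by (auto simp: below_def agree_def)
      moreover have "c i = 0"
      proof (rule ccontr)
        assume "c i \<noteq> 0"
        then have "reflect M (suffix (Suc i) c) \<sqsubset> (\<lambda>_. M div 2)"
          using strict_seqsD(3)[OF c, of i] t by simp
        then have "(\<lambda>_. M div 2) \<sqsubset> suffix (Suc i) c"
          using reflect_less_swap[of "suffix (Suc i) c" M "\<lambda>_. M div 2"] strict_seqsD(1)[OF c] r
          by (simp add: digit_seqs_def)
        then show False using up lex.less_asym by blast
      qed
      moreover have "M div 2 < M" using M by simp
      ultimately show ?thesis by simp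
    next
      case False
      define a where "a = (\<lambda>_::nat. M div 2)"
      have Suc: "Suc M div 2 = Suc (M div 2)" "M - M div 2 = Suc (M div 2)" "M - Suc (M div 2) = M div 2"
        using False by presburger+
      have "tilde_seq M \<in> digit_seqs M" unfolding digit_seqs_def tilde_seq_def Suc using M by auto
      moreover have "suffix 1 (tilde_seq M) = reflect M (tilde_seq M)"
        unfolding fun_eq_iff suffix_nth reflect_nth tilde_seq_def Suc by (simp add: Suc)
      moreover have "suffix 1 a = a" "a (1 - 1) < M" using M by (auto simp: a_def)
      moreover have "tilde_seq M (1 - 1) = Suc (a (1 - 1))" by (simp add: tilde_seq_def a_def Suc)
      ultimately have w: "c \<in> weak_seqs M a"
        using strict_seqs_forced[of 1 a M "tilde_seq M" c] c by simp
      have up: "suffix (Suc i) c \<sqsubseteq> a" using weak_seqsD(2)[OF w ci] .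
      then have le: "c (Suc i) \<le> M div 2"
        using lex_le_imp[OF up, of 1] by (auto simp: below_def agree_def a_def)
      moreover have "c i = 0"
      proof (rule ccontr)
        assume "c i \<noteq> 0"
        then have "reflect M (suffix (Suc i) c) \<sqsubseteq> a"
          using weak_seqsD(3)[OF w, of i] by simp
        then have "M - c (Suc i) \<le> M div 2"
          using lex_le_imp[of "reflect M (suffix (Suc i) c)" a 1]
          by (auto simp: below_def agree_def a_def reflect_nth)
        then show False using le Suc(2) by linarith
      qed
      moreover have "M div 2 < M" using M by simp
      ultimately show ?thesis by simp
    qed
    then show "c (Suc i) < M" "c i = 0" by auto
  qed
  have "c i < M" for i
    by (induction i) (use c0 key(1) in auto)
  then show ?thesis using key(2) by auto
qed

lemma strict_seqs_tilde:
  assumes M: "1 \<le> M" and c: "c \<in> strict_seqs M (tilde_seq M)" shows "c = (\<lambda>_. 0) \<or> c = (\<lambda>_. M)"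
proof (cases "c 0 < M")
  case False
  then have "reflect M c 0 < M" using M by (simp add: reflect_nth)
  then have "reflect M c = (\<lambda>_. 0)" using strict_seqs_tilde_zero[OF M strict_seqs_reflect[OF c]] by blast
  then have "reflect M (reflect M c) = (\<lambda>_. M)" by simp
  then show ?thesis using strict_seqsD(1)[OF c] by simp
qed (use strict_seqs_tilde_zero[OF M c] in blast)

lemma tilde_seq_alpha:
  assumes M: "1 \<le> M"
  obtains p where "base M p" "alpha M p = tilde_seq M" "p \<in> V M"
proof -
  have td: "tilde_seq M \<in> digit_seqs M" using M by (auto simp: tilde_seq_def digit_seqs_def)
  have r: "reflect M (tilde_seq M) = suffix 1 (tilde_seq M)"
    by (auto simp: fun_eq_iff tilde_seq_def reflect_nth)
  have s: "suffix k (tilde_seq M) = (if even k then tilde_seq M else suffix 1 (tilde_seq M))" for k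
    by (auto simp: fun_eq_iff tilde_seq_def)
  have le: "suffix 1 (tilde_seq M) \<sqsubseteq> tilde_seq M"
  proof (cases "even M")
    case True
    then have "suffix 1 (tilde_seq M) = tilde_seq M" by (auto simp: fun_eq_iff tilde_seq_def)
    then show ?thesis by simp
  next
    case False
    then have "below 1 (suffix 1 (tilde_seq M)) (tilde_seq M)"
      unfolding below_def by (intro exI[of _ 0]) (simp add: tilde_seq_def)
    then show ?thesis by (intro lex.less_imp_le below_imp_less)
  qed
  then have up: "suffix k (tilde_seq M) \<sqsubseteq> tilde_seq M" for k using s[of k] by auto
  have rs: "reflect M (suffix k (tilde_seq M)) = suffix (1 + k) (tilde_seq M)" for k
  proof -
    have "reflect M (suffix k (tilde_seq M)) = suffix k (suffix 1 (tilde_seq M))"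
      unfolding suffix_reflect[symmetric] r ..
    then show ?thesis by simp
  qed
  have pos: "0 < tilde_seq M 0" using M by (simp add: tilde_seq_def)
  have "suffix 2 (tilde_seq M) = tilde_seq M" using s[of 2] by simp
  then have "\<not> finite_seq (tilde_seq M)" using periodic_not_finite[of 2] pos by auto
  then obtain p where p: "base M p" "alpha M p = tilde_seq M"
    using alpha_exists[OF M td _ pos up] by blast
  then have "p \<in> V M" using base.V_iff[OF p(1)] up rs by simp
  then show ?thesis using that p by blast
qed

text \<open>If \<open>\<alpha>\<close> were smaller, prefixing the digit 0 would give a member of
  \<open>strict_seqs M (tilde_seq M)\<close>, all of whose tails beyond the first digit are tails of
  \<open>\<alpha>\<close>. Only constant sequences belong to that set, but the second digit is the
  nonzero digit \<open>\<alpha> 0\<close>.\<close>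

lemma tilde_seq_le_alpha:
  assumes M: "1 \<le> M" and p: "p \<in> V M" shows "tilde_seq M \<sqsubseteq> alpha M p"
proof (rule ccontr)
  interpret base M p using V_base[OF M p] .
  assume "\<not> ?thesis"
  then have less: "\<alpha> \<sqsubset> tilde_seq M" by simp
  define c where "c = 0 ## \<alpha>"
  have c_suffix: "suffix (Suc i) c = suffix i \<alpha>" for i by (simp add: c_def fun_eq_iff)
  have "c i \<le> M" for i
    using digit_seqs_le[OF alpha_digits] by (cases i) (simp_all add: c_def)
  moreover have "suffix (Suc i) c \<sqsubset> tilde_seq M" for i
    unfolding c_suffix using alpha_suffix_le less by (rule lex.le_less_trans)
  moreover have "reflect M (suffix (Suc i) c) \<sqsubset> tilde_seq M" for i
  proof -
    have "reflect M (suffix i \<alpha>) \<sqsubseteq> \<alpha>" using p V_iff by blast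
    then show ?thesis unfolding c_suffix using less by (rule lex.le_less_trans)
  qed
  ultimately have "c \<in> strict_seqs M (tilde_seq M)" by (simp add: strict_seqs_def digit_seqs_def)
  then have "c = (\<lambda>_. 0) \<or> c = (\<lambda>_. M)" by (rule strict_seqs_tilde[OF M])
  moreover have "c 0 = 0" "c 1 = \<alpha> 0" by (simp_all add: c_def)
  ultimately show False using alpha_0 M by auto
qed

lemma q_tilde:
  assumes M: "1 \<le> M" shows "base M (q_tilde M)" "alpha M (q_tilde M) = tilde_seq M"
proof -
  obtain p where p: "base M p" "alpha M p = tilde_seq M" "p \<in> V M" using tilde_seq_alpha[OF M] .
  have "p \<le> r" if "r \<in> V M" for r
    using tilde_seq_le_alpha[OF M that] alpha_le_iff[OF p(1) V_base[OF M that]] p(2) by simp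
  then have "q_tilde M = p" unfolding q_tilde_def using p(3) by (intro Least_equality) auto
  then show "base M (q_tilde M)" "alpha M (q_tilde M) = tilde_seq M" using p by auto
qed

lemma (in base) Uq_trivial:
  assumes "q \<le> q_tilde M" shows "Uq M q = {0, real M / (q - 1)}"
proof -
  have "\<alpha> \<sqsubseteq> tilde_seq M"
    using alpha_le_iff[OF base_axioms q_tilde(1)[OF M]] q_tilde(2)[OF M] assms by simp
  then have "strict_seqs M \<alpha> \<subseteq> {(\<lambda>_. 0), (\<lambda>_. M)}"
    using strict_seqs_mono strict_seqs_tilde[OF M] by blast
  moreover have "(\<lambda>_. 0) \<in> strict_seqs M \<alpha>"
  proof -
    have "(\<lambda>_. 0) \<sqsubset> \<alpha>" using zero_le[of \<alpha>] alpha_nonzero by (auto simp: lex_le_def)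
    then show ?thesis by (simp add: strict_seqs_def digit_seqs_def)
  qed
  moreover from this have "(\<lambda>_. M) \<in> strict_seqs M \<alpha>"
    using strict_seqs_reflect by fastforce
  ultimately have "strict_seqs M \<alpha> = {(\<lambda>_. 0), (\<lambda>_. M)}" by blast
  then show ?thesis unfolding Uq_eq using val_const_M[OF q, of M] by simp
qed

section \<open>Gaps of closed sets of reals\<close>

lemma interval_component:
  fixes l r :: real
  assumes "l < r" "{l<..<r} \<subseteq> W" "l \<notin> W" "r \<notin> W" shows "{l<..<r} \<in> components W"
  unfolding in_components_maximal
proof (intro conjI allI impI)
  fix D assume D: "D \<noteq> {} \<and> {l<..<r} \<subseteq> D \<and> D \<subseteq> W \<and> connected D"
  have "l < x \<and> x < r" if x: "x \<in> D" for x
  proof -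
    define y where "y = (l + r) / 2"
    have y: "l < y" "y < r" using assms(1) by (auto simp: y_def)
    then have "y \<in> D" using D by auto
    have "{min x y..max x y} \<subseteq> D"
      using connected_contains_Icc[of D] D x \<open>y \<in> D\<close> by (simp add: min_def max_def)
    then have "l \<notin> {min x y..max x y}" "r \<notin> {min x y..max x y}" using D assms(3,4) by blast+
    then show ?thesis using y by auto
  qed
  then show "D = {l<..<r}" using D by auto
qed (use assms in auto)

lemma component_is_interval:
  fixes W :: "real set"
  assumes "C \<in> components W" "x \<in> C" "l < x" "x < r" "{l<..<r} \<in> components W"
  shows "C = {l<..<r}"
  using components_nonoverlap[OF assms(1,5)] assms(2-4) by auto

lemma bounded_open_component:
  fixes W :: "real set"
  assumes W: "open W" "W \<subseteq> {a..b}" and C: "C \<in> components W"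
  obtains l r where "l < r" "C = {l<..<r}" "l \<notin> W" "r \<notin> W"
proof -
  have op: "open C" using open_components[OF W(1) C] .
  have ne: "C \<noteq> {}" and sub: "C \<subseteq> W" and con: "connected C"
    using in_components_nonempty[OF C] in_components_subset[OF C] in_components_connected[OF C] by simp_all
  have bdd: "bdd_below C" "bdd_above C" using sub W(2) by (meson bdd_below_mono bdd_below_Icc order_trans, meson bdd_above_mono bdd_above_Icc order_trans)
  define l where "l = Inf C"
  define r where "r = Sup C"
  have in_lr: "l < x \<and> x < r" if "x \<in> C" for x
  proof -
    obtain e where e: "0 < e" "\<forall>y. dist y x < e \<longrightarrow> y \<in> C"
      using op \<open>x \<in> C\<close> by (meson open_dist)
    have "x - e / 2 \<in> C" "x + e / 2 \<in> C" using e by (auto simp: dist_real_def)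
    then have "l \<le> x - e / 2" "x + e / 2 \<le> r"
      using cInf_lower[OF _ bdd(1)] cSup_upper[OF _ bdd(2)] by (auto simp: l_def r_def)
    then show ?thesis using e(1) by linarith
  qed
  have "x \<in> C" if "l < x" "x < r" for x
  proof -
    obtain y z where "y \<in> C" "y < x" "z \<in> C" "x < z"
      using \<open>l < x\<close> \<open>x < r\<close> cInf_less_iff[OF ne bdd(1), of x] less_cSup_iff[OF ne bdd(2), of x] by (auto simp: l_def r_def)
    then show ?thesis using connected_contains_Icc[OF con, of y z] by auto
  qed
  then have eq: "C = {l<..<r}" using in_lr by auto
  then have "l < r" using ne by (metis empty_iff greaterThanLessThan_iff less_trans subsetI subset_empty)
  have "x \<notin> W" if x: "x \<in> {l, r}" for x
  proof
    assume "x \<in> W"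
    have "closure C = {l..r}" using \<open>l < r\<close> unfolding eq by simp
    then have "x \<in> closure C" using x \<open>l < r\<close> by auto
    moreover obtain T where T: "closed T" "C = W \<inter> T"
      using closedin_component[OF C] by (auto simp: closedin_closed)
    then have "closure C \<subseteq> T" by (intro closure_minimal) auto
    ultimately have "x \<in> C" using T(2) \<open>x \<in> W\<close> by blast
    then show False using x eq by auto
  qed
  then show ?thesis using that[OF \<open>l < r\<close> eq] by blast
qed

text \<open>
  Neighbouring elements of \<open>V\<close> are obtained by iterating the successor and the predecessor; a limit
  of the resulting sequence in the interior of \<open>C\<close> would be a point of \<open>V\<close> without predecessor
  (successor).
\<close>

lemma discrete_sequence:
  fixes V :: "real set"
  assumes V: "closed V" and C: "C = {l<..<r}" and ne: "x0 \<in> C \<inter> V"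
    and succ: "\<And>v. v \<in> C \<inter> V \<Longrightarrow> \<exists>w\<in>C \<inter> V. v < w \<and> {v<..<w} \<inter> V = {}"
    and pred: "\<And>v. v \<in> C \<inter> V \<Longrightarrow> \<exists>w\<in>C \<inter> V. w < v \<and> {w<..<v} \<inter> V = {}"
  obtains x :: "int \<Rightarrow> real" where "strict_mono x" "range x = C \<inter> V"
    "(x \<longlongrightarrow> l) at_bot" "(x \<longlongrightarrow> r) at_top" "\<And>m. {x m<..<x (m + 1)} \<inter> V = {}"
proof -
  obtain s where s: "\<And>v. v \<in> C \<inter> V \<Longrightarrow> s v \<in> C \<inter> V \<and> v < s v \<and> {v<..<s v} \<inter> V = {}"
    using succ by metis
  obtain p where p: "\<And>v. v \<in> C \<inter> V \<Longrightarrow> p v \<in> C \<inter> V \<and> p v < v \<and> {p v<..<v} \<inter> V = {}"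
    using pred by metis
  define x where "x = (\<lambda>m::int. if 0 \<le> m then (s ^^ nat m) x0 else (p ^^ nat (- m)) x0)"
  have sC: "(s ^^ n) x0 \<in> C \<inter> V" for n using ne s by (induction n) auto
  have pC: "(p ^^ n) x0 \<in> C \<inter> V" for n using ne p by (induction n) auto
  have xC: "x m \<in> C \<inter> V" for m unfolding x_def using sC pC by auto
  have step: "x m < x (m + 1) \<and> {x m<..<x (m + 1)} \<inter> V = {}" for m
  proof (cases "0 \<le> m")
    case True
    then have "nat (m + 1) = Suc (nat m)" by simp
    then have "x (m + 1) = s (x m)" using True by (simp add: x_def)
    then show ?thesis using s[OF xC[of m]] by simp
  next
    case False
    then have "nat (- m) = Suc (nat (- (m + 1)))" by simp
    then have "x m = p ((p ^^ nat (- (m + 1))) x0)" using False by (simp add: x_def)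
    moreover have "(p ^^ nat (- (m + 1))) x0 = x (m + 1)"
      using False by (cases "m = - 1") (auto simp: x_def)
    ultimately show ?thesis using p[OF xC[of "m + 1"]] by simp
  qed
  have mono: "x m < x n" if "m < n" for m n
    using that by (induction n rule: int_gr_induct) (use step order.strict_trans in blast)+
  have top: "\<exists>m. a < x m" if a: "a < r" for a
  proof (rule ccontr)
    assume "\<nexists>m. a < x m"
    then have le: "x m \<le> a" for m by (meson not_le)
    have bdd: "bdd_above (range x)" using le by (intro bdd_aboveI[of _ a]) auto
    define y where "y = Sup (range x)"
    have up: "x m \<le> y" for m unfolding y_def by (rule cSup_upper[OF _ bdd]) simp
    have "y \<in> V" unfolding y_def using xC by (intro closed_subset_contains_Sup[OF V _ _ bdd]) auto
    moreover have "y \<le> a" unfolding y_def using le by (intro cSup_least) auto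
    moreover have "l < y" using xC[of 0] up[of 0] C by auto
    ultimately have "y \<in> C \<inter> V" using C a by auto
    then have py: "p y < y" "{p y<..<y} \<inter> V = {}" using p by auto
    obtain m where m: "p y < x m" using py(1) less_cSup_iff[OF _ bdd, of "p y"] by (auto simp: y_def)
    have "x m < y" using step[of m] up[of "m + 1"] by simp
    then show False using m py(2) xC[of m] by auto
  qed
  have bot: "\<exists>m. x m < a" if a: "l < a" for a
  proof (rule ccontr)
    assume "\<nexists>m. x m < a"
    then have le: "a \<le> x m" for m by (meson not_le)
    have bdd: "bdd_below (range x)" using le by (intro bdd_belowI[of _ a]) auto
    define y where "y = Inf (range x)"
    have low: "y \<le> x m" for m unfolding y_def by (rule cInf_lower[OF _ bdd]) simp
    have "y \<in> V" unfolding y_def using xC by (intro closed_subset_contains_Inf[OF V _ _ bdd]) auto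
    moreover have "a \<le> y" unfolding y_def using le by (intro cInf_greatest) auto
    moreover have "y < r" using xC[of 0] low[of 0] C by auto
    ultimately have "y \<in> C \<inter> V" using C a by auto
    then have sy: "y < s y" "{y<..<s y} \<inter> V = {}" using s by auto
    obtain m where m: "x m < s y" using sy(1) cInf_less_iff[OF _ bdd, of "s y"] by (auto simp: y_def)
    have "y < x m" using step[of "m - 1"] low[of "m - 1"] by simp
    then show False using m sy(2) xC[of m] by auto
  qed
  have mono_le: "x m \<le> x n" if "m \<le> n" for m n using mono[of m n] that by (cases "m = n") auto
  have lim_top: "(x \<longlongrightarrow> r) at_top"
  proof (rule order_tendstoI)
    fix a assume "a < r"
    then obtain m where "a < x m" using top by blast
    then show "\<forall>\<^sub>F n in at_top. a < x n"
      using mono_le by (intro eventually_at_top_linorderI[of m]) (meson order_less_le_trans)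
  next
    fix a assume "r < a"
    moreover have "x n < r" for n using xC[of n] C by auto
    ultimately show "\<forall>\<^sub>F n in at_top. x n < a"
      by (intro always_eventually allI) (meson order.strict_trans)
  qed
  have lim_bot: "(x \<longlongrightarrow> l) at_bot"
  proof (rule order_tendstoI)
    fix a assume "l < a"
    then obtain m where "x m < a" using bot by blast
    then show "\<forall>\<^sub>F n in at_bot. x n < a"
      using mono_le unfolding eventually_at_bot_linorder by (meson order_le_less_trans)
  next
    fix a assume "a < l"
    moreover have "l < x n" for n using xC[of n] C by auto
    ultimately show "\<forall>\<^sub>F n in at_bot. a < x n"
      by (intro always_eventually allI) (meson order.strict_trans)
  qed
  have "v \<in> range x" if v: "v \<in> C \<inter> V" for v
  proof (rule ccontr)
    assume notin: "v \<notin> range x"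
    obtain m0 where m0: "x m0 < v" using bot[of v] v C by auto
    have "x k < v" if "m0 \<le> k" for k
      using that
    proof (induction k rule: int_ge_induct)
      case (step k)
      then show ?case using notin v \<open>\<And>m. x m < x (m + 1) \<and> {x m<..<x (m + 1)} \<inter> V = {}\<close>[of k]
        by (metis Int_iff empty_iff greaterThanLessThan_iff linorder_neqE_linordered_idom rangeI)
    qed (rule m0)
    moreover obtain m1 where "v < x m1" using top[of v] v C by auto
    ultimately show False using mono_le[of m1 "max m0 m1"] by (smt (verit) max.cobounded1 max.cobounded2)
  qed
  then have "range x = C \<inter> V" using xC by auto
  moreover have "strict_mono x" using mono by (simp add: strict_mono_def)
  ultimately show ?thesis using that lim_bot lim_top step by blast
qed

lemma complement_gap:
  fixes S :: "real set"
  assumes S: "closed S" "a \<in> S" "b \<in> S" and x: "x \<in> {a..b} - S"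
  obtains l r where "l \<in> S" "r \<in> S" "l < x" "x < r" "{l<..<r} \<inter> S = {}"
proof -
  let ?L = "S \<inter> {a..x}" and ?R = "S \<inter> {x..b}"
  have ne: "?L \<noteq> {}" "?R \<noteq> {}" using S x by auto
  have cl: "closed ?L" "closed ?R" using S(1) by auto
  have bdd: "bdd_above ?L" "bdd_below ?R" by auto
  have "Sup ?L \<in> ?L" "Inf ?R \<in> ?R"
    using closed_contains_Sup[OF ne(1) bdd(1) cl(1)] closed_contains_Inf[OF ne(2) bdd(2) cl(2)] by auto
  moreover have "{Sup ?L<..<Inf ?R} \<inter> S = {}"
  proof -
    have False if y: "y \<in> S" "Sup ?L < y" "y < Inf ?R" for y
    proof (cases "y \<le> x")
      case True
      then have "y \<in> ?L" using y \<open>Sup ?L \<in> ?L\<close> by auto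
      then show False using cSup_upper[OF _ bdd(1)] y(2) by force
    next
      case False
      then have "y \<in> ?R" using y \<open>Inf ?R \<in> ?R\<close> by auto
      then show False using cInf_lower[OF _ bdd(2)] y(3) by force
    qed
    then show ?thesis by auto
  qed
  ultimately show ?thesis using that[of "Sup ?L" "Inf ?R"] x by (auto simp: le_less)
qed

text \<open>The homeomorphism maps every gap of \<open>S\<close> affinely onto the corresponding gap of \<open>f ` S\<close>.\<close>

lemma homeomorphic_gaps:
  fixes f :: "real \<Rightarrow> real"
  assumes S: "closed S" "S \<subseteq> {a..b}" "a \<in> S" "b \<in> S"
    and T: "closed (f ` S)" "f ` S \<subseteq> {c..d}" "c \<in> f ` S" "d \<in> f ` S"
    and mono: "\<And>x y. x \<in> S \<Longrightarrow> y \<in> S \<Longrightarrow> x < y \<Longrightarrow> f x < f y"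
  shows "open ({a..b} - S)" "open ({c..d} - f ` S)" "({a..b} - S) homeomorphic ({c..d} - f ` S)"
proof -
  have mono_iff: "f x < f y \<longleftrightarrow> x < y" if "x \<in> S" "y \<in> S" for x y
    using mono[OF that] mono[OF that(2,1)] by (metis less_asym linorder_neqE_linordered_idom less_irrefl)
  have "{a..b} - S = {a<..<b} - S" using S(3,4) by (auto simp: less_le)
  then show opS: "open ({a..b} - S)" using S(1) by (simp add: open_Diff)
  have "{c..d} - f ` S = {c<..<d} - f ` S" using T(3,4) by (auto simp: less_le)
  then show opT: "open ({c..d} - f ` S)" using T(1) by (simp add: open_Diff)
  let ?W = "{a..b} - S" and ?W' = "{c..d} - f ` S"
  have "\<exists>l r. l \<in> S \<and> r \<in> S \<and> l < x \<and> x < r \<and> {l<..<r} \<inter> S = {}" if "x \<in> ?W" for x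
    using complement_gap[OF S(1,3,4) that] by metis
  then obtain l r where lr: "\<And>x. x \<in> ?W \<Longrightarrow> l x \<in> S \<and> r x \<in> S \<and> l x < x \<and> x < r x \<and> {l x<..<r x} \<inter> S = {}"
    by metis
  define F where "F = (\<lambda>x. f (l x) + (x - l x) / (r x - l x) * (f (r x) - f (l x)))"
  have F_bounds: "f (l x) < F x" "F x < f (r x)" if x: "x \<in> ?W" for x
  proof -
    have *: "l x < x" "x < r x" "f (l x) < f (r x)" using lr[OF x] mono_iff by auto
    have "0 < (x - l x) / (r x - l x)" "(x - l x) / (r x - l x) < 1" using * by auto
    then have "0 < (x - l x) / (r x - l x) * (f (r x) - f (l x))"
      "(x - l x) / (r x - l x) * (f (r x) - f (l x)) < 1 * (f (r x) - f (l x))"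
      using *(3) by (intro mult_pos_pos mult_strict_right_mono; simp)+
    then show "f (l x) < F x" "F x < f (r x)" by (auto simp: F_def)
  qed
  have unique: "l x = u \<and> r x = v" if "x \<in> ?W" "u \<in> S" "v \<in> S" "u < x" "x < v" "{u<..<v} \<inter> S = {}" for x u v
  proof -
    have "l x \<notin> {u<..<v}" "r x \<notin> {u<..<v}" "u \<notin> {l x<..<r x}" "v \<notin> {l x<..<r x}"
      using lr[OF that(1)] that by blast+
    then show ?thesis using lr[OF that(1)] that(4,5) by auto
  qed
  have F_mono: "F x < F y" if xy: "x \<in> ?W" "y \<in> ?W" "x < y" for x y
  proof (cases "y < r x")
    case True
    then have eq: "l y = l x" "r y = r x" using unique[OF xy(2), of "l x" "r x"] lr[OF xy(1)] xy(3) by auto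
    have "(x - l x) / (r x - l x) < (y - l x) / (r x - l x)"
      using lr[OF xy(1)] xy(3) by (intro divide_strict_right_mono) auto
    then show ?thesis unfolding F_def eq
      using mono_iff lr[OF xy(1)] by (intro add_strict_left_mono mult_strict_right_mono) auto
  next
    case False
    have "r x \<le> l y" using lr[OF xy(1)] lr[OF xy(2)] False xy(2)
      by (metis Diff_iff IntI empty_iff greaterThanLessThan_iff not_less order_less_le_trans le_less)
    then have "f (r x) \<le> f (l y)" using mono_iff lr[OF xy(1)] lr[OF xy(2)] by (metis not_less)
    then show ?thesis using F_bounds(2)[OF xy(1)] F_bounds(1)[OF xy(2)] by linarith
  qed
  have F_in: "F x \<in> ?W'" if x: "x \<in> ?W" for x
  proof -
    have "f (l x) \<in> {c..d}" "f (r x) \<in> {c..d}" using lr[OF x] T(2) by auto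
    moreover have "F x \<notin> f ` S"
    proof
      assume "F x \<in> f ` S"
      then obtain u where "u \<in> S" "F x = f u" by auto
      then have "u \<in> {l x<..<r x} \<inter> S" using F_bounds[OF x] mono_iff lr[OF x] by auto
      then show False using lr[OF x] by blast
    qed
    ultimately show ?thesis using F_bounds[OF x] by auto
  qed
  have "?W' \<subseteq> F ` ?W"
  proof
    fix y assume y: "y \<in> ?W'"
    obtain u' v' where "u' \<in> f ` S" "v' \<in> f ` S" "u' < y" "y < v'" "{u'<..<v'} \<inter> f ` S = {}"
      using complement_gap[OF T(1,3,4) y] .
    then obtain u v where uv: "u \<in> S" "v \<in> S" "f u < y" "y < f v" "{f u<..<f v} \<inter> f ` S = {}" by blast
    define x where "x = u + (y - f u) / (f v - f u) * (v - u)"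
    have "u < v" using mono_iff[OF uv(1,2)] uv(3,4) by simp
    have "0 < (y - f u) / (f v - f u)" "(y - f u) / (f v - f u) < 1" using uv(3,4) by auto
    then have "0 < (y - f u) / (f v - f u) * (v - u)" "(y - f u) / (f v - f u) * (v - u) < 1 * (v - u)"
      using \<open>u < v\<close> by (intro mult_pos_pos mult_strict_right_mono; simp)+
    then have x: "u < x" "x < v" by (auto simp: x_def)
    have gap: "{u<..<v} \<inter> S = {}"
    proof -
      have False if "w \<in> S" "u < w" "w < v" for w
        using mono[OF uv(1) that(1,2)] mono[OF that(1) uv(2) that(3)] uv(5) that(1) by auto
      then show ?thesis by auto
    qed
    have "a \<le> u" "v \<le> b" using uv(1,2) S(2) by auto
    moreover have "x \<notin> S" using gap x by auto
    ultimately have "x \<in> ?W" using x by auto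
    moreover have "F x = y"
    proof -
      have "l x = u" "r x = v" using unique[OF \<open>x \<in> ?W\<close> uv(1,2) x gap] by auto
      then have "F x = f u + (x - u) / (v - u) * (f v - f u)" by (simp add: F_def)
      also have "(x - u) / (v - u) = (y - f u) / (f v - f u)" using \<open>u < v\<close> by (simp add: x_def)
      finally show ?thesis using uv(3,4) by simp
    qed
    ultimately show "y \<in> F ` ?W" by blast
  qed
  moreover have "F ` ?W \<subseteq> ?W'" using F_in by (rule image_subsetI)
  ultimately have img: "F ` ?W = ?W'" by (rule equalityI[rotated])
  have inj: "inj_on F ?W"
  proof (rule inj_onI)
    fix x y assume "x \<in> ?W" "y \<in> ?W" "F x = F y"
    then show "x = y" using F_mono[of x y] F_mono[of y x] by (cases x y rule: linorder_cases) auto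
  qed
  let ?G = "inv_into ?W F"
  have G_img: "?G ` ?W' = ?W" using inv_into_image_cancel[OF inj order_refl] unfolding img .
  \<comment> \<open>A monotone function with open image is continuous. This is applied to
    \<open>F\<close> and to its inverse, whose images are the two open complements.\<close>
  have "continuous_on ?W F"
    using opT F_mono by (intro continuous_onI_mono) (auto simp only: img le_less)
  moreover have "continuous_on ?W' ?G"
  proof (rule continuous_onI_mono)
    show "open (?G ` ?W')" unfolding G_img by (rule opS)
    fix x y assume xy: "x \<in> ?W'" "y \<in> ?W'" "x \<le> y"
    have "?G x \<in> ?W" "?G y \<in> ?W" "F (?G x) = x" "F (?G y) = y"
      using xy(1,2) img by (metis inv_into_into f_inv_into_f)+
    then show "?G x \<le> ?G y" using F_mono xy(3) by (metis not_less)
  qed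
  ultimately have "homeomorphism ?W ?W' F ?G"
    using img G_img inj by (intro homeomorphismI) (auto simp: f_inv_into_f)
  then show "?W homeomorphic ?W'" by (auto simp: homeomorphic_def)
qed

section \<open>Gaps of Vq\<close>

text \<open>A violated weak inequality is visible in finitely many digits, so it would already occur
  in a member of the set that shares them.\<close>

lemma weak_seqs_closed:
  assumes approx: "\<And>N. \<exists>d\<in>weak_seqs M a. agree N d c"
  shows "c \<in> weak_seqs M a"
proof -
  have digits: "c \<in> digit_seqs M" unfolding digit_seqs_def
  proof (intro CollectI allI)
    fix i
    obtain d where d: "d \<in> weak_seqs M a" "agree (Suc i) d c" using approx by blast
    then show "c i \<le> M" using agreeD[OF d(2), of i] digit_seqs_le[OF weak_seqsD(1)[OF d(1)], of i] by simp
  qed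
  have up: "suffix (Suc n) c \<sqsubseteq> a"
    if approx: "\<And>N. \<exists>d\<in>weak_seqs M a. agree N d c" and n: "c n < M" for c n
  proof (rule ccontr)
    assume "\<not> suffix (Suc n) c \<sqsubseteq> a"
    then have "a \<sqsubset> suffix (Suc n) c" by simp
    then obtain j where j: "below (Suc j) a (suffix (Suc n) c)" unfolding less_fun_agree below_def by blast
    obtain d where d: "d \<in> weak_seqs M a" "agree (Suc n + Suc j) d c" using approx by blast
    have "agree (Suc j) (suffix (Suc n) c) (suffix (Suc n) d)"
      by (rule agree_suffix[OF agree_sym[OF d(2)]]) simp
    then have "a \<sqsubset> suffix (Suc n) d" using j below_cong agree_refl below_imp_less by blast
    moreover have "suffix (Suc n) d \<sqsubseteq> a"
      using weak_seqsD(2)[OF d(1), of n] agreeD[OF d(2), of n] n by simp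
    ultimately show False using lex.leD by blast
  qed
  have "\<exists>d\<in>weak_seqs M a. agree N d (reflect M c)" for N
    using approx[of N] weak_seqs_reflect agree_reflect by blast
  then have "suffix (Suc n) (reflect M c) \<sqsubseteq> a" if "0 < c n" for n
    by (rule up) (use that digit_seqs_le[OF digits, of n] in \<open>simp add: reflect_nth\<close>)
  then show ?thesis unfolding weak_seqs_def using digits up[OF approx] by (simp add: suffix_reflect)
qed

lemma val_agree_dist:
  assumes "1 < q" "c \<in> digit_seqs M" "d \<in> digit_seqs M" "agree n c d"
  shows "\<bar>val q d - val q c\<bar> \<le> (real M / (q - 1)) / q ^ n"
proof -
  have "\<bar>val q (suffix n d) - val q (suffix n c)\<bar> \<le> real M / (q - 1)"
    using val_nonneg[OF assms(1) suffix_digit_seqs[OF assms(2)], of n] val_le[OF assms(1) suffix_digit_seqs[OF assms(2)], of n]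
      val_nonneg[OF assms(1) suffix_digit_seqs[OF assms(3)], of n] val_le[OF assms(1) suffix_digit_seqs[OF assms(3)], of n]
    by linarith
  then have "\<bar>val q (suffix n d) - val q (suffix n c)\<bar> / q ^ n \<le> (real M / (q - 1)) / q ^ n"
    using assms(1) by (intro divide_right_mono) auto
  then show ?thesis using val_suffix_diff[OF assms] assms(1) by simp
qed

lemma val_in_closure:
  assumes "1 < q" "c \<in> digit_seqs M" "S \<subseteq> digit_seqs M" "\<And>N. \<exists>d\<in>S. agree N d c"
  shows "val q c \<in> closure (val q ` S)"
  unfolding closure_approachable
proof (intro allI impI)
  fix e :: real assume "0 < e"
  then have "\<forall>\<^sub>F n in sequentially. (real M / (q - 1)) / q ^ n < e"
    using tendsto_div_power[OF assms(1)] by (rule order_tendstoD(2)[rotated])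
  then obtain n where n: "(real M / (q - 1)) / q ^ n < e" by (auto simp: eventually_sequentially)
  obtain d where d: "d \<in> S" "agree n d c" using assms(4) by blast
  have "\<bar>val q d - val q c\<bar> \<le> (real M / (q - 1)) / q ^ n"
    using val_agree_dist[OF assms(1) _ assms(2) d(2)] d(1) assms(3) by (auto simp: abs_minus_commute)
  then have "dist (val q d) (val q c) < e" using n by (simp only: dist_real_def)
  then show "\<exists>y\<in>val q ` S. dist y (val q c) < e" using d(1) by blast
qed

context base
begin

text \<open>At a limit from the left \<open>quasi_agree_left\<close> yields members sharing
  arbitrarily long prefixes with the quasi-greedy expansion of the limit, and
  \<open>weak_seqs_closed\<close> applies. Limits from the right are reduced to these by reflection.
  The bound \<open>a\<close> may belong to another base; (v) uses this with \<open>a\<close> =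
  \<alpha>(q_1).\<close>

lemma closed_val_weak_seqs:
  assumes quasi: "\<And>c. c \<in> weak_seqs M a \<Longrightarrow> quasi_seq M q c"
  shows "closed (val q ` weak_seqs M a)"
proof -
  let ?S = "val q ` weak_seqs M a"
  have SJ: "?S \<subseteq> J M q" using val_in_J[OF q] weak_seqsD(1) by blast
  have left: "x \<in> ?S" if x: "x \<in> J M q" and near: "\<And>e. 0 < e \<Longrightarrow> \<exists>y\<in>?S. x - e < y \<and> y < x" for x
  proof -
    define c where "c = quasi_greedy M q x"
    have c: "quasi_seq M q c" "val q c = x" using quasi_greedy[OF x] by (auto simp: c_def)
    have cd: "c \<in> digit_seqs M" using c(1) by (rule quasi_digits)
    obtain y where "y \<in> ?S" "y < x" using near[of 1] by auto
    then have "0 < x" using SJ by (auto simp: J_def)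
    then have "c \<noteq> (\<lambda>_. 0)" using c(2) by auto
    have "\<exists>d\<in>weak_seqs M a. agree N d c" for N
    proof -
      have "psum q N c < x"
        using psum_less_val[OF q cd _ \<open>c \<noteq> (\<lambda>_. 0)\<close>] c by (auto simp: quasi_seq_def)
      then obtain d where d: "d \<in> weak_seqs M a" "psum q N c < val q d" "val q d < x"
        using near[of "x - psum q N c"] by auto
      have "d \<sqsubset> c" using quasi_val_less_iff[OF q quasi[OF d(1)] c(1)] d(3) c(2) by simp
      then show ?thesis using quasi_agree_left[OF q quasi[OF d(1)] cd _ d(2)] d(1) by blast
    qed
    then have "c \<in> weak_seqs M a" by (rule weak_seqs_closed)
    then show ?thesis using c(2) by blast
  qed
  have reflect: "real M / (q - 1) - x \<in> ?S" if "x \<in> ?S" for x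
  proof -
    obtain c where "c \<in> weak_seqs M a" "x = val q c" using \<open>x \<in> ?S\<close> by blast
    then show ?thesis
      using weak_seqs_reflect val_reflect[OF q weak_seqsD(1)] by (metis image_eqI)
  qed
  have "x \<in> ?S" if x: "x \<in> closure ?S" for x
  proof (rule ccontr)
    assume nx: "x \<notin> ?S"
    have "closure ?S \<subseteq> J M q" using SJ by (intro closure_minimal) (auto simp: J_def)
    then have xJ: "x \<in> J M q" using x by auto
    then obtain e1 where e1: "0 < e1" "\<And>y. y \<in> ?S \<Longrightarrow> x - e1 < y \<Longrightarrow> y < x \<Longrightarrow> False"
      using left nx by blast
    define x' where "x' = real M / (q - 1) - x"
    have "x' \<in> J M q" using xJ by (auto simp: J_def x'_def)
    moreover have "x' \<notin> ?S" using reflect[of x'] nx by (auto simp: x'_def)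
    ultimately obtain e2 where e2: "0 < e2" "\<And>y. y \<in> ?S \<Longrightarrow> x' - e2 < y \<Longrightarrow> y < x' \<Longrightarrow> False"
      using left by blast
    have right: False if "y \<in> ?S" "x < y" "y < x + e2" for y
      using e2(2)[OF reflect[OF that(1)]] that by (simp add: x'_def)
    obtain y where y: "y \<in> ?S" "dist y x < min e1 e2"
      using x e1(1) e2(1) unfolding closure_approachable by (metis min_less_iff_conj)
    have "y \<noteq> x" using y(1) nx by auto
    then show False using e1(2)[OF y(1)] right[OF y(1)] y(2)
      by (cases "y < x") (auto simp: dist_real_def)
  qed
  then show ?thesis using closure_subset_eq by blast
qed

text \<open>
  A sequence \<open>b\<close> with last nonzero digit at position \<open>n\<close> is the greedy expansion of the left
  endpoint of a gap of \<open>Vq\<close>; the right endpoint has the quasi-greedy expansion \<open>gap_right n b\<close>.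
\<close>

definition gap_left :: "nat \<Rightarrow> (nat \<Rightarrow> nat) \<Rightarrow> nat \<Rightarrow> nat" where
  "gap_left n b = prefix (Suc n) (b(n := b n - 1)) \<frown> \<alpha>"

definition gap_right :: "nat \<Rightarrow> (nat \<Rightarrow> nat) \<Rightarrow> nat \<Rightarrow> nat" where
  "gap_right n b = prefix (Suc n) b \<frown> reflect M \<alpha>"

definition gap :: "nat \<Rightarrow> (nat \<Rightarrow> nat) \<Rightarrow> bool" where
  "gap n b \<longleftrightarrow> greedy_seq M q b \<and> 0 < b n \<and> suffix (Suc n) b = (\<lambda>_. 0)
     \<and> gap_left n b \<in> weak_seqs M \<alpha>"

lemma gap_left_simps:
  "agree n (gap_left n b) b" "gap_left n b n = b n - 1" "suffix (Suc n + k) (gap_left n b) = suffix k \<alpha>"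
  unfolding gap_left_def agree_def splice_nth by (auto simp: fun_eq_iff)

lemma gap_right_simps:
  "agree (Suc n) (gap_right n b) b" "suffix (Suc n + k) (gap_right n b) = reflect M (suffix k \<alpha>)"
  unfolding gap_right_def agree_def splice_nth by (auto simp: fun_eq_iff suffix_reflect reflect_nth)

lemma gap_left_digits:
  assumes "b \<in> digit_seqs M" shows "gap_left n b \<in> digit_seqs M"
proof -
  have "b n - 1 \<le> M" using digit_seqs_le[OF assms, of n] by simp
  then have "b(n := b n - 1) \<in> digit_seqs M" using assms by (simp add: digit_seqs_def)
  then show ?thesis unfolding gap_left_def by (intro splice_digit_seqs alpha_digits)
qed

lemma gap_right_digits: "b \<in> digit_seqs M \<Longrightarrow> gap_right n b \<in> digit_seqs M"
  unfolding gap_right_def by (intro splice_digit_seqs reflect_digit_seqs)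

lemma suffix_index: "j \<le> n \<Longrightarrow> suffix (n - j) (suffix (Suc j) c) = suffix (Suc n) c"
  by simp

text \<open>Since \<open>\<alpha>\<close> has value 1, lowering the last nonzero digit by one and
  appending \<open>\<alpha>\<close> preserves the value. This is the passage from a finite greedy
  expansion to the quasi-greedy one.\<close>

lemma gap_left_quasi:
  assumes b: "greedy_seq M q b" "0 < b n" "suffix (Suc n) b = (\<lambda>_. 0)"
  shows "quasi_seq M q (gap_left n b)" "val q (gap_left n b) = val q b"
proof -
  let ?L = "gap_left n b"
  have bd: "b \<in> digit_seqs M" using b(1) by (rule greedy_seq_digits)
  have "val q b - val q ?L = (real (b n) - real (b n - 1) + 0 - 1) / q ^ Suc n"
    using val_diff_agree[OF q gap_left_digits[OF bd] bd gap_left_simps(1), of n] b(3)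
      gap_left_simps(3)[of n 0 b] by (simp add: gap_left_simps(2) val_alpha)
  then show "val q ?L = val q b" using b(2) by (simp add: of_nat_diff)
  have "suffix (Suc i) ?L \<sqsubseteq> \<alpha>" if i: "?L i < M" for i
  proof (cases "i < n")
    case True
    then have "b i < M" using i agreeD[OF gap_left_simps(1)] by simp
    then have "suffix (Suc i) b \<sqsubset> \<alpha>" using b(1) by (simp add: greedy_seq_iff)
    then have "below (n - i) (suffix (Suc i) ?L) \<alpha>"
      using True b(2) gap_left_simps(2)[of n b]
      by (intro below_lower[OF lex_le_imp[OF lex.less_imp_le] agree_suffix[OF gap_left_simps(1)[of n b], of "Suc i" "n - Suc i"]]) auto
    then show ?thesis by (intro lex.less_imp_le below_imp_less)
  next
    case False
    then show ?thesis using gap_left_simps(3)[of n "i - n" b] alpha_suffix_le[of "i - n"] by simp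
  qed
  moreover have "\<not> finite_seq ?L"
  proof
    assume "finite_seq ?L"
    moreover have s: "suffix (Suc n) ?L = \<alpha>" using gap_left_simps(3)[of n 0 b] by simp
    ultimately have "finite_seq \<alpha>" using finite_seq_suffix[of ?L "Suc n" 0] alpha_0 by simp
    then show False using alpha_not_finite by blast
  qed
  ultimately show "quasi_seq M q ?L" unfolding quasi_seq_iff using gap_left_digits[OF bd] by blast
qed

text \<open>The removed tail is nonzero because \<open>c\<close> is infinite. Cutting therefore
  lowers every earlier tail strictly, and the weak quasi-greedy inequalities become strict.\<close>

lemma truncated_greedy:
  assumes c: "quasi_seq M q c" "0 < c n" shows "greedy_seq M q (prefix (Suc n) c \<frown> (\<lambda>_. 0))"
  unfolding greedy_seq_iff
proof (intro conjI allI impI)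
  let ?b = "prefix (Suc n) c \<frown> (\<lambda>_. 0)"
  have cd: "c \<in> digit_seqs M" using c(1) by (rule quasi_digits)
  show "?b \<in> digit_seqs M" using cd by (intro splice_digit_seqs) (auto simp: digit_seqs_def)
  fix i assume i: "?b i < M"
  have zero: "(\<lambda>_. 0) \<sqsubset> \<alpha>" using zero_le[of \<alpha>] alpha_nonzero by (auto simp: lex_le_def)
  show "suffix (Suc i) ?b \<sqsubset> \<alpha>"
  proof (cases "i < n")
    case True
    then have "c i < M" using i by (simp add: splice_nth)
    have ag: "agree (n - i) (suffix (Suc i) ?b) (suffix (Suc i) c)"
      by (rule agree_suffix[OF agree_splice]) (use True in simp)
    obtain k where "suffix (Suc n) c k \<noteq> 0"
      using not_finite_seqD[of c n] c by (auto simp: quasi_seq_def)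
    then have "suffix (Suc n) c \<noteq> (\<lambda>_. 0)" by metis
    then have "(\<lambda>_. 0) \<sqsubset> suffix (Suc n) c" using zero_le[of "suffix (Suc n) c"] unfolding lex_le_def by metis
    moreover have "suffix (n - i) (suffix (Suc i) ?b) = (\<lambda>_. 0)" using True by (simp add: fun_eq_iff)
    moreover have "suffix (n - i) (suffix (Suc i) c) = suffix (Suc n) c"
      by (rule suffix_index) (use True in simp)
    ultimately have "suffix (Suc i) ?b \<sqsubset> suffix (Suc i) c" using less_fun_suffix[OF ag] by metis
    also have "\<dots> \<sqsubseteq> \<alpha>" using c(1) \<open>c i < M\<close> by (simp add: quasi_seq_iff)
    finally show ?thesis .
  next
    case False
    then have "suffix (Suc i) ?b = suffix (Suc i - Suc n) (\<lambda>_. 0)" by (intro suffix_splice_ge) simp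
    then have "suffix (Suc i) ?b = (\<lambda>_. 0)" by (simp only: suffix_const)
    then show ?thesis using zero by metis
  qed
qed

end

section \<open>Gaps for a base in V other than M + 1\<close>

locale V_base = base +
  assumes V: "q \<in> V M" and top: "q \<noteq> real M + 1"
begin

lemma reflect_suffix_le: "reflect M (suffix k \<alpha>) \<sqsubseteq> \<alpha>"
  using V V_iff by simp

lemma reflect_le_suffix: "reflect M \<alpha> \<sqsubseteq> suffix k \<alpha>"
  using reflect_suffix_le[of k] reflect_le_swap[of "suffix k \<alpha>" M \<alpha>] by simp

lemma Vq: "Vq M q = val q ` weak_seqs M \<alpha>"
  by (rule Vq_eq[OF top])

lemma weak_quasi: "c \<in> weak_seqs M \<alpha> \<Longrightarrow> quasi_seq M q c"
  using weak_seqs_iff[OF top] by blast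

lemma closed_Vq: "closed (Vq M q)"
  unfolding Vq by (rule closed_val_weak_seqs[OF weak_quasi])

lemma Vq_subset_J: "Vq M q \<subseteq> J M q"
  unfolding Vq using val_in_J[OF q] weak_seqsD(1) by blast

lemma Uq_subset_Vq: "Uq M q \<subseteq> Vq M q"
  unfolding Vq Uq_eq using strict_seqs_subset by blast

text \<open>Before position \<open>n\<close> the upper bounds come from the greedy sequence
  \<open>b\<close>, the lower bounds from \<open>gap_left n b\<close>, whose digit at
  \<open>n\<close> is smaller. The appended reflection of \<open>\<alpha>\<close> does not exceed
  any tail of \<open>\<alpha>\<close>, which is where \<open>q \<in> V M\<close> enters.\<close>

lemma gap_right_weak:
  assumes "gap n b" shows "gap_right n b \<in> weak_seqs M \<alpha>"
  unfolding weak_seqs_def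
proof (intro CollectI conjI allI impI)
  let ?R = "gap_right n b" and ?L = "gap_left n b"
  have b: "greedy_seq M q b" "0 < b n" "?L \<in> weak_seqs M \<alpha>" using assms by (auto simp: gap_def)
  have bd: "b \<in> digit_seqs M" using b(1) by (rule greedy_seq_digits)
  show "?R \<in> digit_seqs M" by (rule gap_right_digits[OF bd])
  fix i
  have ag: "agree (n - i) (suffix (Suc i) ?R) (suffix (Suc i) b)" if "i < n"
    by (rule agree_suffix[OF gap_right_simps(1)]) (use that in simp)
  show "suffix (Suc i) ?R \<sqsubseteq> \<alpha>" if i: "?R i < M"
  proof (cases "i < n")
    case True
    have "b i < M" using i agreeD[OF gap_right_simps(1), of i n b] True by simp
    then have "suffix (Suc i) b \<sqsubset> \<alpha>" using b(1) by (simp add: greedy_seq_iff)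
    then have "below (n - i) (suffix (Suc i) ?R) \<alpha> \<or> agree (n - i) (suffix (Suc i) ?R) \<alpha>"
      using lex_le_imp[OF lex.less_imp_le] below_cong[OF ag[OF True] agree_refl] agree_trans[OF ag[OF True]] by blast
    moreover have "suffix (n - i) (suffix (Suc i) ?R) = reflect M \<alpha>"
      using suffix_index[of i n ?R] True gap_right_simps(2)[of n 0 b] by simp
    then have "suffix (n - i) (suffix (Suc i) ?R) \<sqsubseteq> suffix (n - i) \<alpha>"
      using reflect_le_suffix[of "n - i"] by metis
    ultimately show ?thesis using lex_le_split[of "suffix (Suc i) ?R" \<alpha> "n - i"] by blast
  next
    case False
    then show ?thesis using gap_right_simps(2)[of n "i - n" b] reflect_suffix_le[of "i - n"] by simp
  qed
  show "reflect M (suffix (Suc i) ?R) \<sqsubseteq> \<alpha>" if i: "0 < ?R i"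
  proof (cases "i < n")
    case True
    have "0 < ?L i" using i agreeD[OF gap_right_simps(1), of i n b] agreeD[OF gap_left_simps(1)[of n b] True] True by simp
    then have L: "reflect M (suffix (Suc i) ?L) \<sqsubseteq> \<alpha>" by (rule weak_seqsD(3)[OF b(3)])
    have "agree (n - Suc i) (suffix (Suc i) ?R) (suffix (Suc i) ?L)"
      by (rule agree_suffix[OF agree_trans[OF agree_mono[OF gap_right_simps(1)] agree_sym[OF gap_left_simps(1)[of n b]]]])
        (use True in simp_all)
    then have "below (n - i) (reflect M (suffix (Suc i) ?R)) \<alpha>"
      using True b(2) gap_left_simps(2)[of n b] agreeD[OF gap_right_simps(1)[of n b], of n] digit_seqs_le[OF bd, of n]
      by (intro below_lower[OF lex_le_imp[OF L] agree_reflect]) (auto simp: reflect_nth)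
    then show ?thesis by (intro lex.less_imp_le below_imp_less)
  next
    case False
    then show ?thesis using gap_right_simps(2)[of n "i - n" b] alpha_suffix_le[of "i - n"] by simp
  qed
qed

text \<open>The two endpoints share \<open>n\<close> digits and differ by one in the next, so
  \<open>d\<close> must agree with one of them there. In the first case its tail exceeds
  \<open>\<alpha>\<close>, in the second it falls below the reflection of
  \<open>\<alpha>\<close>.\<close>

lemma gap_no_weak:
  assumes "gap n b" "d \<in> weak_seqs M \<alpha>" "gap_left n b \<sqsubset> d" "d \<sqsubset> gap_right n b" shows False
proof -
  let ?R = "gap_right n b" and ?L = "gap_left n b"
  have b: "0 < b n" using assms(1) by (simp add: gap_def)
  have LR: "agree n ?L ?R"
    using agree_trans[OF gap_left_simps(1) agree_sym[OF agree_mono[OF gap_right_simps(1)]]] by simp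
  have "agree n ?L d"
    using lex_le_imp[OF lex.less_imp_le[OF assms(3)], of n] lex_le_imp[OF lex.less_imp_le[OF assms(4)], of n]
      below_trans below_not_agree LR below_cong agree_refl by blast
  then have Ld: "agree n ?L d" and dR: "agree n d ?R" using agree_trans[OF agree_sym LR] by auto
  have R: "?R n = b n" using agreeD[OF gap_right_simps(1)[of n b], of n] by simp
  have "?L n \<le> d n" using less_fun_first[OF assms(3) Ld] by linarith
  moreover have "d n \<le> ?R n" using less_fun_first[OF assms(4) dR] by linarith
  ultimately consider "d n = ?L n" | "d n = ?R n" using R gap_left_simps(2)[of n b] by linarith
  then show False
  proof cases
    case 1
    then have "agree (Suc n) ?L d" using Ld by (simp add: agree_Suc)
    then have "suffix (Suc n) ?L \<sqsubset> suffix (Suc n) d" using less_fun_suffix assms(3) by blast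
    then have "\<alpha> \<sqsubset> suffix (Suc n) d" using gap_left_simps(3)[of n 0 b] by simp
    moreover have "d n < M"
      using 1 b gap_left_simps(2)[of n b] digit_seqs_le[OF greedy_seq_digits, of M q b n] assms(1)
      by (auto simp: gap_def)
    ultimately show False using weak_seqsD(2)[OF assms(2)] lex.leD by blast
  next
    case 2
    then have "agree (Suc n) d ?R" using dR by (simp add: agree_Suc)
    then have "suffix (Suc n) d \<sqsubset> suffix (Suc n) ?R" using less_fun_suffix assms(4) by blast
    then have "suffix (Suc n) d \<sqsubset> reflect M \<alpha>" using gap_right_simps(2)[of n 0 b] by simp
    moreover have "reflect M (suffix (Suc n) d) \<sqsubseteq> \<alpha>" using weak_seqsD(3)[OF assms(2)] 2 R b by simp
    then have "reflect M \<alpha> \<sqsubseteq> suffix (Suc n) d"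
      using reflect_le_swap[of "suffix (Suc n) d" M \<alpha>] weak_seqsD(1)[OF assms(2)] by simp
    ultimately show False using lex.leD by blast
  qed
qed

lemma gap_properties:
  assumes "gap n b"
  shows "val q b \<in> Vq M q" "val q (gap_right n b) \<in> Vq M q" "val q b < val q (gap_right n b)"
    "{val q b<..<val q (gap_right n b)} \<inter> Vq M q = {}"
    "greedy M q (val q b) = b" "quasi_greedy M q (val q (gap_right n b)) = gap_right n b"
    "val q b \<notin> Uq M q" "val q (gap_right n b) \<notin> Uq M q"
proof -
  let ?R = "gap_right n b" and ?L = "gap_left n b"
  have b: "greedy_seq M q b" "0 < b n" "suffix (Suc n) b = (\<lambda>_. 0)" "?L \<in> weak_seqs M \<alpha>"
    using assms by (auto simp: gap_def)
  have L: "quasi_seq M q ?L" "val q ?L = val q b" using gap_left_quasi[OF b(1-3)] by auto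
  have R: "?R \<in> weak_seqs M \<alpha>" "quasi_seq M q ?R" using gap_right_weak[OF assms] weak_quasi by auto
  show "val q b \<in> Vq M q" unfolding Vq using b(4) L(2)[symmetric] by simp
  show "val q ?R \<in> Vq M q" unfolding Vq using R(1) by simp
  have Rn: "?R n = b n" using agreeD[OF gap_right_simps(1)[of n b], of n] by simp
  have "agree n ?L ?R"
    using agree_trans[OF gap_left_simps(1) agree_sym[OF agree_mono[OF gap_right_simps(1)]]] by simp
  then have "?L \<sqsubset> ?R" unfolding less_fun_agree
    using b(2) Rn gap_left_simps(2)[of n b] by (intro exI[of _ n]) simp
  then show "val q b < val q ?R" using quasi_val_less_iff[OF q L(1) R(2)] L(2) by simp
  have False if d: "d \<in> weak_seqs M \<alpha>" "val q b < val q d" "val q d < val q ?R" for d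
    using gap_no_weak[OF assms d(1)] d(2,3) quasi_val_less_iff[OF q L(1) weak_quasi[OF d(1)]]
      quasi_val_less_iff[OF q weak_quasi[OF d(1)] R(2)] L(2) by simp
  then show "{val q b<..<val q ?R} \<inter> Vq M q = {}" unfolding Vq by auto
  show gr: "greedy M q (val q b) = b" by (rule greedy_eq[OF q b(1)])
  show "quasi_greedy M q (val q ?R) = ?R" by (rule quasi_greedy_eq[OF q R(2)])
  show "val q b \<notin> Uq M q"
  proof
    assume "val q b \<in> Uq M q"
    then obtain c where c: "c \<in> strict_seqs M \<alpha>" "val q b = val q c" unfolding Uq_eq by blast
    then have "greedy_seq M q c" by (simp add: strict_seqs_iff)
    then have "c = b" using greedy_eq[OF q] gr c(2) by metis
    moreover have "finite_seq b" unfolding finite_seq_iff using b(2,3) by (intro exI[of _ n]) simp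
    ultimately show False using strict_seqs_not_finite[OF c(1)] by simp
  qed
  show "val q ?R \<notin> Uq M q"
  proof
    assume "val q ?R \<in> Uq M q"
    then obtain c where c: "c \<in> strict_seqs M \<alpha>" "val q ?R = val q c" unfolding Uq_eq by blast
    then have "c = ?R" using quasi_inj[OF q strict_seqs_quasi[OF c(1)] R(2)] by simp
    then have "reflect M (suffix (Suc n) ?R) \<sqsubset> \<alpha>" using strict_seqsD(3)[of ?R M \<alpha> n] c(1) Rn b(2) by simp
    then show False using gap_right_simps(2)[of n 0 b] by simp
  qed
qed

text \<open>The gap is cut at the least violating position \<open>m\<close>. At earlier nonzero
  digits the lower bounds are strict, which permits lowering the digit at \<open>m\<close>. Equality
  counts as a violation, so that the lemma locates points inside gaps as well as right
  endpoints.\<close>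

lemma first_violation:
  assumes c: "quasi_seq M q c" and viol: "0 < c n" "\<alpha> \<sqsubseteq> reflect M (suffix (Suc n) c)"
  shows "\<exists>n b. gap n b \<and> gap_left n b \<sqsubset> c \<and> c \<sqsubseteq> gap_right n b"
proof -
  define P where "P = (\<lambda>n. 0 < c n \<and> \<alpha> \<sqsubseteq> reflect M (suffix (Suc n) c))"
  define m where "m = (LEAST n. P n)"
  have "P n" using viol by (simp add: P_def)
  then have "P m" unfolding m_def by (rule LeastI)
  then have m: "0 < c m" "\<alpha> \<sqsubseteq> reflect M (suffix (Suc m) c)" by (auto simp: P_def)
  have before: "reflect M (suffix (Suc j) c) \<sqsubset> \<alpha>" if "j < m" "0 < c j" for j
    using not_less_Least[of j P] that unfolding m_def P_def by auto
  have cd: "c \<in> digit_seqs M" using c by (rule quasi_digits)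
  define b where "b = prefix (Suc m) c \<frown> (\<lambda>_. 0)"
  have bc: "agree (Suc m) b c" unfolding b_def by (rule agree_splice)
  have bm: "b m = c m" using agreeD[OF bc, of m] by simp
  let ?R = "gap_right m b" and ?L = "gap_left m b"
  have Lc: "agree m ?L c" using agree_trans[OF gap_left_simps(1) agree_mono[OF bc]] by simp
  have Lm: "?L m = c m - 1" by (simp only: gap_left_simps(2) bm)
  have bd: "greedy_seq M q b" unfolding b_def by (rule truncated_greedy[OF c m(1)])
  have "?L \<in> weak_seqs M \<alpha>" unfolding weak_seqs_def
  proof (intro CollectI conjI allI impI)
    show Ld: "?L \<in> digit_seqs M" by (rule gap_left_digits[OF greedy_seq_digits[OF bd]])
    fix j
    have ag: "agree (m - Suc j) (suffix (Suc j) ?L) (suffix (Suc j) c)" if "j < m"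
      by (rule agree_suffix[OF Lc]) (use that in simp)
    have tail: "suffix (Suc j) ?L = suffix (j - m) \<alpha>" if "m \<le> j"
      using gap_left_simps(3)[of m "j - m" b] that by simp
    show "suffix (Suc j) ?L \<sqsubseteq> \<alpha>" if j: "?L j < M"
    proof (cases "j < m")
      case True
      then have "c j < M" using j agreeD[OF Lc True] by simp
      then have "suffix (Suc j) c \<sqsubseteq> \<alpha>" using c by (simp add: quasi_seq_iff)
      then have "below (m - j) (suffix (Suc j) ?L) \<alpha>"
        using True m(1) Lm
        by (intro below_lower[OF lex_le_imp ag[OF True]]) auto
      then show ?thesis by (intro lex.less_imp_le below_imp_less)
    next
      case False
      then show ?thesis using tail alpha_suffix_le by simp
    qed
    show "reflect M (suffix (Suc j) ?L) \<sqsubseteq> \<alpha>" if j: "0 < ?L j"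
    proof (cases "j < m")
      case True
      then have "0 < c j" using j agreeD[OF Lc True] by simp
      then have less: "reflect M (suffix (Suc j) c) \<sqsubset> \<alpha>" using before True by blast
      \<comment> \<open>If these digits agreed, the strict inequality at \<open>j\<close> would be
        passed on to position \<open>m\<close>, where it fails.\<close>
      have "below (m - j) (reflect M (suffix (Suc j) c)) \<alpha>"
      proof (rule ccontr)
        assume "\<not> ?thesis"
        then have ag2: "agree (m - j) (reflect M (suffix (Suc j) c)) \<alpha>"
          using lex_le_imp[OF lex.less_imp_le[OF less]] by blast
        have "suffix (m - j) (reflect M (suffix (Suc j) c)) = reflect M (suffix (Suc m) c)"
          using True by (simp add: suffix_reflect)
        then have "reflect M (suffix (Suc m) c) \<sqsubset> suffix (m - j) \<alpha>"
          using less_fun_suffix[OF ag2] less by metis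
        also have "\<dots> \<sqsubseteq> \<alpha>" by (rule alpha_suffix_le)
        finally show False using m(2) lex.leD by blast
      qed
      then have bel: "below (Suc (m - Suc j)) (reflect M (suffix (Suc j) c)) \<alpha>"
        using True Suc_diff_Suc by metis
      have "below (m - j) (reflect M (suffix (Suc j) ?L)) \<alpha> \<or> agree (m - j) (reflect M (suffix (Suc j) ?L)) \<alpha>"
        unfolding Suc_diff_Suc[OF True, symmetric]
        by (rule below_raise[OF bel agree_reflect[OF ag[OF True]]])
          (use True Lm m(1) in \<open>simp add: reflect_nth\<close>)
      moreover have "suffix (m - j) (reflect M (suffix (Suc j) ?L)) = reflect M \<alpha>"
        using suffix_index[of j m ?L] True gap_left_simps(3)[of m 0 b] by (simp add: suffix_reflect)
      then have "suffix (m - j) (reflect M (suffix (Suc j) ?L)) \<sqsubseteq> suffix (m - j) \<alpha>"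
        using reflect_le_suffix[of "m - j"] by metis
      ultimately show ?thesis using lex_le_split[of "reflect M (suffix (Suc j) ?L)" \<alpha> "m - j"] by blast
    next
      case False
      then show ?thesis using tail reflect_suffix_le by simp
    qed
  qed
  moreover have "suffix (Suc m) b = (\<lambda>_. 0)" by (simp add: b_def fun_eq_iff)
  ultimately have "gap m b" using bd bm m(1) by (simp add: gap_def)
  moreover have "?L \<sqsubset> c" unfolding less_fun_agree using Lc Lm m(1) by (intro exI[of _ m]) simp
  moreover have "c \<sqsubseteq> ?R"
  proof -
    have ag: "agree (Suc m) c ?R" using agree_trans[OF agree_sym[OF bc] agree_sym[OF gap_right_simps(1)]] .
    have "suffix (Suc m) c \<sqsubseteq> reflect M \<alpha>"
      using m(2) reflect_le_swap[of "reflect M (suffix (Suc m) c)" M \<alpha>] reflect_le_iff[of "reflect M \<alpha>" M "suffix (Suc m) c"] cd by simp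
    then have "suffix (Suc m) c \<sqsubseteq> suffix (Suc m) ?R" using gap_right_simps(2)[of m 0 b] by simp
    then show ?thesis using lex_le_suffix[OF ag] by blast
  qed
  ultimately show ?thesis by blast
qed

lemma gap_around:
  assumes "x \<in> J M q - Vq M q"
  shows "\<exists>n b. gap n b \<and> val q b < x \<and> x < val q (gap_right n b)"
proof -
  define c where "c = quasi_greedy M q x"
  have c: "quasi_seq M q c" "val q c = x" using quasi_greedy assms by (auto simp: c_def)
  have nw: "c \<notin> weak_seqs M \<alpha>" using assms c(2) unfolding Vq by auto
  have cd: "c \<in> digit_seqs M" using c(1) by (rule quasi_digits)
  obtain n where n: "0 < c n" "\<not> reflect M (suffix (Suc n) c) \<sqsubseteq> \<alpha>"
    using nw c(1) cd unfolding weak_seqs_def quasi_seq_iff by auto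
  then obtain m b where g: "gap m b" "gap_left m b \<sqsubset> c" "c \<sqsubseteq> gap_right m b"
    using first_violation[OF c(1) n(1)] lex.less_imp_le by (metis lex.not_le)
  have "c \<noteq> gap_right m b" using gap_right_weak[OF g(1)] nw by auto
  then have "c \<sqsubset> gap_right m b" using g(3) by (simp add: lex_le_def)
  then have "x < val q (gap_right m b)"
    using quasi_val_less_iff[OF q c(1) weak_quasi[OF gap_right_weak[OF g(1)]]] c(2) by simp
  moreover have L: "quasi_seq M q (gap_left m b)" "val q (gap_left m b) = val q b"
    using gap_left_quasi g(1) by (auto simp: gap_def)
  then have "val q b < x" using quasi_val_less_iff[OF q L(1) c(1)] g(2) c(2) by simp
  ultimately show ?thesis using g(1) by blast
qed

lemma gap_from_left:
  assumes x: "x \<in> Vq M q" and fin: "finite_seq (greedy M q x)"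
  shows "\<exists>n. gap n (greedy M q x)"
proof -
  define b where "b = greedy M q x"
  have xJ: "x \<in> J M q" using x Vq_subset_J by blast
  have b: "greedy_seq M q b" "val q b = x" using greedy[OF xJ] by (auto simp: b_def)
  obtain n where n: "b n \<noteq> 0" "suffix (Suc n) b = (\<lambda>_. 0)" using fin by (auto simp: b_def finite_seq_iff)
  have L: "quasi_seq M q (gap_left n b)" "val q (gap_left n b) = val q b"
    using gap_left_quasi[OF b(1) _ n(2)] n(1) by auto
  obtain c where c: "c \<in> weak_seqs M \<alpha>" "x = val q c" using x unfolding Vq by blast
  have "gap_left n b = c" using quasi_inj[OF q L(1) weak_quasi[OF c(1)]] L(2) b(2) c(2) by simp
  then have "gap n b" using b(1) n c(1) by (simp add: gap_def)
  then show ?thesis unfolding b_def by blast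
qed

lemma gap_from_right:
  assumes c: "c \<in> weak_seqs M \<alpha>" and viol: "0 < c n" "reflect M (suffix (Suc n) c) = \<alpha>"
  shows "\<exists>n b. gap n b \<and> gap_right n b = c"
proof -
  obtain m b where g: "gap m b" "gap_left m b \<sqsubset> c" "c \<sqsubseteq> gap_right m b"
    using first_violation[OF weak_quasi[OF c] viol(1)] viol(2) by auto
  then have "\<not> c \<sqsubset> gap_right m b" using gap_no_weak c by blast
  then have "c = gap_right m b" using g(3) by (auto simp: lex_le_def)
  then show ?thesis using g(1) by blast
qed

text \<open>An infinite greedy expansion is also quasi-greedy and thus equals \<open>c\<close>. For
  a weak sequence the greedy inequalities can fail only through equality, that is, through a tail
  \<open>\<alpha>\<close> after a digit below \<open>M\<close>.\<close>

lemma greedy_infinite_iff: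
  assumes c: "c \<in> weak_seqs M \<alpha>"
  shows "\<not> finite_seq (greedy M q (val q c)) \<longleftrightarrow> (\<forall>n. c n < M \<longrightarrow> suffix (Suc n) c \<noteq> \<alpha>)"
    and "\<not> finite_seq (greedy M q (val q c)) \<Longrightarrow> greedy M q (val q c) = c"
proof -
  have cd: "c \<in> digit_seqs M" using c by (rule weak_seqsD)
  define b where "b = greedy M q (val q c)"
  have b: "greedy_seq M q b" "val q b = val q c"
    using greedy[OF val_in_J[OF q cd]] by (auto simp: b_def)
  have eq: "b = c" if "\<not> finite_seq b"
  proof -
    have "quasi_seq M q b" using b(1) that by (auto simp: quasi_seq_def greedy_seq_def less_imp_le)
    then show ?thesis using quasi_inj[OF q _ weak_quasi[OF c]] b(2) by blast
  qed
  then show "\<not> finite_seq (greedy M q (val q c)) \<Longrightarrow> greedy M q (val q c) = c" by (simp add: b_def)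
  have "\<not> finite_seq b \<longleftrightarrow> (\<forall>n. c n < M \<longrightarrow> suffix (Suc n) c \<noteq> \<alpha>)"
  proof
    assume "\<not> finite_seq b"
    then have "greedy_seq M q c" using eq b(1) by simp
    then show "\<forall>n. c n < M \<longrightarrow> suffix (Suc n) c \<noteq> \<alpha>" unfolding greedy_seq_iff using lex.less_irrefl by metis
  next
    assume "\<forall>n. c n < M \<longrightarrow> suffix (Suc n) c \<noteq> \<alpha>"
    then have "greedy_seq M q c" using weak_seqsD(2)[OF c] cd unfolding greedy_seq_iff lex_le_def by blast
    then have "b = c" unfolding b_def by (rule greedy_eq[OF q])
    then show "\<not> finite_seq b" using weak_quasi[OF c] by (simp add: quasi_seq_def)
  qed
  then show "\<not> finite_seq (greedy M q (val q c)) \<longleftrightarrow> (\<forall>n. c n < M \<longrightarrow> suffix (Suc n) c \<noteq> \<alpha>)"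
    by (simp add: b_def)
qed

text \<open>Links the position \<open>n\<close> with the words of the theorem: the last nonzero
  digit is unique, so \<open>w\<close> has length n + 1.\<close>

lemma gap_word:
  assumes "gap n b" "b = w \<frown> (\<lambda>_. 0)" "w \<noteq> []" "0 < last w"
  shows "gap_right n b = w \<frown> reflect M \<alpha>"
proof -
  have last: "b (length w - 1) = last w" using assms(2,3) by (simp add: last_conv_nth)
  have beyond: "b i = 0" if "length w \<le> i" for i using assms(2) that by simp
  have "0 < b n" "suffix (Suc n) b = (\<lambda>_. 0)" using assms(1) by (auto simp: gap_def)
  then have "n < length w" using beyond[of n] by (metis less_irrefl not_less)
  moreover have "\<not> n < length w - 1"
  proof
    assume "n < length w - 1"
    then have "Suc n + (length w - 1 - Suc n) = length w - 1" by linarith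
    then have "b (length w - 1) = 0"
      using fun_cong[OF \<open>suffix (Suc n) b = (\<lambda>_. 0)\<close>, of "length w - 1 - Suc n"] unfolding suffix_nth by metis
    then show False using last assms(4) by simp
  qed
  ultimately have "Suc n = length w" by simp
  then show ?thesis unfolding gap_right_def assms(2) by simp
qed

end

section \<open>Topology of the univoque sets\<close>

lemma (in base) closure_Uq_top:
  assumes top: "q = real M + 1"
  shows "closure (Uq M q) = Vq M q \<and> Vq M q = J M q \<and> J M q = {0..1}"
proof -
  have J: "J M q = {0..1}" using top M by (simp add: J_def)
  have "{0..1} \<subseteq> closure (Uq M q)"
  proof
    fix x :: real assume "x \<in> {0..1}"
    then have "x \<in> J M q" using J by simp
    then obtain c where c: "quasi_seq M q c" "val q c = x" using quasi_seq_exists by blast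
    have cd: "c \<in> digit_seqs M" using c(1) by (rule quasi_digits)
    \<comment> \<open>Here \<open>\<alpha>\<close> is constantly \<open>M\<close>, so strict
      admissibility only asks that no tail be constantly 0 or constantly \<open>M\<close>. An
      alternating end guarantees this after any prefix.\<close>
    define e where "e = (\<lambda>i::nat. if even i then 0 else M)"
    have ed: "e \<in> digit_seqs M" by (simp add: e_def digit_seqs_def)
    have e2: "e (2 * i) = 0" "e (2 * i + 1) = M" for i by (simp_all add: e_def)
    have "\<exists>d\<in>strict_seqs M \<alpha>. agree N d c" for N
    proof -
      let ?d = "prefix N c \<frown> e"
      have dd: "?d \<in> digit_seqs M" by (rule splice_digit_seqs[OF cd ed])
      have d: "?d (N + 2 * i) = 0" "?d (N + (2 * i + 1)) = M" for i
        using e2[of i] by (simp_all add: splice_nth)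
      have ne: "suffix k ?d \<noteq> (\<lambda>_. M)" "suffix k ?d \<noteq> (\<lambda>_. 0)" for k
      proof -
        have "k + (N + k) = N + 2 * k" "k + (N + k + 1) = N + (2 * k + 1)" by simp_all
        then have s: "suffix k ?d (N + k) = 0" "suffix k ?d (N + k + 1) = M"
          using d[of k] unfolding suffix_nth by metis+
        show "suffix k ?d \<noteq> (\<lambda>_. M)"
        proof
          assume "suffix k ?d = (\<lambda>_. M)"
          from fun_cong[OF this, of "N + k"] show False unfolding s using M by simp
        qed
        show "suffix k ?d \<noteq> (\<lambda>_. 0)"
        proof
          assume "suffix k ?d = (\<lambda>_. 0)"
          from fun_cong[OF this, of "N + k + 1"] show False unfolding s using M by simp
        qed
      qed
      have up: "suffix k ?d \<sqsubset> \<alpha>" for k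
        using ne(1)[of k] le_const_M[OF suffix_digit_seqs[OF dd], of k]
        unfolding alpha_top[OF top] lex_le_def by blast
      have down: "reflect M (suffix k ?d) \<sqsubset> \<alpha>" for k
      proof -
        have "reflect M (suffix k ?d) \<noteq> (\<lambda>_. M)"
        proof
          assume "reflect M (suffix k ?d) = (\<lambda>_. M)"
          then have "reflect M (reflect M (suffix k ?d)) = (\<lambda>_. 0)" by simp
          then show False using ne(2)[of k] reflect_reflect[OF suffix_digit_seqs[OF dd], of k] by metis
        qed
        then show ?thesis using le_const_M[of "reflect M (suffix k ?d)" M]
          unfolding alpha_top[OF top] lex_le_def by simp
      qed
      have "?d \<in> strict_seqs M \<alpha>" unfolding strict_seqs_def using dd up down by blast
      then show ?thesis using agree_splice by blast
    qed
    then have "val q c \<in> closure (val q ` strict_seqs M \<alpha>)"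
      by (intro val_in_closure[OF q cd]) (auto simp: strict_seqs_def)
    then show "x \<in> closure (Uq M q)" using c(2) by (simp add: Uq_eq)
  qed
  moreover have "closure (Uq M q) \<subseteq> {0..1}"
    using J by (intro closure_minimal) (auto simp: Uq_def)
  ultimately show ?thesis using J top by (auto simp: Vq_def)
qed

context V_base
begin

lemma zero_M_strict: "(\<lambda>_. 0) \<in> strict_seqs M \<alpha>" "(\<lambda>_. M) \<in> strict_seqs M \<alpha>"
proof -
  have "(\<lambda>_. 0) \<sqsubset> \<alpha>" using zero_le[of \<alpha>] alpha_nonzero by (auto simp: lex_le_def)
  then show 0: "(\<lambda>_. 0) \<in> strict_seqs M \<alpha>" by (simp add: strict_seqs_def digit_seqs_def)
  show "(\<lambda>_. M) \<in> strict_seqs M \<alpha>" using strict_seqs_reflect[OF 0] by simp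
qed

lemma endpoints_Uq: "0 \<in> Uq M q" "real M / (q - 1) \<in> Uq M q"
  unfolding Uq_eq using zero_M_strict val_const_M[OF q, of M] val_zero[of q] by (metis image_eqI)+

lemma gap_free: "gap n b \<Longrightarrow> val q b < y \<Longrightarrow> y < val q (gap_right n b) \<Longrightarrow> y \<notin> Vq M q"
  using gap_properties(4) by (meson disjoint_iff greaterThanLessThan_iff)

lemma gap_component:
  assumes "gap n b"
  shows "{val q b<..<val q (gap_right n b)} \<in> components (J M q - Vq M q)"
proof (rule interval_component)
  note g = gap_properties[OF assms]
  show "{val q b<..<val q (gap_right n b)} \<subseteq> J M q - Vq M q"
    using g(1,2,4) Vq_subset_J by (fastforce simp: J_def)
qed (use gap_properties[OF assms] in auto)

lemma component_gap:
  assumes C: "C \<in> components (J M q - Vq M q)"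
  obtains n b where "gap n b" "C = {val q b<..<val q (gap_right n b)}"
proof -
  obtain x where x: "x \<in> C" using in_components_nonempty[OF C] by blast
  then have "x \<in> J M q - Vq M q" using in_components_subset[OF C] by blast
  then obtain n b where g: "gap n b" "val q b < x" "x < val q (gap_right n b)" using gap_around by blast
  have "C = {val q b<..<val q (gap_right n b)}"
    by (rule component_is_interval[OF C x g(2,3) gap_component[OF g(1)]])
  then show ?thesis using that g(1) by blast
qed

lemma interval_gap:
  assumes "l < r" "{l<..<r} \<in> components (J M q - Vq M q)"
  obtains n b where "gap n b" "l = val q b" "r = val q (gap_right n b)"
proof -
  obtain n b where g: "gap n b" "{l<..<r} = {val q b<..<val q (gap_right n b)}"
    using component_gap[OF assms(2)] by blast
  have "l = val q b \<and> r = val q (gap_right n b)"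
    using g(2) assms(1) gap_properties(3)[OF g(1)]
    by (metis closure_greaterThanLessThan Icc_eq_Icc less_imp_le)
  then show ?thesis using that g(1) by blast
qed

lemma open_J_diff_Vq: "open (J M q - Vq M q)"
proof -
  have e: "0 \<in> Vq M q" "real M / (q - 1) \<in> Vq M q" using endpoints_Uq Uq_subset_Vq by blast+
  have "x \<in> {0<..<real M / (q - 1)}" if "x \<in> J M q - Vq M q" for x
  proof -
    have "x \<noteq> 0" "x \<noteq> real M / (q - 1)" using that e by (metis DiffD2)+
    then show ?thesis using that by (simp add: J_def)
  qed
  moreover have "{0<..<real M / (q - 1)} \<subseteq> J M q" by (simp add: J_def greaterThanLessThan_subseteq_atLeastAtMost_iff)
  ultimately have "J M q - Vq M q = {0<..<real M / (q - 1)} - Vq M q" by blast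
  then show ?thesis using closed_Vq by (simp add: open_Diff)
qed

lemma Aq_infinite: "infinite (Aq M q)"
proof -
  \<comment> \<open>The sequences \<open>0\<^sup>k\<^sup>+\<^sup>1 \<alpha>\<close> have the
    pairwise different values \<open>1 / q ^ Suc k\<close>, which supply infinitely many left
    endpoints.\<close>
  define c where "c = (\<lambda>k. prefix (Suc k) (\<lambda>_. 0) \<frown> \<alpha>)"
  have c_nth: "c k i = (if i < Suc k then 0 else \<alpha> (i - Suc k))" for k i
    unfolding c_def splice_nth ..
  have c_ge: "suffix (Suc k + i) (c k) = suffix i \<alpha>" for k i by (simp add: fun_eq_iff c_nth)
  have cd: "c k \<in> digit_seqs M" for k
    unfolding c_def by (rule splice_digit_seqs[OF _ alpha_digits]) (simp add: digit_seqs_def)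
  have weak: "c k \<in> weak_seqs M \<alpha>" for k unfolding weak_seqs_def
  proof (intro CollectI conjI allI impI)
    fix i
    have tail: "suffix (Suc i) (c k) = suffix (i - k) \<alpha>" if "k \<le> i" using c_ge[of k "i - k"] that by simp
    show "suffix (Suc i) (c k) \<sqsubseteq> \<alpha>"
    proof (cases "k \<le> i")
      case False
      then have "suffix (Suc i) (c k) 0 = 0" by (simp add: c_nth)
      then have "suffix (Suc i) (c k) \<sqsubset> \<alpha>"
        unfolding less_fun_agree using alpha_0 by (intro exI[of _ 0]) (simp only: agree_0)
      then show ?thesis by (rule lex.less_imp_le)
    qed (use tail alpha_suffix_le in simp)
    show "reflect M (suffix (Suc i) (c k)) \<sqsubseteq> \<alpha>" if "0 < c k i"
    proof -
      have "\<not> i < Suc k" using that by (auto simp: c_nth split: if_splits)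
      then show ?thesis using tail reflect_suffix_le by simp
    qed
  qed (rule cd)
  have val_c: "val q (c k) = 1 / q ^ Suc k" for k
  proof -
    have "psum q (Suc k) (c k) = 0" unfolding psum_def c_nth by (intro sum.neutral) simp
    moreover have "suffix (Suc k) (c k) = \<alpha>" using c_ge[of k 0] by simp
    ultimately show ?thesis using val_psum[OF q cd[of k], of "Suc k"] val_alpha by simp
  qed
  have "val q (c k) \<in> Aq M q" for k
  proof -
    have z: "c k k = 0" by (simp add: c_nth)
    have tail: "suffix (Suc k) (c k) = \<alpha>" using c_ge[of k 0] by simp
    have "finite_seq (greedy M q (val q (c k)))"
      using greedy_infinite_iff(1)[OF weak[of k]] z tail M by fastforce
    moreover have "val q (c k) \<in> Vq M q" unfolding Vq using weak by blast
    moreover from calculation obtain n where "gap n (greedy M q (val q (c k)))" using gap_from_left by blast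
    then have "val q (c k) \<notin> Uq M q"
      using gap_properties(7) greedy(2)[OF val_in_J[OF q cd]] by metis
    ultimately show ?thesis by (simp add: Aq_def)
  qed
  moreover have "inj (\<lambda>k. val q (c k))"
    unfolding val_c using q by (intro injI) (simp add: power_inject_exp)
  then have "infinite (range (\<lambda>k. val q (c k)))" by (rule range_inj_infinite)
  ultimately show ?thesis using finite_subset[of "range (\<lambda>k. val q (c k))" "Aq M q"] by blast
qed

lemma left_endpoints:
  "{l. \<exists>r. l < r \<and> {l<..<r} \<in> components (J M q - Vq M q)} = Aq M q"
proof (intro equalityI subsetI)
  fix l assume "l \<in> {l. \<exists>r. l < r \<and> {l<..<r} \<in> components (J M q - Vq M q)}"
  then obtain r where "l < r" "{l<..<r} \<in> components (J M q - Vq M q)" by blast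
  then obtain n b where g: "gap n b" "l = val q b" using interval_gap by metis
  then have "finite_seq b" by (auto simp: gap_def finite_seq_iff)
  then show "l \<in> Aq M q" using gap_properties[OF g(1)] g(2) by (simp add: Aq_def)
next
  fix l assume "l \<in> Aq M q"
  then have l: "l \<in> Vq M q" "finite_seq (greedy M q l)" by (auto simp: Aq_def)
  obtain n where g: "gap n (greedy M q l)" using gap_from_left[OF l] by blast
  have "val q (greedy M q l) = l" using greedy(2) l(1) Vq_subset_J by blast
  then show "l \<in> {l. \<exists>r. l < r \<and> {l<..<r} \<in> components (J M q - Vq M q)}"
    using gap_component[OF g] gap_properties(3)[OF g] by auto
qed

lemma infinite_gaps: "infinite (components (J M q - Vq M q))"
proof
  assume fin: "finite (components (J M q - Vq M q))"
  have "Aq M q \<subseteq> Inf ` components (J M q - Vq M q)"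
  proof
    fix l assume "l \<in> Aq M q"
    then obtain r where lr: "l < r" "{l<..<r} \<in> components (J M q - Vq M q)"
      unfolding left_endpoints[symmetric] by blast
    then have "Inf {l<..<r} = l" by simp
    then show "l \<in> Inf ` components (J M q - Vq M q)" using lr(2) by (metis image_eqI)
  qed
  then show False using Aq_infinite finite_subset[OF _ finite_imageI[OF fin]] by blast
qed

lemma gap_components_are_intervals:
  "\<forall>C \<in> components (J M q - Vq M q). \<exists>xL xR. xL < xR \<and> C = {xL<..<xR}"
proof
  fix C assume "C \<in> components (J M q - Vq M q)"
  then obtain n b where "gap n b" "C = {val q b<..<val q (gap_right n b)}" by (rule component_gap)
  then show "\<exists>xL xR. xL < xR \<and> C = {xL<..<xR}" using gap_properties(3) by blast
qed

lemma disjoint_gaps: "pairwise disjnt (components S)"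
  using pairwise_disjoint_components[of S] by (simp add: pairwise_def disjnt_def)

end

section \<open>Bases in the closure of U: statement (ii)\<close>

locale strict_base = V_base +
  assumes strict: "reflect M (suffix k \<alpha>) \<sqsubset> \<alpha>"
begin

lemma closure_Uq: "closure (Uq M q) = Vq M q"
proof (rule equalityI)
  show "closure (Uq M q) \<subseteq> Vq M q" using Uq_subset_Vq closed_Vq by (rule closure_minimal)
  show "Vq M q \<subseteq> closure (Uq M q)"
  proof
    fix x assume "x \<in> Vq M q"
    then obtain c where c: "c \<in> weak_seqs M \<alpha>" "x = val q c" unfolding Vq by blast
    have "val q c \<in> closure (val q ` strict_seqs M \<alpha>)"
      by (rule val_in_closure[OF q weak_seqsD(1)[OF c(1)] _ weak_seqs_approx[OF strict c(1)]])
        (auto simp: strict_seqs_def)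
    then show "x \<in> closure (Uq M q)" by (simp add: Uq_eq c(2))
  qed
qed

text \<open>The sequence ends with the reflection of \<open>\<alpha>\<close>. If it also had a tail
  \<open>\<alpha>\<close>, one of these tails would contain the other, and some reflected tail of
  \<open>\<alpha>\<close> would equal \<open>\<alpha>\<close>.\<close>

lemma gap_right_greedy:
  assumes g: "gap n b" shows "greedy M q (val q (gap_right n b)) = gap_right n b"
    "\<not> finite_seq (greedy M q (val q (gap_right n b)))"
proof -
  let ?R = "gap_right n b"
  have "suffix (Suc i) ?R \<noteq> \<alpha>" for i
  proof
    assume eq: "suffix (Suc i) ?R = \<alpha>"
    show False
    proof (cases "i < n")
      case True
      then have "suffix (n - i) (suffix (Suc i) ?R) = reflect M \<alpha>"
        using suffix_index[of i n ?R] gap_right_simps(2)[of n 0 b] by simp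
      then have "suffix (n - i) \<alpha> = reflect M \<alpha>" unfolding eq .
      then show False using strict[of "n - i"] by simp
    next
      case False
      then have "reflect M (suffix (i - n) \<alpha>) = \<alpha>" using eq gap_right_simps(2)[of n "i - n" b] by simp
      then show False using strict[of "i - n"] by simp
    qed
  qed
  then show inf: "\<not> finite_seq (greedy M q (val q ?R))"
    using greedy_infinite_iff(1)[OF gap_right_weak[OF g]] by blast
  then show "greedy M q (val q ?R) = ?R" by (rule greedy_infinite_iff(2)[OF gap_right_weak[OF g]])
qed

lemma right_endpoints:
  "{r. \<exists>l. l < r \<and> {l<..<r} \<in> components (J M q - Vq M q)} = Bq M q"
proof (intro equalityI subsetI)
  fix r assume "r \<in> {r. \<exists>l. l < r \<and> {l<..<r} \<in> components (J M q - Vq M q)}"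
  then obtain l where "l < r" "{l<..<r} \<in> components (J M q - Vq M q)" by blast
  then obtain n b where g: "gap n b" "r = val q (gap_right n b)" using interval_gap by metis
  then show "r \<in> Bq M q" using gap_properties[OF g(1)] gap_right_greedy[OF g(1)] by (simp add: Bq_def)
next
  fix r assume "r \<in> Bq M q"
  then have r: "r \<in> Vq M q" "r \<notin> Uq M q" "\<not> finite_seq (greedy M q r)" by (auto simp: Bq_def)
  obtain c where c: "c \<in> weak_seqs M \<alpha>" "r = val q c" using r(1) unfolding Vq by blast
  have "c \<notin> strict_seqs M \<alpha>" using r(2) c(2) unfolding Uq_eq by blast
  moreover have "\<forall>n. c n < M \<longrightarrow> suffix (Suc n) c \<noteq> \<alpha>" using greedy_infinite_iff(1)[OF c(1)] r(3) c(2) by blast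
  ultimately obtain n where n: "0 < c n" "reflect M (suffix (Suc n) c) = \<alpha>"
    using c(1) unfolding strict_seqs_def weak_seqs_def lex_le_def by auto
  obtain m b where g: "gap m b" "gap_right m b = c" using gap_from_right[OF c(1) n] by blast
  then show "r \<in> {r. \<exists>l. l < r \<and> {l<..<r} \<in> components (J M q - Vq M q)}"
    using gap_component[OF g(1)] gap_properties(3)[OF g(1)] c(2) by auto
qed

lemma right_endpoint_greedy:
  assumes "l < r" "{l<..<r} \<in> components (J M q - Vq M q)" "w \<noteq> []" "last w > 0"
    "greedy M q l = w \<frown> (\<lambda>_. 0)"
  shows "greedy M q r = w \<frown> reflect M \<alpha>"
proof -
  obtain n b where g: "gap n b" "l = val q b" "r = val q (gap_right n b)"
    using interval_gap[OF assms(1,2)] .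
  have "b = w \<frown> (\<lambda>_. 0)" using gap_properties(5)[OF g(1)] g(2) assms(5) by simp
  then have "gap_right n b = w \<frown> reflect M \<alpha>" using gap_word[OF g(1) _ assms(3,4)] by blast
  then show ?thesis using gap_right_greedy(1)[OF g(1)] g(3) by simp
qed

end

section \<open>Bases of V outside the closure of U: statement (iii)\<close>

locale periodic_base = V_base +
  assumes not_strict: "\<exists>k. \<not> reflect M (suffix k \<alpha>) \<sqsubset> \<alpha>"
begin

text \<open>Two shifts by m + 1 with a reflection each return to \<open>\<alpha>\<close>, so
  \<open>\<alpha>\<close> is periodic with period 2(m + 1).\<close>

lemma turning_point:
  obtains m where "0 < \<alpha> m" "reflect M (suffix (Suc m) \<alpha>) = \<alpha>"
proof -
  obtain m where m: "0 < \<alpha> m" "\<not> reflect M (suffix (Suc m) \<alpha>) \<sqsubset> \<alpha>"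
    using strict_reflect_all not_strict by blast
  then show ?thesis using that reflect_suffix_le[of "Suc m"] by (auto simp: lex_le_def)
qed

text \<open>By \<open>turning_point\<close> a tail \<open>\<alpha>\<close> is followed, m + 1 digits
  later, by the reflection of \<open>\<alpha>\<close>, and conversely. Equality in one kind of bound
  thus entails equality in the other, and the point is at once a left and a right endpoint.\<close>

lemma two_sided:
  assumes x: "x \<in> Vq M q - Uq M q"
  shows "\<exists>n b. gap n b \<and> val q b = x" "\<exists>n b. gap n b \<and> val q (gap_right n b) = x"
proof -
  obtain c where c: "c \<in> weak_seqs M \<alpha>" "x = val q c" using x unfolding Vq by blast
  have cd: "c \<in> digit_seqs M" using c(1) by (rule weak_seqsD)
  obtain m where m: "0 < \<alpha> m" "reflect M (suffix (Suc m) \<alpha>) = \<alpha>" by (rule turning_point)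
  have m': "suffix (Suc m) \<alpha> = reflect M \<alpha>" using arg_cong[OF m(2), of "reflect M"] by simp
  have up_down: "0 < c (Suc n + m) \<and> reflect M (suffix (Suc (Suc n + m)) c) = \<alpha>"
    if "suffix (Suc n) c = \<alpha>" for n
  proof -
    have "suffix (Suc m) (suffix (Suc n) c) = suffix (Suc (Suc n + m)) c" by simp
    then have "suffix (Suc (Suc n + m)) c = reflect M \<alpha>" using that m' by simp
    moreover have "c (Suc n + m) = \<alpha> m" using fun_cong[OF that, of m] by simp
    ultimately show ?thesis using m(1) by simp
  qed
  have down_up: "c (Suc n + m) < M \<and> suffix (Suc (Suc n + m)) c = \<alpha>"
    if "reflect M (suffix (Suc n) c) = \<alpha>" for n
  proof -
    have eq: "suffix (Suc n) c = reflect M \<alpha>" using arg_cong[OF that, of "reflect M"] cd by simp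
    have "suffix (Suc m) (suffix (Suc n) c) = suffix (Suc (Suc n + m)) c" by simp
    then have "suffix (Suc (Suc n + m)) c = \<alpha>" unfolding eq suffix_reflect m(2) by simp
    moreover have "c (Suc n + m) = M - \<alpha> m" using fun_cong[OF eq, of m] by (simp add: reflect_nth)
    ultimately show ?thesis using m(1) M by simp
  qed
  have "c \<notin> strict_seqs M \<alpha>" using x c(2) unfolding Uq_eq by blast
  then obtain n where "c n < M \<and> suffix (Suc n) c = \<alpha> \<or> 0 < c n \<and> reflect M (suffix (Suc n) c) = \<alpha>"
    using c(1) unfolding strict_seqs_def weak_seqs_def lex_le_def by auto
  then obtain i j where ij: "c i < M" "suffix (Suc i) c = \<alpha>" "0 < c j" "reflect M (suffix (Suc j) c) = \<alpha>"
    using up_down down_up by metis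
  have "finite_seq (greedy M q x)" using greedy_infinite_iff(1)[OF c(1)] ij(1,2) c(2) by blast
  moreover have "x \<in> Vq M q" "val q (greedy M q x) = x" using x greedy(2) Vq_subset_J by auto
  ultimately show "\<exists>n b. gap n b \<and> val q b = x" using gap_from_left by metis
  show "\<exists>n b. gap n b \<and> val q (gap_right n b) = x" using gap_from_right[OF c(1) ij(3,4)] c(2) by metis
qed

text \<open>A point of \<open>Vq\<close> outside \<open>Uq\<close> joins the gap ending there to the
  gap beginning there, so the union of the two gaps with this point is an open neighbourhood
  avoiding \<open>Uq\<close>.\<close>

lemma open_J_diff_Uq: "open (J M q - Uq M q)"
proof -
  have "\<exists>e>0. ball x e \<subseteq> J M q - Uq M q" if x: "x \<in> J M q - Uq M q" for x
  proof (cases "x \<in> Vq M q")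
    case True
    then have xV: "x \<in> Vq M q - Uq M q" using x by blast
    obtain n b where r: "gap n b" "val q b = x" using two_sided(1)[OF xV] by blast
    obtain m d where l: "gap m d" "val q (gap_right m d) = x" using two_sided(2)[OF xV] by blast
    have "{val q d<..<val q (gap_right n b)} \<subseteq> J M q - Uq M q"
    proof
      fix y assume y: "y \<in> {val q d<..<val q (gap_right n b)}"
      then have "y \<in> J M q" using gap_properties(1)[OF l(1)] gap_properties(2)[OF r(1)] Vq_subset_J
        by (force simp: J_def)
      moreover have "y \<notin> Uq M q"
      proof (cases "y = x")
        case False
        then have "y \<notin> Vq M q"
          using y gap_free[OF l(1), of y] gap_free[OF r(1), of y] l(2) r(2) by (cases "y < x") auto
        then show ?thesis using Uq_subset_Vq by blast
      qed (use x in blast)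
      ultimately show "y \<in> J M q - Uq M q" by blast
    qed
    moreover have "x \<in> {val q d<..<val q (gap_right n b)}"
      using gap_properties(3)[OF l(1)] gap_properties(3)[OF r(1)] l(2) r(2) by simp
    then obtain e where "0 < e" "ball x e \<subseteq> {val q d<..<val q (gap_right n b)}"
      using openE[OF open_greaterThanLessThan] by metis
    ultimately show ?thesis by (meson order_trans)
  next
    case False
    then have "x \<in> J M q - Vq M q" using x by blast
    then obtain e where "0 < e" "ball x e \<subseteq> J M q - Vq M q"
      using openE[OF open_J_diff_Vq] by metis
    then show ?thesis using Uq_subset_Vq by blast
  qed
  then show ?thesis by (simp add: open_contains_ball)
qed

lemma closed_Uq: "closed (Uq M q)"
proof -
  have "Uq M q = J M q - (J M q - Uq M q)" by (auto simp: Uq_def)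
  moreover have "closed (J M q)" by (simp add: J_def)
  ultimately show ?thesis using open_J_diff_Uq by (metis closed_Diff)
qed

lemma component_sequence:
  assumes C: "C \<in> components (J M q - Uq M q)"
  shows "\<exists>xL xR. xL < xR \<and> C = {xL<..<xR} \<and> infinite (C \<inter> Vq M q)
    \<and> (\<exists>x :: int \<Rightarrow> real. strict_mono x \<and> range x = C \<inter> Vq M q
        \<and> (x \<longlongrightarrow> xL) at_bot \<and> (x \<longlongrightarrow> xR) at_top
        \<and> (\<forall>m w. w \<noteq> [] \<and> last w > 0 \<and> greedy M q (x m) = w \<frown> (\<lambda>_. 0)
            \<longrightarrow> quasi_greedy M q (x (m + 1)) = w \<frown> reflect M \<alpha>))"
proof -
  let ?W = "J M q - Uq M q"
  have sub: "C \<subseteq> ?W" using in_components_subset[OF C] .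
  have "?W \<subseteq> {0..real M / (q - 1)}" by (auto simp: J_def)
  then obtain l r where lr: "l < r" "C = {l<..<r}"
    using bounded_open_component[OF open_J_diff_Uq _ C] by metis
  \<comment> \<open>Endpoints of gaps lie outside \<open>Uq\<close>, so a closed gap that meets
    \<open>C\<close> is contained in \<open>C\<close>. Hence successors and predecessors in
    \<open>Vq\<close> never leave \<open>C\<close>.\<close>
  have join: "{val q b..val q (gap_right n b)} \<subseteq> C"
    if g: "gap n b" and y: "y \<in> C" "val q b \<le> y" "y \<le> val q (gap_right n b)" for n b y
  proof (rule components_maximal[OF C])
    show "connected {val q b..val q (gap_right n b)}" by (rule connected_Icc)
    show "C \<inter> {val q b..val q (gap_right n b)} \<noteq> {}" using y by auto
    show "{val q b..val q (gap_right n b)} \<subseteq> ?W"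
    proof
      fix z assume z: "z \<in> {val q b..val q (gap_right n b)}"
      have "z \<in> J M q" using z gap_properties(1,2)[OF g] Vq_subset_J by (force simp: J_def)
      moreover have "z \<notin> Uq M q"
      proof (cases "z = val q b \<or> z = val q (gap_right n b)")
        case False
        then have "z \<notin> Vq M q" using z gap_free[OF g, of z] by auto
        then show ?thesis using Uq_subset_Vq by blast
      qed (use gap_properties(7,8)[OF g] in auto)
      ultimately show "z \<in> ?W" by blast
    qed
  qed
  have "\<exists>x0. x0 \<in> C \<inter> Vq M q"
  proof -
    obtain y where y: "y \<in> C" using in_components_nonempty[OF C] by blast
    show ?thesis
    proof (cases "y \<in> Vq M q")
      case False
      then obtain n b where g: "gap n b" "val q b < y" "y < val q (gap_right n b)"
        using gap_around[of y] y sub by blast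
      then have "val q b \<in> C" using join[OF g(1) y] by auto
      then show ?thesis using gap_properties(1)[OF g(1)] by blast
    qed (use y in blast)
  qed
  then obtain x0 where x0: "x0 \<in> C \<inter> Vq M q" by blast
  have succ: "\<exists>w\<in>C \<inter> Vq M q. v < w \<and> {v<..<w} \<inter> Vq M q = {}" if v: "v \<in> C \<inter> Vq M q" for v
  proof -
    have "v \<in> Vq M q - Uq M q" using v sub by blast
    then obtain n b where g: "gap n b" "val q b = v" using two_sided(1) by blast
    note p = gap_properties[OF g(1)]
    have "val q (gap_right n b) \<in> C" using join[OF g(1), of v] v g(2) p(3) by auto
    then show ?thesis using p(2,3,4) g(2) by (intro bexI[of _ "val q (gap_right n b)"]) auto
  qed
  have pred: "\<exists>w\<in>C \<inter> Vq M q. w < v \<and> {w<..<v} \<inter> Vq M q = {}" if v: "v \<in> C \<inter> Vq M q" for v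
  proof -
    have "v \<in> Vq M q - Uq M q" using v sub by blast
    then obtain n b where g: "gap n b" "val q (gap_right n b) = v" using two_sided(2) by blast
    note p = gap_properties[OF g(1)]
    have "val q b \<in> C" using join[OF g(1), of v] v g(2) p(3) by auto
    then show ?thesis using p(1,3,4) g(2) by (intro bexI[of _ "val q b"]) auto
  qed
  obtain x :: "int \<Rightarrow> real" where x: "strict_mono x" "range x = C \<inter> Vq M q"
    "(x \<longlongrightarrow> l) at_bot" "(x \<longlongrightarrow> r) at_top" "\<And>m. {x m<..<x (m + 1)} \<inter> Vq M q = {}"
    by (rule discrete_sequence[OF closed_Vq lr(2) x0 succ pred], assumption, assumption, rule that)
  have "infinite (range x)" 
  proof
    assume "finite (range x)"
    then have "finite (UNIV :: int set)"
      using strict_mono_eq[OF x(1)] by (intro finite_imageD[of x UNIV]) (auto simp: inj_def)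
    then show False using infinite_UNIV_int by blast
  qed
  then have inf: "infinite (C \<inter> Vq M q)" using x(2) by simp
  have word: "quasi_greedy M q (x (m + 1)) = w \<frown> reflect M \<alpha>"
    if w: "w \<noteq> []" "last w > 0" "greedy M q (x m) = w \<frown> (\<lambda>_. 0)" for m w
  proof -
    have xm: "x m \<in> Vq M q - Uq M q" "x (m + 1) \<in> Vq M q" using x(2) sub by blast+
    obtain n b where g: "gap n b" "val q b = x m" using two_sided(1)[OF xm(1)] by blast
    note p = gap_properties[OF g(1)]
    have "x m < x (m + 1)" using x(1) by (simp add: strict_mono_less)
    then have "x (m + 1) = val q (gap_right n b)"
      using x(5)[of m] p(2,3) gap_free[OF g(1), of "x (m + 1)"] g(2) xm(2)
      by (metis disjoint_iff greaterThanLessThan_iff linorder_neqE_linordered_idom)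
    moreover have "b = w \<frown> (\<lambda>_. 0)" using p(5) g(2) w(3) by simp
    then have "gap_right n b = w \<frown> reflect M \<alpha>" using gap_word[OF g(1) _ w(1,2)] by blast
    ultimately show ?thesis using p(6) by simp
  qed
  show ?thesis
    by (rule exI[of _ l], rule exI[of _ r], intro conjI lr inf, rule exI[of _ x], intro conjI x(1-4))
      (intro allI impI, elim conjE, rule word)
qed

end

text \<open>The left endpoint belongs to \<open>V\<close>, for otherwise
  \<open>V_left_closed\<close> would let the component extend further left. Its expansion of 1 is
  periodic, as otherwise \<open>nonperiodic_right_limit\<close> would put elements of
  \<open>V\<close> inside the component. The base \<open>r\<close> of
  \<open>periodic_successor\<close> lies in \<open>V\<close> to the right of \<open>q1\<close>,
  hence not before \<open>q2\<close>.\<close>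

lemma component_base:
  assumes M: "1 \<le> M" and less: "q1 < q2" and comp: "{q1<..<q2} \<in> components ({1<..real M + 1} - V M)"
    and "q1 \<noteq> 1"
  obtains r where "V_base M q1" "base M r" "q2 \<le> r" "strict_seqs M (alpha M r) \<subseteq> weak_seqs M (alpha M q1)"
proof -
  let ?D = "{1<..real M + 1} - V M"
  have sub: "{q1<..<q2} \<subseteq> ?D" using in_components_subset[OF comp] .
  have "1 \<le> q1"
  proof (rule ccontr)
    assume "\<not> 1 \<le> q1"
    then have "(q1 + min q2 1) / 2 \<in> {q1<..<q2}" "(q1 + min q2 1) / 2 \<le> 1" using less by (auto simp: min_def)
    then show False using sub by fastforce
  qed
  then have q1: "1 < q1" using assms(4) by simp
  have q2: "q2 \<le> real M + 1"
  proof (rule ccontr)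
    assume "\<not> q2 \<le> real M + 1"
    then have "(q2 + max q1 (real M + 1)) / 2 \<in> {q1<..<q2}" "real M + 1 < (q2 + max q1 (real M + 1)) / 2"
      using less by (auto simp: max_def)
    then show False using sub by fastforce
  qed
  have no_V: "p \<notin> V M" if "q1 < p" "p < q2" for p using sub that by auto
  interpret base M q1 using M q1 less q2 by (simp add: base_def)
  have V: "q1 \<in> V M"
  proof (rule ccontr)
    assume nV: "q1 \<notin> V M"
    then obtain e where e: "0 < e" "\<And>p. p \<in> V M \<Longrightarrow> q1 - e < p \<Longrightarrow> p < q1 \<Longrightarrow> False"
      using V_left_closed by blast
    define m where "m = max (q1 - e) 1"
    have m: "1 \<le> m" "m < q1" "q1 - e \<le> m" using e(1) q1 by (auto simp: m_def)
    have "{m<..<q2} \<subseteq> ?D"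
    proof
      fix p assume p: "p \<in> {m<..<q2}"
      then have "p \<notin> V M" using no_V[of p] nV e(2)[of p] m(3) by (cases p q1 rule: linorder_cases) auto
      then show "p \<in> ?D" using p m(1) q2 by auto
    qed
    moreover have "{q1<..<q2} \<inter> {m<..<q2} \<noteq> {}" using less m(2) by (auto intro: exI[of _ "(q1 + q2) / 2"] simp: set_eq_iff)
    ultimately have "{m<..<q2} \<subseteq> {q1<..<q2}"
      using components_maximal[OF comp connected_Ioo] by blast
    then show False using less m(2) by auto
  qed
  have top: "q1 \<noteq> real M + 1" using less q2 by simp
  interpret V_base M q1 by unfold_locales (rule V, rule top)
  have "\<exists>k\<ge>1. suffix k (alpha M q1) = alpha M q1"
  proof (rule ccontr)
    assume "\<not> ?thesis"
    then obtain p where "p \<in> V M" "q1 < p" "p < q1 + (q2 - q1)"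
      using nonperiodic_right_limit[OF V top, of "q2 - q1"] less by auto
    then show False using no_V by simp
  qed
  then obtain k where "1 \<le> k" "suffix k (alpha M q1) = alpha M q1" by blast
  then obtain r where r: "base M r" "r \<in> V M" "q1 < r" "strict_seqs M (alpha M r) \<subseteq> weak_seqs M (alpha M q1)"
    using periodic_successor[OF V top] by blast
  then have "q2 \<le> r" using no_V[of r] by (meson not_less)
  then show ?thesis using that[OF V_base_axioms r(1)] r(4) by blast
qed

text \<open>Since \<open>q1 < q \<le> q2 \<le> r\<close>, the strict sequences for \<open>q\<close>
  are squeezed: they contain the weak sequences for \<open>q1\<close> because \<open>alpha\<close>
  increases strictly, and they lie in the strict sequences for \<open>r\<close>, which are weak for
  \<open>q1\<close>. The order isomorphism evaluates the same sequence in base \<open>q1\<close>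
  instead of \<open>q\<close>; \<open>homeomorphic_gaps\<close> extends it to the
  complements.\<close>

lemma stable_between:
  assumes M: "1 \<le> M" and comp: "q1 < q2" "{q1<..<q2} \<in> components ({1<..real M + 1} - V M)" "q1 \<noteq> 1"
    and q: "q \<in> {q1<..q2}" and base: "base M q"
  shows "Uq' M q = Vq' M q1 \<and> open (J M q - Uq M q) \<and> open (J M q1 - Vq M q1)
    \<and> (J M q - Uq M q) homeomorphic (J M q1 - Vq M q1)"
proof -
  obtain r where r: "V_base M q1" "base M r" "q2 \<le> r" "strict_seqs M (alpha M r) \<subseteq> weak_seqs M (alpha M q1)"
    using component_base[OF M comp] .
  interpret V1: V_base M q1 by (rule r(1))
  interpret B: base M q by (rule base)
  let ?Q = "weak_seqs M (alpha M q1)"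
  have "alpha M q \<sqsubseteq> alpha M r" using alpha_le_iff[OF base r(2)] q r(3) by simp
  then have "strict_seqs M (alpha M q) \<subseteq> ?Q" using strict_seqs_mono r(4) by blast
  moreover have "?Q \<subseteq> strict_seqs M (alpha M q)"
    using weak_seqs_strict_seqs alpha_less[OF V1.base_axioms base] q by simp
  ultimately have Q: "strict_seqs M (alpha M q) = ?Q" by blast
  have quasi: "quasi_seq M q c" if "c \<in> ?Q" for c using B.strict_seqs_quasi that Q by blast
  have Uq: "Uq M q = val q ` ?Q" unfolding B.Uq_eq Q ..
  define f where "f = (\<lambda>x. val q1 (quasi_greedy M q x))"
  have f: "f (val q c) = val q1 c" if "c \<in> ?Q" for c
    unfolding f_def using quasi_greedy_eq[OF B.q quasi[OF that]] by simp
  have img: "f ` Uq M q = Vq M q1" unfolding Uq V1.Vq image_image using f by simp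
  have ends: "0 \<in> Uq M q" "real M / (q - 1) \<in> Uq M q"
  proof -
    have "(\<lambda>_. 0) \<in> ?Q" "(\<lambda>_. M) \<in> ?Q" using V1.zero_M_strict strict_seqs_subset by blast+
    then have "val q (\<lambda>_. 0) \<in> Uq M q" "val q (\<lambda>_. M) \<in> Uq M q" unfolding Uq by blast+
    then show "0 \<in> Uq M q" "real M / (q - 1) \<in> Uq M q" using val_const_M[OF B.q, of M] by simp_all
  qed
  have "closed (Uq M q)" unfolding Uq by (rule B.closed_val_weak_seqs[OF quasi])
  moreover have "Uq M q \<subseteq> {0..real M / (q - 1)}" by (auto simp: Uq_def J_def)
  moreover have "closed (f ` Uq M q)" "f ` Uq M q \<subseteq> {0..real M / (q1 - 1)}"
    "0 \<in> f ` Uq M q" "real M / (q1 - 1) \<in> f ` Uq M q"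
    unfolding img using V1.closed_Vq V1.Vq_subset_J V1.endpoints_Uq V1.Uq_subset_Vq by (auto simp: J_def)
  moreover have "f x < f y" if xy: "x \<in> Uq M q" "y \<in> Uq M q" "x < y" for x y
  proof -
    obtain c d where cd: "c \<in> ?Q" "d \<in> ?Q" "x = val q c" "y = val q d" using xy(1,2) unfolding Uq by blast
    then have "c \<sqsubset> d" using quasi_val_less_iff[OF B.q quasi quasi] xy(3) by blast
    then show ?thesis
      using quasi_val_less_iff[OF V1.q V1.weak_quasi V1.weak_quasi] cd f by simp
  qed
  ultimately have "open ({0..real M / (q - 1)} - Uq M q)" "open ({0..real M / (q1 - 1)} - f ` Uq M q)"
    "({0..real M / (q - 1)} - Uq M q) homeomorphic ({0..real M / (q1 - 1)} - f ` Uq M q)"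
    using homeomorphic_gaps[of "Uq M q" 0 "real M / (q - 1)" f 0 "real M / (q1 - 1)"] ends by blast+
  moreover have "Uq' M q = Vq' M q1" unfolding B.Uq'_eq V1.Vq'_eq[OF V1.top] Q ..
  ultimately show ?thesis unfolding img J_def by blast
qed

theorem theorem1p9:
  fixes M :: nat and q :: real
  assumes "M \<ge> 1" and "1 < q" and "q \<le> real M + 1"
  shows
    "(q = real M + 1 \<longrightarrow>
        closure (Uq M q) = Vq M q \<and> Vq M q = J M q \<and> J M q = {0..1})
   \<and> (q \<in> closure (U M) - {real M + 1} \<longrightarrow>
        J M q - closure (Uq M q) = J M q - Vq M q
      \<and> infinite (components (J M q - Vq M q))
      \<and> pairwise disjnt (components (J M q - Vq M q))
      \<and> J M q - Vq M q = \<Union>(components (J M q - Vq M q))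
      \<and> (\<forall>C \<in> components (J M q - Vq M q). \<exists>xL xR. xL < xR \<and> C = {xL<..<xR})
      \<and> {xL. \<exists>xR. xL < xR \<and> {xL<..<xR} \<in> components (J M q - Vq M q)} = Aq M q
      \<and> {xR. \<exists>xL. xL < xR \<and> {xL<..<xR} \<in> components (J M q - Vq M q)} = Bq M q
      \<and> (\<forall>xL xR w. xL < xR \<and> {xL<..<xR} \<in> components (J M q - Vq M q)
            \<and> w \<noteq> [] \<and> last w > 0 \<and> greedy M q xL = w \<frown> (\<lambda>_. 0)
          \<longrightarrow> greedy M q xR = w \<frown> reflect M (alpha M q)))
   \<and> (q \<in> V M - closure (U M) \<longrightarrow>
        J M q - closure (Uq M q) = J M q - Uq M q
      \<and> open (J M q - Uq M q)
      \<and> (\<forall>C \<in> components (J M q - Uq M q). \<exists>xL xR. xL < xR \<and> C = {xL<..<xR}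
          \<and> infinite (C \<inter> Vq M q)
          \<and> (\<exists>x :: int \<Rightarrow> real.
                strict_mono x \<and> range x = C \<inter> Vq M q
              \<and> (x \<longlongrightarrow> xL) at_bot \<and> (x \<longlongrightarrow> xR) at_top
              \<and> (\<forall>m w. w \<noteq> [] \<and> last w > 0 \<and> greedy M q (x m) = w \<frown> (\<lambda>_. 0)
                  \<longrightarrow> quasi_greedy M q (x (m + 1)) = w \<frown> reflect M (alpha M q)))))
   \<and> (q \<le> q_tilde M \<longrightarrow>
        J M q - Uq M q = {0 <..< real M / (q - 1)})
   \<and> (\<forall>q1 q2. q1 < q2 \<and> {q1<..<q2} \<in> components ({1<..real M + 1} - V M)
          \<and> q1 \<noteq> 1 \<and> q \<in> {q1<..q2}
        \<longrightarrow> Uq' M q = Vq' M q1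
          \<and> open (J M q - Uq M q) \<and> open (J M q1 - Vq M q1)
          \<and> (J M q - Uq M q) homeomorphic (J M q1 - Vq M q1))"
proof -
  let "(_ \<longrightarrow> ?i) \<and> (_ \<longrightarrow> ?ii) \<and> (_ \<longrightarrow> ?iii) \<and> (_ \<longrightarrow> ?iv) \<and> ?v" = ?thesis
  interpret base M q using assms by (simp add: base_def)
  have i: "q = real M + 1 \<longrightarrow> ?i" using closure_Uq_top by blast
  have ii: "q \<in> closure (U M) - {real M + 1} \<longrightarrow> ?ii"
  proof
    assume cl: "q \<in> closure (U M) - {real M + 1}"
    have strict: "reflect M (suffix k \<alpha>) \<sqsubset> \<alpha>" for k using closure_U_strict cl by blast
    interpret strict_base M q
      by unfold_locales (use cl strict V_iff lex.less_imp_le in blast)+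
    show ?ii
      by (intro conjI, simp only: closure_Uq, rule infinite_gaps, rule disjoint_gaps,
          rule Union_components[symmetric], rule gap_components_are_intervals, rule left_endpoints,
          rule right_endpoints, intro allI impI, elim conjE, rule right_endpoint_greedy)
  qed
  have iii: "q \<in> V M - closure (U M) \<longrightarrow> ?iii"
  proof
    assume V: "q \<in> V M - closure (U M)"
    have "q \<noteq> real M + 1" using V top_in_U closure_subset by blast
    moreover have "\<exists>k. \<not> reflect M (suffix k \<alpha>) \<sqsubset> \<alpha>" using V strict_in_closure_U by blast
    ultimately interpret periodic_base M q by unfold_locales (use V in blast)+
    show ?iii
      by (intro conjI ballI, simp only: closure_closed[OF closed_Uq], rule open_J_diff_Uq,
          rule component_sequence)
  qed
  have iv: "q \<le> q_tilde M \<longrightarrow> ?iv"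
  proof
    assume "q \<le> q_tilde M"
    then have "Uq M q = {0, real M / (q - 1)}" by (rule Uq_trivial)
    then show ?iv unfolding J_def by (simp add: set_eq_iff) linarith
  qed
  have v: ?v
    by (intro allI impI, elim conjE, rule stable_between[OF assms(1)]) (assumption | rule base_axioms)+
  show ?thesis by (intro conjI i ii iii iv v)
qed

end
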